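(* Let $d\ge 2$ and let $\mathcal{L}=(L_1,L_2)$ with $L_1,L_2>0$. For every $\mathcal{A}=(\gamma,\beta)$ with $\gamma>0$, $\beta>0$, and every $p>0$, $$\liminf_{\varepsilon\to 0}\ \inf_{\tilde g_\varepsilon}\ \sup_{g\in\mathbb{H}(\mathcal{A},\mathcal{L})}\mathbb{E}_g\Big[\big(\phi_\varepsilon^{-1}(\gamma,\beta)\,\|\tilde g_\varepsilon-g\|_\infty\big)^p\Big]>0,$$ where $\inf_{\tilde g_\varepsilon}$ denotes the infimum over all estimators of $g$ based on the observation $\{X_\varepsilon(t),t\in\mathcal{D}\}$, and where $$\phi_\varepsilon(\gamma,\beta)=\begin{cases}(\varepsilon\sqrt{\ln(1/\varepsilon)})^{\frac{2\gamma}{2\gamma+1+(d-1)/\beta}}, & \text{if }\beta>1,\ \beta\ge d(\gamma-1)+1,\\ (\varepsilon\sqrt{\ln(1/\varepsilon)})^{\frac{2}{2+d/\beta}}, & \text{if }\gamma>1,\ \beta<d(\gamma-1)+1,\\ (\varepsilon\sqrt{\ln(1/\varepsilon)})^{\frac{2}{2+d/(\gamma\beta)}}, & \text{if }(\gamma,\beta)\in(0,1]^2.\end{cases}$$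
   Context: Model. One observes $\{X_\varepsilon(t),t\in\mathcal{D}\}$ satisfying the Gaussian white noise equation $X_\varepsilon(dt)=g(t)\,dt+\varepsilon W(dt)$, $t\in\mathcal{D}$, where $\mathcal{D}$ is a fixed bounded open interval (product of open intervals) in $\mathbb{R}^d$ containing $[-1,1]^d$, $W$ is the standard Brownian sheet in $\mathbb{R}^d$, $0<\varepsilon<1$ is a known noise level, and $g:\mathbb{R}^d\to\mathbb{R}$ is unknown. $\mathbb{E}_g$ is the expectation with respect to the law $\mathbb{P}_g$ of this observation. $\|\cdot\|_\infty$ is the sup-norm on $[-1,1]^d$. Hölder classes. For $\alpha>0$, $L>0$, let $\lfloor\alpha\rfloor$ be the largest integer strictly less than $\alpha$, and for $\vec k=(k_1,\dots,k_d)\in\mathbb{N}^d$ (entries may be $0$) let $|\vec k|=k_1+\dots+k_d$. $\mathbb{H}_d(\alpha,L)$ is the set of all functions $G:\mathbb{R}^d\to\mathbb{R}$ having on $\mathbb{R}^d$ all partial derivatives of order $\lfloor\alpha\rfloor$ and such that $$\sum_{0\le|\vec k|\le\lfloor\alpha\rfloor}\sup_{x\in\mathbb{R}^d}\left|\frac{\partial^{|\vec k|}G(x)}{\partial x_1^{k_1}\cdots\partial x_d^{k_d}}\right|\le L,$$ $$\left|G(y)-\sum_{0\le|\vec k|\le\lfloor\alpha\rfloor}\frac{\partial^{|\vec k|}G(x)}{\partial x_1^{k_1}\cdots\partial x_d^{k_d}}\prod_{j=1}^d\frac{(y_j-x_j)^{k_j}}{k_j!}\right|\le L\|y-x\|^\alpha\quad\forall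 x,y\in\mathbb{R}^d,$$ with $\|\cdot\|$ the Euclidean norm. $\mathbb{H}_1(\alpha,L)$ is the same class with $d=1$. Composite class. For $\mathcal{A}=(\gamma,\beta)$ and $\mathcal{L}=(L_1,L_2)$, $\mathbb{H}(\mathcal{A},\mathcal{L})$ is the set of all functions $g=f\circ G$, i.e. $g(x)=f(G(x))$, with $f\in\mathbb{H}_1(\gamma,L_1)$ and $G\in\mathbb{H}_d(\beta,L_2)$. *)

theory Defs
  imports "HOL-Probability.Probability"
begin

section \<open>Hoelder classes\<close>

text \<open>
  Multi-indices are functions on the canonical basis, so that one definition covers both
  the line (\<open>real\<close>) and d-space (\<open>real ^ 'n\<close>); values outside \<^term>\<open>Basis\<close> are normalised to 0.
\<close>

definition multi_indices :: "nat \<Rightarrow> ('a::euclidean_space \<Rightarrow> nat) set" where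
  "multi_indices m = {k. (\<forall>b. b \<notin> Basis \<longrightarrow> k b = 0) \<and> (\<Sum>b\<in>Basis. k b) \<le> m}"

lemma finite_multi_indices: "finite (multi_indices m :: ('a::euclidean_space \<Rightarrow> nat) set)"
proof (rule finite_subset)
  show "finite {k :: 'a \<Rightarrow> nat. \<forall>b. (b \<in> Basis \<longrightarrow> k b \<in> {..m}) \<and> (b \<notin> Basis \<longrightarrow> k b = 0)}"
    by (rule finite_set_of_finite_funs) auto
  show "multi_indices m \<subseteq> {k :: 'a \<Rightarrow> nat. \<forall>b. (b \<in> Basis \<longrightarrow> k b \<in> {..m}) \<and> (b \<notin> Basis \<longrightarrow> k b = 0)}"
  proof
    fix k :: "'a \<Rightarrow> nat" assume k: "k \<in> multi_indices m"
    have "k b \<le> m" if "b \<in> Basis" for b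
      using member_le_sum[OF that, of k] k by (simp add: multi_indices_def)
    then show "k \<in> {k. \<forall>b. (b \<in> Basis \<longrightarrow> k b \<in> {..m}) \<and> (b \<notin> Basis \<longrightarrow> k b = 0)}"
      using k by (simp add: multi_indices_def)
  qed
qed

text \<open>
  \<open>partial_derivatives m G D\<close>: all partial derivatives of \<open>G\<close> up to order \<open>m\<close> exist on the whole
  space, and \<open>D k\<close> is the one with multi-index \<open>k\<close>. The multi-index notation presupposes that
  mixed derivatives do not depend on the order of differentiation. In \<open>hoelder\<close> below this is no
  restriction, since the Taylor condition there forces \<open>G\<close> to be \<open>m\<close> times continuously
  differentiable.
\<close>

definition partial_derivatives ::
  "nat \<Rightarrow> ('a::euclidean_space \<Rightarrow> real) \<Rightarrow> (('a \<Rightarrow> nat) \<Rightarrow> 'a \<Rightarrow> real) \<Rightarrow> bool" where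
  "partial_derivatives m G D \<longleftrightarrow>
     D (\<lambda>_. 0) = G \<and>
     (\<forall>k b x. b \<in> Basis \<and> k(b := Suc (k b)) \<in> multi_indices m \<longrightarrow>
        ((\<lambda>s. D k (x + s *\<^sub>R b)) has_real_derivative D (k(b := Suc (k b))) x) (at 0))"

text \<open>The largest integer \<^emph>\<open>strictly\<close> less than \<open>\<alpha>\<close>, for \<open>\<alpha> > 0\<close>.\<close>

definition strict_floor :: "real \<Rightarrow> nat" where
  "strict_floor \<alpha> = nat (\<lceil>\<alpha>\<rceil> - 1)"

lemma strict_floor_eqI:
  assumes "real n < \<alpha>" "\<alpha> \<le> real n + 1"
  shows "strict_floor \<alpha> = n"
proof -
  have "\<lceil>\<alpha>\<rceil> = int n + 1"
    using assms by (intro ceiling_unique) auto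
  then show ?thesis by (simp add: strict_floor_def)
qed

definition hoelder :: "real \<Rightarrow> real \<Rightarrow> ('a::euclidean_space \<Rightarrow> real) set" where
  "hoelder \<alpha> L = {G. \<exists>D. partial_derivatives (strict_floor \<alpha>) G D \<and>
     (\<Sum>k\<in>multi_indices (strict_floor \<alpha>). SUP x. ennreal \<bar>D k x\<bar>) \<le> ennreal L \<and>
     (\<forall>x y. \<bar>G y - (\<Sum>k\<in>multi_indices (strict_floor \<alpha>).
                D k x * (\<Prod>b\<in>Basis. ((y - x) \<bullet> b) ^ k b / fact (k b)))\<bar>
            \<le> L * norm (y - x) powr \<alpha>)}"

definition composite_class ::
  "real \<Rightarrow> real \<Rightarrow> real \<Rightarrow> real \<Rightarrow> ('a::euclidean_space \<Rightarrow> real) set" where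
  "composite_class \<gamma> \<beta> L1 L2 =
     {f \<circ> G | (f :: real \<Rightarrow> real) G. f \<in> hoelder \<gamma> L1 \<and> G \<in> hoelder \<beta> L2}"


section \<open>Brownian sheet and the Gaussian white noise model\<close>

text \<open>A real Gaussian random variable, possibly degenerate (constant).\<close>

definition gaussian_rv :: "'w measure \<Rightarrow> ('w \<Rightarrow> real) \<Rightarrow> bool" where
  "gaussian_rv M X \<longleftrightarrow> X \<in> borel_measurable M \<and>
     ((\<exists>\<mu>. AE \<omega> in M. X \<omega> = \<mu>) \<or>
      (\<exists>\<mu> \<sigma>. 0 < \<sigma> \<and> distributed M lborel X (\<lambda>x. ennreal (normal_density \<mu> \<sigma> x))))"

definition gaussian_process :: "'w measure \<Rightarrow> ('t \<Rightarrow> 'w \<Rightarrow> real) \<Rightarrow> bool" where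
  "gaussian_process M X \<longleftrightarrow>
     (\<forall>I c. finite I \<longrightarrow> gaussian_rv M (\<lambda>\<omega>. \<Sum>t\<in>I. c t * X t \<omega>))"

text \<open>
  The sheet is indexed by the whole space: its covariance is the volume of the intersection of
  the boxes spanned by \<open>0, s\<close> and by \<open>0, t\<close>, so its restrictions to different orthants are
  independent.
\<close>

definition brownian_sheet :: "'w measure \<Rightarrow> (real ^ 'n \<Rightarrow> 'w \<Rightarrow> real) \<Rightarrow> bool" where
  "brownian_sheet M W \<longleftrightarrow>
     gaussian_process M W \<and>
     (\<forall>t. (\<integral>\<omega>. W t \<omega> \<partial>M) = 0) \<and>
     (\<forall>s t. (\<integral>\<omega>. W s \<omega> * W t \<omega> \<partial>M) =
        (\<Prod>i\<in>UNIV. if 0 < s $ i * t $ i then min \<bar>s $ i\<bar> \<bar>t $ i\<bar> else 0)) \<and>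
     (AE \<omega> in M. continuous_on UNIV (\<lambda>t. W t \<omega>))"

text \<open>
  Integrated form of \<open>X(dt) = g(t) dt + \<epsilon> W(dt)\<close>, anchored at the origin: the drift is the integral
  of \<open>g\<close> over the box spanned by \<open>0\<close> and \<open>t\<close>, with the sign that makes its mixed derivative equal
  to \<open>g\<close> on every orthant. On a box \<open>D\<close> containing the origin, the values at the points of \<open>D\<close> and
  the increments over the boxes with vertices in \<open>D\<close> determine each other.
\<close>

definition drift :: "(real ^ 'n \<Rightarrow> real) \<Rightarrow> real ^ 'n \<Rightarrow> real" where
  "drift g t = (\<Prod>i\<in>UNIV. sgn (t $ i)) *
     (LINT u:{u. \<forall>i. u $ i \<in> closed_segment 0 (t $ i)}|lborel. g u)"

definition observation ::
  "(real ^ 'n \<Rightarrow> 'w \<Rightarrow> real) \<Rightarrow> (real ^ 'n) set \<Rightarrow> real \<Rightarrow> (real ^ 'n \<Rightarrow> real) \<Rightarrow> 'w \<Rightarrow> real ^ 'n \<Rightarrow> real" where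
  "observation W D \<epsilon> g \<omega> = (\<lambda>t\<in>D. drift g t + \<epsilon> * W t \<omega>)"

abbreviation path_space :: "(real ^ 'n) set \<Rightarrow> (real ^ 'n \<Rightarrow> real) measure" where
  "path_space D \<equiv> \<Pi>\<^sub>M t\<in>D. (borel :: real measure)"

lemma measurable_observation:
  assumes "brownian_sheet M W"
  shows "observation W D \<epsilon> g \<in> measurable M (path_space D)"
proof -
  have "W t \<in> borel_measurable M" for t
    using assms[unfolded brownian_sheet_def gaussian_process_def, THEN conjunct1,
      rule_format, of "{t}" "\<lambda>_. 1"] by (simp add: gaussian_rv_def)
  then show ?thesis
    unfolding observation_def by (intro measurable_restrict) auto
qed

definition observation_law ::
  "'w measure \<Rightarrow> (real ^ 'n \<Rightarrow> 'w \<Rightarrow> real) \<Rightarrow> (real ^ 'n) set \<Rightarrow> real \<Rightarrow> (real ^ 'n \<Rightarrow> real) \<Rightarrow>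
     (real ^ 'n \<Rightarrow> real) measure" where
  "observation_law M W D \<epsilon> g = distr M (path_space D) (observation W D \<epsilon> g)"


section \<open>Estimators, risk and rate\<close>

text \<open>
  Estimators map an observed path to a real function on \<open>[-1,1]^d\<close>, each of whose values is a
  measurable functional of the path.
\<close>

definition estimators ::
  "(real ^ 'n) set \<Rightarrow> ((real ^ 'n \<Rightarrow> real) \<Rightarrow> real ^ 'n \<Rightarrow> real) set" where
  "estimators D = {h. \<forall>x\<in>cbox (- 1) 1. (\<lambda>X. h X x) \<in> borel_measurable (path_space D)}"

definition sup_norm :: "(real ^ 'n \<Rightarrow> real) \<Rightarrow> ennreal" where
  "sup_norm h = (SUP x\<in>cbox (- 1) 1. ennreal \<bar>h x\<bar>)"

text \<open>Power with a positive real exponent on \<open>[0,\<infinity>]\<close>.\<close>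

definition ennpowr :: "ennreal \<Rightarrow> real \<Rightarrow> ennreal" where
  "ennpowr u p = (if u = \<top> then \<top> else ennreal (enn2real u powr p))"

text \<open>
  The loss is a measurable function of the path whenever, for example, the estimator takes
  values in the continuous functions. For estimators with a non-measurable loss, the integral
  below is the lower integral, so that the infimum of the risks over all estimators is not
  made larger by a convention.
\<close>

definition risk ::
  "'w measure \<Rightarrow> (real ^ 'n \<Rightarrow> 'w \<Rightarrow> real) \<Rightarrow> (real ^ 'n) set \<Rightarrow> real \<Rightarrow> real \<Rightarrow> real \<Rightarrow>
     ((real ^ 'n \<Rightarrow> real) \<Rightarrow> real ^ 'n \<Rightarrow> real) \<Rightarrow> (real ^ 'n \<Rightarrow> real) \<Rightarrow> ennreal" where
  "risk M W D \<epsilon> \<phi> p h g =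
     (\<integral>\<^sup>+ X. ennpowr (ennreal (inverse \<phi>) * sup_norm (\<lambda>x. h X x - g x)) p
        \<partial>observation_law M W D \<epsilon> g)"

text \<open>For \<open>\<gamma>, \<beta> > 0\<close> the last branch is reached exactly when \<open>\<gamma> \<le> 1\<close> and \<open>\<beta> \<le> 1\<close>.\<close>

definition rate :: "nat \<Rightarrow> real \<Rightarrow> real \<Rightarrow> real \<Rightarrow> real" where
  "rate d \<gamma> \<beta> \<epsilon> = (\<epsilon> * sqrt (ln (1 / \<epsilon>))) powr
     (if 1 < \<beta> \<and> real d * (\<gamma> - 1) + 1 \<le> \<beta> then 2 * \<gamma> / (2 * \<gamma> + 1 + (real d - 1) / \<beta>)
      else if 1 < \<gamma> \<and> \<beta> < real d * (\<gamma> - 1) + 1 then 2 / (2 + real d / \<beta>)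
      else 2 / (2 + real d / (\<gamma> * \<beta>)))"

lemma rate_last_branch:
  assumes "2 \<le> d"
  shows "\<not> (1 < \<beta> \<and> real d * (\<gamma> - 1) + 1 \<le> \<beta>) \<and> \<not> (1 < \<gamma> \<and> \<beta> < real d * (\<gamma> - 1) + 1)
           \<longleftrightarrow> \<gamma> \<le> 1 \<and> \<beta> \<le> 1"
proof -
  have "real d * (\<gamma> - 1) > 0" if "\<gamma> > 1" using that assms by simp
  moreover have "real d * (\<gamma> - 1) \<le> 0" if "\<gamma> \<le> 1"
    using that by (simp add: mult_nonneg_nonpos)
  ultimately show ?thesis by linarith
qed

end

theory Submission
  imports Defs
begin

text \<open>
  The lower bound comes from a family of hypotheses \<open>g j\<close>, one for each point of a one-dimensional
  grid, that differ from a common \<open>g0\<close> by bumps with separated supports: smooth bumps in the inner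
  function, or, in the zone \<open>\<beta> > 1\<close>, shifts of the level sets of a sine wave seen through a narrow
  bump in the outer function. The number of hypotheses is polynomial in \<open>1 / \<epsilon>\<close>, while
  \<open>\<parallel>g j - g0\<parallel>\<^sup>2 / \<epsilon>\<^sup>2\<close> is a small multiple of \<open>ln (1 / \<epsilon>)\<close>.

  Let \<open>A j\<close> be the event that the estimator is close to \<open>g j\<close> at all grid points. These events are
  disjoint, and by the Cameron-Martin formula the law under \<open>g j\<close> satisfies
  \<open>P j A \<le> \<tau> * P0 A + exp (\<parallel>g j - g0\<parallel>\<^sup>2 / \<epsilon>\<^sup>2) / \<tau>\<close> for every \<open>\<tau> > 0\<close>. Averaging over \<open>j\<close> with
  \<open>\<tau>\<close> the square root of the number of hypotheses leaves some \<open>j\<close> with \<open>P j (A j) \<le> 1 / 2\<close>.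

  No stochastic integral is needed: on finitely many coordinates the shift by the drift equals the
  shift by its projection onto the span of the covariance kernels, which is the shift generated by
  a finite linear combination of values of the sheet and has smaller norm; the inequality
  then extends from cylinder events to all measurable sets of paths.
\<close>

section \<open>Hoelder classes\<close>

text \<open>Only the logarithm of the number of hypotheses enters, so a grid along one axis costs no
  more than a constant against a d-dimensional one; this logarithm is the origin of the factor
  \<open>sqrt (ln (1 / \<epsilon>))\<close> in the rate. If bumps of scale \<delta> are separated by
  about \<open>\<delta> powr \<kappa>\<close> and lie within squared distance
  \<open>\<delta> powr N\<close> of \<open>g0\<close>, then balancing \<open>\<delta> powr N\<close>
  against \<open>\<epsilon>\<^sup>2 * ln (1 / \<epsilon>)\<close> gives the exponent
  \<open>2 * \<kappa> / N\<close>. The zones differ in this pair: \<kappa> = \<beta> and N = 2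
  \<beta> + d for an outer function that is nearly linear at 0, \<kappa> = \<gamma> \<beta> and N =
  2 \<gamma> \<beta> + d for one that oscillates at the height of the inner bump, \<kappa> =
  \<gamma> and N = 2 \<gamma> + 1 + (d - 1) / \<beta> for moved level sets. The obstacle is that the
  sheet is an abstract Gaussian process and a path has uncountably many coordinates: the change of
  measure is obtained on finite index sets, so its bound must not depend on them.\<close>

definition taylor_monomial :: "('a::euclidean_space \<Rightarrow> nat) \<Rightarrow> 'a \<Rightarrow> real" where
  "taylor_monomial k v = (\<Prod>b\<in>Basis. (v \<bullet> b) ^ k b / fact (k b))"

text \<open>The strict bound makes room for \<open>n = 0\<close>, the empty Taylor polynomial, from
  which the induction in \<open>taylor_remainder_bound\<close> starts.\<close>

definition indices_below :: "nat \<Rightarrow> ('a::euclidean_space \<Rightarrow> nat) set" where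
  "indices_below n = {k. (\<forall>b. b \<notin> Basis \<longrightarrow> k b = 0) \<and> (\<Sum>b\<in>Basis. k b) < n}"

lemma indices_below_Suc: "indices_below (Suc m) = multi_indices m"
  by (auto simp: indices_below_def multi_indices_def)

lemma finite_indices_below: "finite (indices_below n :: ('a::euclidean_space \<Rightarrow> nat) set)"
proof (cases n)
  case 0 then show ?thesis by (simp add: indices_below_def)
next
  case (Suc m) then show ?thesis by (simp add: indices_below_Suc finite_multi_indices)
qed

lemma sum_fun_upd_Suc:
  fixes k :: "'a \<Rightarrow> nat"
  assumes "finite S" "b \<in> S"
  shows "(\<Sum>c\<in>S. (k(b := Suc (k b))) c) = Suc (\<Sum>c\<in>S. k c)"
proof -
  have "(\<Sum>c\<in>S. (k(b := Suc (k b))) c) = Suc (k b) + (\<Sum>c\<in>S - {b}. (k(b := Suc (k b))) c)"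
    using assms by (subst sum.remove[of S b]) auto
  also have "(\<Sum>c\<in>S - {b}. (k(b := Suc (k b))) c) = (\<Sum>c\<in>S - {b}. k c)"
    by (intro sum.cong) auto
  finally show ?thesis using assms by (simp add: sum.remove[of S b])
qed

lemma fun_upd_Suc_in_indices_below:
  assumes "b \<in> Basis"
  shows "k(b := Suc (k b)) \<in> indices_below (Suc n) \<longleftrightarrow> k \<in> indices_below n"
proof -
  have *: "(\<Sum>c\<in>Basis. (k(b := Suc (k b))) c) = Suc (\<Sum>c\<in>Basis. k c)"
    using assms by (intro sum_fun_upd_Suc) auto
  show ?thesis
    unfolding indices_below_def mem_Collect_eq * using assms by auto
qed

lemma prod_coordinates_has_derivative:
  fixes F :: "'a::euclidean_space \<Rightarrow> real \<Rightarrow> real"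
  assumes "\<And>b. b \<in> Basis \<Longrightarrow> (F b has_real_derivative F' b) (at (x \<bullet> b))"
  shows "((\<lambda>x. \<Prod>b\<in>Basis. F b (x \<bullet> b)) has_derivative
           (\<lambda>v. \<Sum>b\<in>Basis. (v \<bullet> b) * (F' b * (\<Prod>c\<in>Basis - {b}. F c (x \<bullet> c))))) (at x)"
proof -
  have "((\<lambda>x. F b (x \<bullet> b)) has_derivative (\<lambda>v. F' b * (v \<bullet> b))) (at x)" if "b \<in> Basis" for b
    using has_derivative_compose[OF has_derivative_inner_left[OF has_derivative_ident]
        assms[OF that, unfolded has_field_derivative_def]] .
  from has_derivative_prod[of Basis, OF this]
  show ?thesis by (simp add: mult_ac)
qed

lemma taylor_monomial_0: "taylor_monomial k (0::'a::euclidean_space) = (if \<forall>b\<in>Basis. k b = 0 then 1 else 0)"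
  unfolding taylor_monomial_def by (auto simp: prod_zero_iff)

text \<open>Dividing by factorials makes every nonzero partial derivative of a monomial another
  monomial with coefficient one. The case \<open>k b = 0\<close> is split off because
  \<open>k b - 1\<close> is truncated there.\<close>

lemma taylor_monomial_has_derivative:
  fixes x :: "'a::euclidean_space"
  shows "(taylor_monomial k has_derivative
     (\<lambda>v. \<Sum>b\<in>Basis. (v \<bullet> b) * (if k b = 0 then 0 else taylor_monomial (k(b := k b - 1)) x))) (at x)"
proof -
  have "((\<lambda>x. \<Prod>b\<in>Basis. (x \<bullet> b) ^ k b / fact (k b)) has_derivative
      (\<lambda>v. \<Sum>b\<in>Basis. (v \<bullet> b) * (real (k b) * (x \<bullet> b) ^ (k b - 1) / fact (k b) *
          (\<Prod>c\<in>Basis - {b}. (x \<bullet> c) ^ k c / fact (k c))))) (at x)"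
    by (rule prod_coordinates_has_derivative) (auto intro!: derivative_eq_intros)
  moreover have "real (k b) * (x \<bullet> b) ^ (k b - 1) / fact (k b) *
          (\<Prod>c\<in>Basis - {b}. (x \<bullet> c) ^ k c / fact (k c)) =
       (if k b = 0 then 0 else taylor_monomial (k(b := k b - 1)) x)" if "b \<in> Basis" for b
  proof (cases "k b")
    case (Suc j)
    define k' where "k' = k(b := j)"
    have "taylor_monomial k' x = (x \<bullet> b) ^ k' b / fact (k' b) * (\<Prod>c\<in>Basis - {b}. (x \<bullet> c) ^ k' c / fact (k' c))"
      unfolding taylor_monomial_def using that by (subst prod.remove[of Basis b]) auto
    also have "(\<Prod>c\<in>Basis - {b}. (x \<bullet> c) ^ k' c / fact (k' c)) = (\<Prod>c\<in>Basis - {b}. (x \<bullet> c) ^ k c / fact (k c))"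
      by (intro prod.cong) (auto simp: k'_def)
    also have "k' b = j" by (simp add: k'_def)
    finally have *: "taylor_monomial k' x =
       (x \<bullet> b) ^ j / fact j * (\<Prod>c\<in>Basis - {b}. (x \<bullet> c) ^ k c / fact (k c))" .
    have k': "k(b := k b - 1) = k'" using Suc by (simp add: k'_def)
    have "real (Suc j) * (x \<bullet> b) ^ j / fact (Suc j) = (x \<bullet> b) ^ j / fact j"
      by (simp add: field_simps del: of_nat_Suc)
    then show ?thesis unfolding k' * using Suc by simp
  qed simp
  then have "(\<lambda>v. \<Sum>b\<in>Basis. (v \<bullet> b) * (real (k b) * (x \<bullet> b) ^ (k b - 1) / fact (k b) *
          (\<Prod>c\<in>Basis - {b}. (x \<bullet> c) ^ k c / fact (k c)))) =
      (\<lambda>v. \<Sum>b\<in>Basis. (v \<bullet> b) * (if k b = 0 then 0 else taylor_monomial (k(b := k b - 1)) x))"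
    by (intro ext sum.cong refl) (simp only:)
  ultimately have "((\<lambda>x. \<Prod>b\<in>Basis. (x \<bullet> b) ^ k b / fact (k b)) has_derivative
      (\<lambda>v. \<Sum>b\<in>Basis. (v \<bullet> b) * (if k b = 0 then 0 else taylor_monomial (k(b := k b - 1)) x))) (at x)"
    by (simp only:)
  then show ?thesis
    unfolding taylor_monomial_def[abs_def] .
qed

text \<open>Differentiating a Taylor polynomial in direction \<open>b\<close> kills the terms with
  \<open>k b = 0\<close> and lowers the others; this bijection reindexes the surviving ones.\<close>

lemma bij_betw_fun_upd_Suc:
  assumes "b \<in> Basis"
  shows "bij_betw (\<lambda>k. k(b := Suc (k b))) (indices_below n)
           {k \<in> indices_below (Suc n). k b \<noteq> 0}"
proof (rule bij_betwI[where g = "\<lambda>k. k(b := k b - 1)"])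
  show "(\<lambda>k. k(b := Suc (k b))) \<in> indices_below n \<rightarrow> {k \<in> indices_below (Suc n). k b \<noteq> 0}"
    using fun_upd_Suc_in_indices_below[OF assms] by auto
  show "(\<lambda>k. k(b := k b - 1)) \<in> {k \<in> indices_below (Suc n). k b \<noteq> 0} \<rightarrow> indices_below n"
  proof (rule Pi_I)
    fix k :: "'a \<Rightarrow> nat" assume k: "k \<in> {k \<in> indices_below (Suc n). k b \<noteq> 0}"
    then have "(k(b := k b - 1))(b := Suc ((k(b := k b - 1)) b)) = k" by auto
    then show "k(b := k b - 1) \<in> indices_below n"
      using k fun_upd_Suc_in_indices_below[OF assms, of "k(b := k b - 1)" n] by simp
  qed
qed auto

text \<open>Induction on the order. The gradient of a remainder of order \<open>n + 1\<close> has as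
  components the remainders of order \<open>n\<close> of the shifted families
  \<open>D (k(b := Suc (k b)))\<close>, so the mean value inequality on the segment from
  \<open>x\<close> to \<open>y\<close> raises the power of the distance by one. Summing over the
  basis costs a factor \<open>DIM('a)\<close> at each step.\<close>

lemma taylor_remainder_bound:
  fixes D :: "('a::euclidean_space \<Rightarrow> nat) \<Rightarrow> 'a \<Rightarrow> real"
  assumes "\<And>k x. k \<in> indices_below n \<Longrightarrow>
      (D k has_derivative (\<lambda>v. \<Sum>b\<in>Basis. (v \<bullet> b) * D (k(b := Suc (k b))) x)) (at x)"
    and "\<And>k x. k \<in> indices_below (Suc n) \<Longrightarrow> \<bar>D k x\<bar> \<le> B"
  shows "\<bar>D (\<lambda>_. 0) y - (\<Sum>k\<in>indices_below n. D k x * taylor_monomial k (y - x))\<bar>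
           \<le> B * DIM('a) ^ n * norm (y - x) ^ n"
  using assms
proof (induction n arbitrary: D y)
  case 0
  have "(\<lambda>_. 0) \<in> (indices_below (Suc 0) :: ('a \<Rightarrow> nat) set)" by (simp add: indices_below_def)
  from "0.prems"(2)[OF this] show ?case by (simp add: indices_below_def)
next
  case (Suc n)
  let ?up = "\<lambda>b (k::'a \<Rightarrow> nat). k(b := Suc (k b))"
  define R where "R y = D (\<lambda>_. 0) y - (\<Sum>k\<in>indices_below (Suc n). D k x * taylor_monomial k (y - x))" for y
  define R' where "R' b y = D (?up b (\<lambda>_. 0)) y -
      (\<Sum>k\<in>indices_below n. D (?up b k) x * taylor_monomial k (y - x))" for b y
  have up_comm: "?up b (?up c k) = ?up c (?up b k)" for b c k by auto
  have R': "\<bar>R' b y\<bar> \<le> B * DIM('a) ^ n * norm (y - x) ^ n" if b: "b \<in> Basis" for b y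
    unfolding R'_def
  proof (rule Suc.IH[of "\<lambda>k. D (?up b k)"])
    fix k z assume "k \<in> (indices_below n :: ('a \<Rightarrow> nat) set)"
    then have "?up b k \<in> indices_below (Suc n)" using fun_upd_Suc_in_indices_below[OF b] by blast
    from Suc.prems(1)[OF this, of z]
    show "(D (?up b k) has_derivative (\<lambda>v. \<Sum>c\<in>Basis. (v \<bullet> c) * D (?up b (?up c k)) z)) (at z)"
      by (simp only: up_comm[where b = b])
  next
    fix k z assume "k \<in> (indices_below (Suc n) :: ('a \<Rightarrow> nat) set)"
    then have "?up b k \<in> indices_below (Suc (Suc n))"
      using fun_upd_Suc_in_indices_below[OF b] by blast
    then show "\<bar>D (?up b k) z\<bar> \<le> B" by (rule Suc.prems(2))
  qed
  have zero: "(\<lambda>_. 0) \<in> (indices_below (Suc n) :: ('a \<Rightarrow> nat) set)"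
    by (simp add: indices_below_def)
  have der: "(R has_derivative (\<lambda>v. \<Sum>b\<in>Basis. (v \<bullet> b) * R' b z)) (at z)" for z
  proof -
    have mono: "((\<lambda>y. taylor_monomial k (y - x)) has_derivative
       (\<lambda>v. \<Sum>b\<in>Basis. (v \<bullet> b) * (if k b = 0 then 0 else taylor_monomial (k(b := k b - 1)) (z - x)))) (at z)"
      for k :: "'a \<Rightarrow> nat"
    proof -
      have "((\<lambda>y. y - x) has_derivative (\<lambda>v. v)) (at z)" by (auto intro!: derivative_eq_intros)
      from has_derivative_compose[OF this taylor_monomial_has_derivative] show ?thesis .
    qed
    have "(R has_derivative (\<lambda>v. (\<Sum>b\<in>Basis. (v \<bullet> b) * D (?up b (\<lambda>_. 0)) z) -
        (\<Sum>k\<in>indices_below (Suc n). D k x * (\<Sum>b\<in>Basis. (v \<bullet> b) *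
          (if k b = 0 then 0 else taylor_monomial (k(b := k b - 1)) (z - x)))))) (at z)"
      unfolding R_def
      by (intro has_derivative_diff Suc.prems(1)[OF zero] has_derivative_sum
          has_derivative_mult_right mono)
    moreover have "(\<Sum>k\<in>indices_below (Suc n). D k x * (\<Sum>b\<in>Basis. (v \<bullet> b) *
          (if k b = 0 then 0 else taylor_monomial (k(b := k b - 1)) (z - x)))) =
        (\<Sum>b\<in>Basis. (v \<bullet> b) * (\<Sum>k\<in>indices_below n. D (?up b k) x * taylor_monomial k (z - x)))" for v
    proof -
      have "(\<Sum>k\<in>indices_below (Suc n). D k x *
          (if k b = 0 then 0 else taylor_monomial (k(b := k b - 1)) (z - x))) =
         (\<Sum>k\<in>indices_below n. D (?up b k) x * taylor_monomial k (z - x))" if "b \<in> Basis" for b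
      proof -
        have "(\<Sum>k\<in>indices_below (Suc n). D k x *
          (if k b = 0 then 0 else taylor_monomial (k(b := k b - 1)) (z - x))) =
          (\<Sum>k\<in>{k\<in>indices_below (Suc n). k b \<noteq> 0}. D k x * taylor_monomial (k(b := k b - 1)) (z - x))"
          by (intro sum.mono_neutral_cong_right finite_indices_below) auto
        also have "\<dots> = (\<Sum>k\<in>indices_below n. D (?up b k) x * taylor_monomial k (z - x))"
          by (subst sum.reindex_bij_betw[OF bij_betw_fun_upd_Suc[OF that], symmetric]) simp
        finally show ?thesis .
      qed
      then have "(\<Sum>b\<in>Basis. (v \<bullet> b) * (\<Sum>k\<in>indices_below n. D (?up b k) x * taylor_monomial k (z - x))) =
         (\<Sum>b\<in>Basis. (v \<bullet> b) * (\<Sum>k\<in>indices_below (Suc n). D k x *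
          (if k b = 0 then 0 else taylor_monomial (k(b := k b - 1)) (z - x))))"
        by (intro sum.cong) auto
      also have "\<dots> = (\<Sum>k\<in>indices_below (Suc n). D k x * (\<Sum>b\<in>Basis. (v \<bullet> b) *
          (if k b = 0 then 0 else taylor_monomial (k(b := k b - 1)) (z - x))))"
        unfolding sum_distrib_left by (subst sum.swap) (simp add: mult_ac)
      finally show ?thesis by simp
    qed
    ultimately show ?thesis
      unfolding R'_def by (simp add: sum_subtractf algebra_simps)
  qed
  let ?C = "B * DIM('a) ^ n * norm (y - x) ^ n"
  have B: "0 \<le> B" using Suc.prems(2)[of "\<lambda>_. 0" x] by (force simp: indices_below_def)
  have "norm (R y - R x) \<le> (DIM('a) * ?C) * norm (y - x)"
  proof (rule differentiable_bound[OF convex_closed_segment[of x y]])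
    show "(R has_derivative (\<lambda>v. \<Sum>b\<in>Basis. (v \<bullet> b) * R' b z)) (at z within closed_segment x y)" for z
      using der has_derivative_at_withinI by blast
    fix z assume "z \<in> closed_segment x y"
    then have z: "norm (z - x) \<le> norm (y - x)" by (rule segment_bound1)
    show "onorm (\<lambda>v. \<Sum>b\<in>Basis. (v \<bullet> b) * R' b z) \<le> DIM('a) * ?C"
    proof (rule onorm_bound)
      show "0 \<le> DIM('a) * ?C" using B by simp
      fix v :: 'a
      have "norm (\<Sum>b\<in>Basis. (v \<bullet> b) * R' b z) \<le> (\<Sum>b\<in>(Basis :: 'a set). norm v * ?C)"
      proof (rule sum_norm_le)
        fix b :: 'a assume b: "b \<in> Basis"
        have "\<bar>R' b z\<bar> \<le> B * DIM('a) ^ n * norm (z - x) ^ n" using R'[OF b] .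
        also have "\<dots> \<le> ?C" using z B by (intro mult_left_mono power_mono) auto
        finally show "norm ((v \<bullet> b) * R' b z) \<le> norm v * ?C"
          unfolding norm_mult using Basis_le_norm[OF b, of v] by (intro mult_mono) auto
      qed
      then show "norm (\<Sum>b\<in>Basis. (v \<bullet> b) * R' b z) \<le> DIM('a) * ?C * norm v" by (simp add: mult_ac)
    qed
  qed auto
  moreover have "R x = 0"
  proof -
    have "(\<Sum>k\<in>indices_below (Suc n). D k x * taylor_monomial k (x - x)) =
       (\<Sum>k\<in>{\<lambda>_. 0}. D k x * taylor_monomial k (x - x))"
      using zero by (intro sum.mono_neutral_right finite_indices_below)
        (auto simp: taylor_monomial_0 indices_below_def fun_eq_iff)
    also have "\<dots> = D (\<lambda>_. 0) x" by (simp add: taylor_monomial_0)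
    finally show ?thesis by (simp add: R_def)
  qed
  ultimately show ?case unfolding R_def by (simp add: mult_ac)
qed

section \<open>Membership in Hoelder classes and closure properties\<close>

lemma strict_floor_bounds:
  assumes "0 < \<alpha>"
  shows "real (strict_floor \<alpha>) < \<alpha>" "\<alpha> \<le> real (strict_floor \<alpha>) + 1"
proof -
  have "0 \<le> \<lceil>\<alpha>\<rceil> - 1" using assms by (simp add: one_le_ceiling)
  then have "real (strict_floor \<alpha>) = real_of_int \<lceil>\<alpha>\<rceil> - 1" by (simp add: strict_floor_def)
  then show "real (strict_floor \<alpha>) < \<alpha>" "\<alpha> \<le> real (strict_floor \<alpha>) + 1" by linarith+
qed

lemma hoelderI:
  assumes "partial_derivatives (strict_floor \<alpha>) G D"
    and "\<And>k x. k \<in> multi_indices (strict_floor \<alpha>) \<Longrightarrow> \<bar>D k x\<bar> \<le> B"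
    and "real (card (multi_indices (strict_floor \<alpha>) :: ('a::euclidean_space \<Rightarrow> nat) set)) * B \<le> L"
    and "\<And>x y. \<bar>G y - (\<Sum>k\<in>multi_indices (strict_floor \<alpha>). D k x * taylor_monomial k (y - x))\<bar>
            \<le> L * norm (y - x) powr \<alpha>"
  shows "(G :: 'a \<Rightarrow> real) \<in> hoelder \<alpha> L"
proof -
  have zero: "(\<lambda>_. 0) \<in> (multi_indices (strict_floor \<alpha>) :: ('a \<Rightarrow> nat) set)"
    by (simp add: multi_indices_def)
  have B: "0 \<le> B" using assms(2)[OF zero, of 0] by linarith
  have "(\<Sum>k\<in>multi_indices (strict_floor \<alpha>). SUP x. ennreal \<bar>D k x\<bar>) \<le>
      (\<Sum>k\<in>(multi_indices (strict_floor \<alpha>) :: ('a \<Rightarrow> nat) set). ennreal B)"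
    using assms(2) by (intro sum_mono SUP_least ennreal_leI) auto
  also have "\<dots> = ennreal (real (card (multi_indices (strict_floor \<alpha>) :: ('a \<Rightarrow> nat) set)) * B)"
    using B by (simp add: ennreal_mult ennreal_of_nat_eq_real_of_nat)
  also have "\<dots> \<le> ennreal L" using assms(3) by (rule ennreal_leI)
  finally show ?thesis
    using assms(1,4) unfolding hoelder_def taylor_monomial_def by blast
qed

lemma hoelderE:
  assumes "G \<in> hoelder \<alpha> L"
  obtains D where "partial_derivatives (strict_floor \<alpha>) G D"
    and "(\<Sum>k\<in>multi_indices (strict_floor \<alpha>). SUP x. ennreal \<bar>D k x\<bar>) \<le> ennreal L"
    and "\<And>x y. \<bar>G y - (\<Sum>k\<in>multi_indices (strict_floor \<alpha>). D k x * taylor_monomial k (y - x))\<bar>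
            \<le> L * norm (y - x) powr \<alpha>"
  using assms unfolding hoelder_def taylor_monomial_def by blast

lemma hoelder_mono:
  assumes "G \<in> hoelder \<alpha> L" "L \<le> L'"
  shows "G \<in> hoelder \<alpha> L'"
proof -
  from assms(1) obtain D where D: "partial_derivatives (strict_floor \<alpha>) G D"
    "(\<Sum>k\<in>multi_indices (strict_floor \<alpha>). SUP x. ennreal \<bar>D k x\<bar>) \<le> ennreal L"
    "\<And>x y. \<bar>G y - (\<Sum>k\<in>multi_indices (strict_floor \<alpha>). D k x * taylor_monomial k (y - x))\<bar>
       \<le> L * norm (y - x) powr \<alpha>"
    by (rule hoelderE) (rule that)
  have "L * norm (y - x) powr \<alpha> \<le> L' * norm (y - x) powr \<alpha>" for x y
    using assms(2) by (intro mult_right_mono) auto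
  moreover have "ennreal L \<le> ennreal L'" using assms(2) by (rule ennreal_leI)
  ultimately have "(\<Sum>k\<in>multi_indices (strict_floor \<alpha>). SUP x. ennreal \<bar>D k x\<bar>) \<le> ennreal L'"
    "\<And>x y. \<bar>G y - (\<Sum>k\<in>multi_indices (strict_floor \<alpha>). D k x * taylor_monomial k (y - x))\<bar>
       \<le> L' * norm (y - x) powr \<alpha>"
    using D(2,3) order_trans by blast+
  with D(1) show ?thesis
    unfolding hoelder_def taylor_monomial_def by blast
qed

lemma hoelder_add:
  assumes "F \<in> hoelder \<alpha> L" "G \<in> hoelder \<alpha> L'" "0 \<le> L" "0 \<le> L'"
  shows "(\<lambda>x. F x + G x) \<in> hoelder \<alpha> (L + L')"
proof -
  let ?m = "strict_floor \<alpha>"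
  from assms(1) obtain D where D: "partial_derivatives ?m F D"
    "(\<Sum>k\<in>multi_indices ?m. SUP x. ennreal \<bar>D k x\<bar>) \<le> ennreal L"
    "\<And>x y. \<bar>F y - (\<Sum>k\<in>multi_indices ?m. D k x * taylor_monomial k (y - x))\<bar> \<le> L * norm (y - x) powr \<alpha>"
    by (rule hoelderE) (rule that)
  from assms(2) obtain E where E: "partial_derivatives ?m G E"
    "(\<Sum>k\<in>multi_indices ?m. SUP x. ennreal \<bar>E k x\<bar>) \<le> ennreal L'"
    "\<And>x y. \<bar>G y - (\<Sum>k\<in>multi_indices ?m. E k x * taylor_monomial k (y - x))\<bar> \<le> L' * norm (y - x) powr \<alpha>"
    by (rule hoelderE) (rule that)
  define H where "H = (\<lambda>k x. D k x + E k x)"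
  have "partial_derivatives ?m (\<lambda>x. F x + G x) H"
    using D(1) E(1) unfolding partial_derivatives_def H_def by (auto intro!: DERIV_add)
  moreover have "(\<Sum>k\<in>multi_indices ?m. SUP x. ennreal \<bar>H k x\<bar>) \<le> ennreal (L + L')"
  proof -
    have "(\<Sum>k\<in>multi_indices ?m. SUP x. ennreal \<bar>H k x\<bar>) \<le>
       (\<Sum>k\<in>multi_indices ?m. (SUP x. ennreal \<bar>D k x\<bar>) + (SUP x. ennreal \<bar>E k x\<bar>))"
    proof (intro sum_mono SUP_least)
      fix k x
      have "ennreal \<bar>H k x\<bar> \<le> ennreal \<bar>D k x\<bar> + ennreal \<bar>E k x\<bar>"
        by (simp add: H_def ennreal_leI flip: ennreal_plus)
      also have "\<dots> \<le> (SUP x. ennreal \<bar>D k x\<bar>) + (SUP x. ennreal \<bar>E k x\<bar>)"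
        by (intro add_mono SUP_upper) auto
      finally show "ennreal \<bar>H k x\<bar> \<le> (SUP x. ennreal \<bar>D k x\<bar>) + (SUP x. ennreal \<bar>E k x\<bar>)" .
    qed
    also have "\<dots> \<le> ennreal L + ennreal L'"
      unfolding sum.distrib by (intro add_mono D E)
    finally show ?thesis using assms by simp
  qed
  moreover have "\<bar>F y + G y - (\<Sum>k\<in>multi_indices ?m. H k x * taylor_monomial k (y - x))\<bar>
      \<le> (L + L') * norm (y - x) powr \<alpha>" for x y
    using D(3)[of y x] E(3)[of y x] unfolding H_def distrib_right sum.distrib by linarith
  ultimately show ?thesis unfolding hoelder_def taylor_monomial_def by blast
qed

lemma hoelder_cmult:
  assumes "G \<in> hoelder \<alpha> L" "0 \<le> c" "0 \<le> L"
  shows "(\<lambda>x. c * G x) \<in> hoelder \<alpha> (c * L)"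
proof -
  let ?m = "strict_floor \<alpha>"
  from assms(1) obtain D where D: "partial_derivatives ?m G D"
    "(\<Sum>k\<in>multi_indices ?m. SUP x. ennreal \<bar>D k x\<bar>) \<le> ennreal L"
    "\<And>x y. \<bar>G y - (\<Sum>k\<in>multi_indices ?m. D k x * taylor_monomial k (y - x))\<bar> \<le> L * norm (y - x) powr \<alpha>"
    by (rule hoelderE) (rule that)
  define H where "H = (\<lambda>k x. c * D k x)"
  have "partial_derivatives ?m (\<lambda>x. c * G x) H"
    using D(1) unfolding partial_derivatives_def H_def by (auto intro!: DERIV_cmult)
  moreover have "(\<Sum>k\<in>multi_indices ?m. SUP x. ennreal \<bar>H k x\<bar>) \<le> ennreal (c * L)"
  proof -
    have "(\<Sum>k\<in>multi_indices ?m. SUP x. ennreal \<bar>H k x\<bar>) =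
       (\<Sum>k\<in>multi_indices ?m. ennreal c * (SUP x. ennreal \<bar>D k x\<bar>))"
      using assms by (simp add: H_def abs_mult ennreal_mult SUP_mult_left_ennreal)
    also have "\<dots> \<le> ennreal c * ennreal L"
      unfolding sum_distrib_left[symmetric] by (intro mult_left_mono D) auto
    finally show ?thesis using assms by (simp add: ennreal_mult)
  qed
  moreover have "\<bar>c * G y - (\<Sum>k\<in>multi_indices ?m. H k x * taylor_monomial k (y - x))\<bar>
      \<le> (c * L) * norm (y - x) powr \<alpha>" for x y
  proof -
    have "c * G y - (\<Sum>k\<in>multi_indices ?m. H k x * taylor_monomial k (y - x)) =
       c * (G y - (\<Sum>k\<in>multi_indices ?m. D k x * taylor_monomial k (y - x)))"
      by (simp add: H_def sum_distrib_left algebra_simps)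
    then show ?thesis using mult_left_mono[OF D(3)[of y x] assms(2)] assms(2)
      by (simp add: abs_mult mult_ac)
  qed
  ultimately show ?thesis unfolding hoelder_def taylor_monomial_def by blast
qed

lemma taylor_monomial_scaleR:
  "taylor_monomial k (c *\<^sub>R v) = c ^ (\<Sum>b\<in>Basis. k b) * taylor_monomial k v"
  unfolding taylor_monomial_def power_sum prod.distrib[symmetric]
  by (intro prod.cong) (auto simp: power_mult_distrib)

text \<open>A partial derivative of order s of the dilated function carries the factor
  \<open>h powr (\<alpha> - s)\<close>, at most 1 because \<open>h \<le> 1\<close> and
  \<open>s < \<alpha>\<close>, and the Taylor condition is invariant under this scaling. One
  \<open>L\<close> therefore serves all scales and centres.\<close>

lemma hoelder_dilation:
  fixes G :: "'a::euclidean_space \<Rightarrow> real"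
  assumes "G \<in> hoelder \<alpha> L" "0 < h" "h \<le> 1" "0 < \<alpha>" "0 \<le> L"
  shows "(\<lambda>x. h powr \<alpha> * G ((x - c) /\<^sub>R h)) \<in> hoelder \<alpha> L"
proof -
  let ?m = "strict_floor \<alpha>"
  from assms(1) obtain D where D: "partial_derivatives ?m G D"
    "(\<Sum>k\<in>multi_indices ?m. SUP x. ennreal \<bar>D k x\<bar>) \<le> ennreal L"
    "\<And>x y. \<bar>G y - (\<Sum>k\<in>multi_indices ?m. D k x * taylor_monomial k (y - x))\<bar> \<le> L * norm (y - x) powr \<alpha>"
    by (rule hoelderE) (rule that)
  define s where "s k = (\<Sum>b\<in>(Basis :: 'a set). k b)" for k :: "'a \<Rightarrow> nat"
  define H where "H = (\<lambda>k x. h powr \<alpha> / h ^ s k * D k ((x - c) /\<^sub>R h))"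
  have "partial_derivatives ?m (\<lambda>x. h powr \<alpha> * G ((x - c) /\<^sub>R h)) H"
    unfolding partial_derivatives_def
  proof (intro conjI allI impI)
    show "H (\<lambda>_. 0) = (\<lambda>x. h powr \<alpha> * G ((x - c) /\<^sub>R h))"
      using D(1) by (simp add: H_def partial_derivatives_def s_def)
    fix k :: "'a \<Rightarrow> nat" and b x :: 'a
    assume b: "b \<in> Basis \<and> k(b := Suc (k b)) \<in> multi_indices ?m"
    let ?k = "k(b := Suc (k b))"
    have s: "s ?k = Suc (s k)" unfolding s_def using b by (intro sum_fun_upd_Suc) auto
    have "((\<lambda>t. D k ((x - c) /\<^sub>R h + t *\<^sub>R b)) has_real_derivative D ?k ((x - c) /\<^sub>R h)) (at (0 / h))"
      using D(1) b by (simp add: partial_derivatives_def)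
    then have "((\<lambda>t. D k ((x - c) /\<^sub>R h + (t / h) *\<^sub>R b)) has_real_derivative
        D ?k ((x - c) /\<^sub>R h) * (1 / h)) (at 0)"
      by (rule DERIV_chain2) (use assms in \<open>auto intro!: derivative_eq_intros\<close>)
    from DERIV_cmult[OF this, of "h powr \<alpha> / h ^ s k"]
    show "((\<lambda>t. H k (x + t *\<^sub>R b)) has_real_derivative H ?k x) (at 0)"
      unfolding H_def s by (simp add: add_divide_distrib scaleR_diff_right scaleR_add_right field_simps)
  qed
  moreover have "(\<Sum>k\<in>multi_indices ?m. SUP x. ennreal \<bar>H k x\<bar>) \<le> ennreal L"
  proof (rule order_trans[OF sum_mono D(2)])
    fix k :: "'a \<Rightarrow> nat" assume "k \<in> multi_indices ?m"
    then have "s k \<le> ?m" by (simp add: multi_indices_def s_def)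
    then have "real (s k) \<le> \<alpha>" using strict_floor_bounds[OF assms(4)] by linarith
    then have "h powr \<alpha> \<le> h powr real (s k)" using assms by (intro powr_mono') auto
    then have le: "h powr \<alpha> / h ^ s k \<le> 1" using assms by (simp add: powr_realpow)
    show "(SUP x. ennreal \<bar>H k x\<bar>) \<le> (SUP x. ennreal \<bar>D k x\<bar>)"
    proof (rule SUP_least)
      fix x
      have "\<bar>H k x\<bar> \<le> \<bar>D k ((x - c) /\<^sub>R h)\<bar>"
        using le assms unfolding H_def abs_mult by (intro mult_left_le_one_le) auto
      then have "ennreal \<bar>H k x\<bar> \<le> ennreal \<bar>D k ((x - c) /\<^sub>R h)\<bar>" by (rule ennreal_leI)
      also have "\<dots> \<le> (SUP x. ennreal \<bar>D k x\<bar>)" by (rule SUP_upper) simp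
      finally show "ennreal \<bar>H k x\<bar> \<le> (SUP x. ennreal \<bar>D k x\<bar>)" .
    qed
  qed
  moreover have "\<bar>h powr \<alpha> * G ((y - c) /\<^sub>R h) - (\<Sum>k\<in>multi_indices ?m. H k x * taylor_monomial k (y - x))\<bar>
      \<le> L * norm (y - x) powr \<alpha>" for x y
  proof -
    let ?x = "(x - c) /\<^sub>R h" and ?y = "(y - c) /\<^sub>R h"
    have yx: "?y - ?x = (y - x) /\<^sub>R h" by (simp add: algebra_simps)
    have "(\<Sum>k\<in>multi_indices ?m. H k x * taylor_monomial k (y - x)) =
       h powr \<alpha> * (\<Sum>k\<in>multi_indices ?m. D k ?x * taylor_monomial k (?y - ?x))"
      unfolding yx taylor_monomial_scaleR H_def sum_distrib_left s_def
      using assms by (intro sum.cong) (auto simp: field_simps power_inverse)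
    then have "\<bar>h powr \<alpha> * G ?y - (\<Sum>k\<in>multi_indices ?m. H k x * taylor_monomial k (y - x))\<bar> =
       h powr \<alpha> * \<bar>G ?y - (\<Sum>k\<in>multi_indices ?m. D k ?x * taylor_monomial k (?y - ?x))\<bar>"
      by (simp add: abs_mult flip: right_diff_distrib)
    also have "\<dots> \<le> h powr \<alpha> * (L * norm (?y - ?x) powr \<alpha>)"
      by (intro mult_left_mono D(3)) auto
    also have "\<dots> = L * norm (y - x) powr \<alpha>"
    proof -
      have "norm (?y - ?x) = norm (y - x) / h" unfolding yx using assms by (simp add: divide_inverse)
      then have "norm (?y - ?x) powr \<alpha> = norm (y - x) powr \<alpha> / h powr \<alpha>"
        using assms by (simp only: powr_divide norm_ge_zero)
      moreover have "h powr \<alpha> \<noteq> 0" using assms by simp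
      ultimately show ?thesis by simp
    qed
    finally show ?thesis .
  qed
  ultimately show ?thesis unfolding hoelder_def taylor_monomial_def by blast
qed

section \<open>From bounded derivatives to Hoelder classes\<close>

text \<open>The derivatives are carried as a sequence, \<open>\<phi> i\<close> being the i-th
  derivative of \<open>\<phi> 0\<close>; partial derivatives of a product over coordinates are then
  products of entries of such sequences.\<close>

definition bounded_derivatives :: "nat \<Rightarrow> (nat \<Rightarrow> real \<Rightarrow> real) \<Rightarrow> bool" where
  "bounded_derivatives n \<phi> \<longleftrightarrow>
     (\<forall>i<n. \<forall>x. (\<phi> i has_real_derivative \<phi> (Suc i) x) (at x)) \<and> (\<forall>i\<le>n. \<exists>B. \<forall>x. \<bar>\<phi> i x\<bar> \<le> B)"

lemma taylor_monomial_bound: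
  assumes "1 \<le> norm v" "(\<Sum>b\<in>Basis. k b) \<le> m"
  shows "\<bar>taylor_monomial k v\<bar> \<le> norm v ^ m"
proof -
  have "\<bar>taylor_monomial k v\<bar> \<le> (\<Prod>b\<in>Basis. norm v ^ k b)"
    unfolding taylor_monomial_def abs_prod
  proof (intro prod_mono conjI)
    fix b :: 'a assume b: "b \<in> Basis"
    have "\<bar>(v \<bullet> b) ^ k b / fact (k b)\<bar> \<le> \<bar>v \<bullet> b\<bar> ^ k b"
      by (simp add: power_abs divide_le_eq mult_le_cancel_left1 fact_ge_1)
    also have "\<dots> \<le> norm v ^ k b" using Basis_le_norm[OF b] by (intro power_mono) auto
    finally show "\<bar>(v \<bullet> b) ^ k b / fact (k b)\<bar> \<le> norm v ^ k b" .
  qed simp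
  also have "\<dots> = norm v ^ (\<Sum>b\<in>Basis. k b)" by (rule power_sum[symmetric])
  also have "\<dots> \<le> norm v ^ m" using assms by (intro power_increasing) auto
  finally show ?thesis .
qed

text \<open>The inequalities \<open>m < \<alpha>\<close> and \<open>\<alpha> \<le> m + 1\<close>
  serve two ranges. At distance at most 1 the Taylor remainder of order \<open>m + 1\<close> is
  below the power \<alpha> of the distance; at larger distances every term grows at most like the
  power \<open>m\<close>, again below the power \<alpha>.\<close>

lemma hoelder_of_bounded_derivatives:
  fixes D :: "('a::euclidean_space \<Rightarrow> nat) \<Rightarrow> 'a \<Rightarrow> real"
  assumes "0 < \<alpha>" and m: "m = strict_floor \<alpha>"
    and der: "\<And>k x. k \<in> multi_indices m \<Longrightarrow>
      (D k has_derivative (\<lambda>v. \<Sum>b\<in>Basis. (v \<bullet> b) * D (k(b := Suc (k b))) x)) (at x)"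
    and bd: "\<And>k x. k \<in> multi_indices (Suc m) \<Longrightarrow> \<bar>D k x\<bar> \<le> B"
  shows "\<exists>L>0. D (\<lambda>_. 0) \<in> hoelder \<alpha> L"
proof -
  note a = strict_floor_bounds[OF assms(1), folded m]
  have zero: "(\<lambda>_. 0) \<in> (multi_indices m :: ('a \<Rightarrow> nat) set)"
    by (simp add: multi_indices_def)
  have mono: "k \<in> multi_indices (Suc m)" if "k \<in> multi_indices m" for k :: "'a \<Rightarrow> nat"
    using that by (simp add: multi_indices_def)
  have B: "0 \<le> B" using bd[OF mono[OF zero], of 0] by linarith
  let ?N = "real (card (multi_indices m :: ('a \<Rightarrow> nat) set))"
  \<comment> \<open>The first summand covers the near range, the next two the far range and the sum
    of suprema, and the last makes \<open>L\<close> positive.\<close>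
  define L where "L = B * DIM('a) ^ Suc m + B + ?N * B + 1"
  have DB: "0 \<le> B * real (DIM('a) ^ Suc m)" and NB: "0 \<le> ?N * B" using B by auto
  have L: "B * real (DIM('a) ^ Suc m) \<le> L" "B + ?N * B \<le> L" "?N * B \<le> L" "0 < L"
    using B DB NB unfolding L_def by linarith+
  have "D (\<lambda>_. 0) \<in> hoelder \<alpha> L"
  proof (rule hoelderI[where \<alpha> = \<alpha> and D = D and B = B, folded m])
    show "partial_derivatives m (D (\<lambda>_. 0)) D"
      unfolding partial_derivatives_def
    proof (intro conjI allI impI)
      fix k :: "'a \<Rightarrow> nat" and b x :: 'a
      assume b: "b \<in> Basis \<and> k(b := Suc (k b)) \<in> multi_indices m"
      then have "k \<in> indices_below m"
        using fun_upd_Suc_in_indices_below[of b k m] by (simp add: indices_below_Suc)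
      then have "k \<in> multi_indices m" by (auto simp: indices_below_def multi_indices_def)
      from der[OF this, of x]
      have "(D k has_derivative (\<lambda>v. \<Sum>b\<in>Basis. (v \<bullet> b) * D (k(b := Suc (k b))) x)) (at (x + 0 *\<^sub>R b))"
        by simp
      moreover have "((\<lambda>s. x + s *\<^sub>R b) has_derivative (\<lambda>s. s *\<^sub>R b)) (at 0)"
        by (auto intro!: derivative_eq_intros)
      ultimately have "((\<lambda>s. D k (x + s *\<^sub>R b)) has_derivative
          (\<lambda>s. \<Sum>c\<in>Basis. (s *\<^sub>R b \<bullet> c) * D (k(c := Suc (k c))) x)) (at 0)"
        using has_derivative_compose[of "\<lambda>s. x + s *\<^sub>R b" "\<lambda>s. s *\<^sub>R b" 0 UNIV "D k"
            "\<lambda>v. \<Sum>c\<in>Basis. (v \<bullet> c) * D (k(c := Suc (k c))) x"] by blast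
      also have "(\<lambda>s. \<Sum>c\<in>Basis. (s *\<^sub>R b \<bullet> c) * D (k(c := Suc (k c))) x) =
          (\<lambda>s. s * D (k(b := Suc (k b))) x)"
      proof
        fix s
        have "(\<Sum>c\<in>Basis. (s *\<^sub>R b \<bullet> c) * D (k(c := Suc (k c))) x) =
           (\<Sum>c\<in>Basis. if c = b then s * D (k(b := Suc (k b))) x else 0)"
          using b by (intro sum.cong) (auto simp: inner_Basis)
        then show "(\<Sum>c\<in>Basis. (s *\<^sub>R b \<bullet> c) * D (k(c := Suc (k c))) x) = s * D (k(b := Suc (k b))) x"
          using b by simp
      qed
      finally show "((\<lambda>s. D k (x + s *\<^sub>R b)) has_real_derivative D (k(b := Suc (k b))) x) (at 0)"
        by (simp add: has_field_derivative_def mult_commute_abs)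
    qed simp
  next
    fix k :: "'a \<Rightarrow> nat" and x :: 'a assume "k \<in> multi_indices m"
    then show "\<bar>D k x\<bar> \<le> B" by (intro bd mono)
  next
    show "?N * B \<le> L" by (rule L)
  next
    fix x y
    show "\<bar>D (\<lambda>_. 0) y - (\<Sum>k\<in>multi_indices m. D k x * taylor_monomial k (y - x))\<bar>
          \<le> L * norm (y - x) powr \<alpha>" (is "?lhs \<le> _")
    proof (cases "norm (y - x) \<le> 1")
      case True
      have "?lhs \<le> B * DIM('a) ^ Suc m * norm (y - x) ^ Suc m"
        using taylor_remainder_bound[of "Suc m" D B y x] der bd
        unfolding indices_below_Suc by blast
      also have "\<dots> \<le> L * norm (y - x) powr \<alpha>"
      proof (rule mult_mono)
        show "norm (y - x) ^ Suc m \<le> norm (y - x) powr \<alpha>"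
        proof (cases "y = x")
          case False
          have "norm (y - x) powr real (Suc m) \<le> norm (y - x) powr \<alpha>"
            using True a by (intro powr_mono') auto
          moreover have "norm (y - x) powr real (Suc m) = norm (y - x) ^ Suc m"
            using False by (intro powr_realpow) auto
          ultimately show ?thesis by simp
        qed simp
      qed (use L B in auto)
      finally show ?thesis .
    next
      case False
      have "?lhs \<le> \<bar>D (\<lambda>_. 0) y\<bar> + (\<Sum>k\<in>multi_indices m. \<bar>D k x * taylor_monomial k (y - x)\<bar>)"
        using sum_abs[of "\<lambda>k. D k x * taylor_monomial k (y - x)" "multi_indices m"] by linarith
      also have "\<dots> \<le> B * norm (y - x) ^ m + (\<Sum>k\<in>(multi_indices m :: ('a \<Rightarrow> nat) set). B * norm (y - x) ^ m)"
      proof (rule add_mono[OF _ sum_mono])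
        have "\<bar>D (\<lambda>_. 0) y\<bar> \<le> B * 1" using bd[OF mono[OF zero]] by simp
        also have "\<dots> \<le> B * norm (y - x) ^ m" using B False by (intro mult_left_mono one_le_power) auto
        finally show "\<bar>D (\<lambda>_. 0) y\<bar> \<le> B * norm (y - x) ^ m" .
        fix k :: "'a \<Rightarrow> nat" assume k: "k \<in> multi_indices m"
        show "\<bar>D k x * taylor_monomial k (y - x)\<bar> \<le> B * norm (y - x) ^ m"
          unfolding abs_mult
          using bd[OF mono[OF k]] taylor_monomial_bound[of "y - x" k m] k False B
          by (intro mult_mono) (auto simp: multi_indices_def)
      qed
      also have "\<dots> = (B + ?N * B) * norm (y - x) ^ m" by (simp add: algebra_simps)
      also have "\<dots> \<le> L * norm (y - x) powr \<alpha>"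
      proof (rule mult_mono)
        have "norm (y - x) powr real m \<le> norm (y - x) powr \<alpha>"
          using False a by (intro powr_mono) auto
        then show "norm (y - x) ^ m \<le> norm (y - x) powr \<alpha>" using False
          by (subst (asm) powr_realpow) auto
      qed (use L in auto)
      finally show ?thesis .
    qed
  qed
  with L show ?thesis by blast
qed

text \<open>Partial derivatives act on such a product factor by factor, so bounds in one dimension
  suffice. All building blocks of the hypotheses, bumps as well as waves, are products of this
  kind.\<close>

lemma hoelder_prod_coordinates:
  fixes \<phi> :: "'a::euclidean_space \<Rightarrow> nat \<Rightarrow> real \<Rightarrow> real"
  assumes "0 < \<alpha>" "\<And>b. b \<in> Basis \<Longrightarrow> bounded_derivatives (Suc (strict_floor \<alpha>)) (\<phi> b)"
  shows "\<exists>L>0. (\<lambda>x. \<Prod>b\<in>Basis. \<phi> b 0 (x \<bullet> b)) \<in> hoelder \<alpha> L"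
proof -
  define m where "m = strict_floor \<alpha>"
  have "\<exists>B. \<forall>x. \<bar>\<phi> b i x\<bar> \<le> B" if "b \<in> Basis" "i \<le> Suc m" for b i
    using assms(2)[OF that(1)] that(2) by (auto simp: bounded_derivatives_def m_def)
  then obtain C where C: "\<And>b i x. b \<in> Basis \<Longrightarrow> i \<le> Suc m \<Longrightarrow> \<bar>\<phi> b i x\<bar> \<le> C b i" by metis
  define B where "B = (\<Sum>b\<in>(Basis :: 'a set). \<Sum>i\<le>Suc m. \<bar>C b i\<bar>)"
  have B: "\<bar>\<phi> b i x\<bar> \<le> B" if "b \<in> Basis" "i \<le> Suc m" for b i x
  proof -
    have "\<bar>\<phi> b i x\<bar> \<le> \<bar>C b i\<bar>" using C[OF that, of x] by linarith
    also have "\<dots> \<le> (\<Sum>i\<le>Suc m. \<bar>C b i\<bar>)" using that by (intro member_le_sum) auto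
    also have "\<dots> \<le> B" unfolding B_def using that
      by (intro member_le_sum[of b Basis "\<lambda>b. \<Sum>i\<le>Suc m. \<bar>C b i\<bar>"] sum_nonneg) auto
    finally show ?thesis .
  qed
  have k_le: "k b \<le> n" if "b \<in> Basis" "k \<in> multi_indices n" for b n and k :: "'a \<Rightarrow> nat"
    using member_le_sum[OF that(1), of k] that by (simp add: multi_indices_def)
  define D where "D k x = (\<Prod>b\<in>Basis. \<phi> b (k b) (x \<bullet> b))" for k x
  have "\<exists>L>0. D (\<lambda>_. 0) \<in> hoelder \<alpha> L"
  proof (rule hoelder_of_bounded_derivatives[OF assms(1) m_def, where B = "B ^ DIM('a)"])
    fix k :: "'a \<Rightarrow> nat" and x assume k: "k \<in> multi_indices m"
    have "(D k has_derivative (\<lambda>v. \<Sum>b\<in>Basis. (v \<bullet> b) * (\<phi> b (Suc (k b)) (x \<bullet> b) *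
        (\<Prod>c\<in>Basis - {b}. \<phi> c (k c) (x \<bullet> c))))) (at x)"
      unfolding D_def[abs_def]
    proof (rule prod_coordinates_has_derivative)
      show "(\<phi> b (k b) has_real_derivative \<phi> b (Suc (k b)) (x \<bullet> b)) (at (x \<bullet> b))" if "b \<in> Basis" for b
        using assms(2)[OF that] k_le[OF that k] by (auto simp: bounded_derivatives_def m_def)
    qed
    also have "(\<lambda>v. \<Sum>b\<in>Basis. (v \<bullet> b) * (\<phi> b (Suc (k b)) (x \<bullet> b) *
        (\<Prod>c\<in>Basis - {b}. \<phi> c (k c) (x \<bullet> c)))) = (\<lambda>v. \<Sum>b\<in>Basis. (v \<bullet> b) * D (k(b := Suc (k b))) x)"
    proof (intro ext sum.cong refl)
      fix v b :: 'a assume b: "b \<in> Basis"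
      have "(\<Prod>c\<in>Basis - {b}. \<phi> c (k c) (x \<bullet> c)) = (\<Prod>c\<in>Basis - {b}. \<phi> c ((k(b := Suc (k b))) c) (x \<bullet> c))"
        by (intro prod.cong) auto
      then show "(v \<bullet> b) * (\<phi> b (Suc (k b)) (x \<bullet> b) * (\<Prod>c\<in>Basis - {b}. \<phi> c (k c) (x \<bullet> c))) =
          (v \<bullet> b) * D (k(b := Suc (k b))) x"
        unfolding D_def using b by (subst prod.remove[of Basis b]) auto
    qed
    finally show "(D k has_derivative (\<lambda>v. \<Sum>b\<in>Basis. (v \<bullet> b) * D (k(b := Suc (k b))) x)) (at x)" .
  next
    fix k :: "'a \<Rightarrow> nat" and x assume k: "k \<in> multi_indices (Suc m)"
    have "\<bar>D k x\<bar> \<le> (\<Prod>b\<in>(Basis :: 'a set). B)"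
      unfolding D_def abs_prod using B k_le[OF _ k] by (intro prod_mono) auto
    then show "\<bar>D k x\<bar> \<le> B ^ DIM('a)" by simp
  qed
  then show ?thesis by (simp add: D_def[abs_def])
qed

section \<open>Sine waves and polynomial bumps\<close>

lemma bounded_derivatives_sin: "bounded_derivatives n (\<lambda>i x. sin (x + real i * (pi / 2)))"
  unfolding bounded_derivatives_def
proof (intro conjI allI impI)
  fix i x
  \<comment> \<open>Each differentiation advances sine by a quarter period, so one formula covers
    all orders.\<close>
  have "sin (x + real (Suc i) * (pi / 2)) = cos (x + real i * (pi / 2))"
    by (simp add: sin_add cos_add algebra_simps add_divide_distrib)
  then show "((\<lambda>x. sin (x + real i * (pi / 2))) has_real_derivative sin (x + real (Suc i) * (pi / 2))) (at x)"
    by (auto intro!: derivative_eq_intros)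
qed (auto intro!: exI[of _ 1])

lemma bounded_derivatives_1: "bounded_derivatives n (\<lambda>i x. if i = 0 then 1 else 0)"
  by (auto simp: bounded_derivatives_def intro!: exI[of _ 1])

text \<open>A Hoelder class asks for finitely many bounded derivatives, so a truncated polynomial of
  high degree can replace an infinitely smooth function of compact support.\<close>

definition bump :: "nat \<Rightarrow> real \<Rightarrow> real" where
  "bump n u = max 0 (1 - u\<^sup>2) ^ n"

lemma bump_0: "bump n 0 = 1"
  and bump_nonneg: "0 \<le> bump n u"
  and bump_le_1: "bump n u \<le> 1"
  by (auto simp: bump_def intro!: power_le_one)

lemma bump_eq_0: "0 < n \<Longrightarrow> 1 \<le> \<bar>u\<bar> \<Longrightarrow> bump n u = 0"
  using one_le_power[of "\<bar>u\<bar>" 2] by (simp add: bump_def)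

lemma bump_less_1: "0 < n \<Longrightarrow> u \<noteq> 0 \<Longrightarrow> bump n u < 1"
  by (auto simp: bump_def power_less_one_iff)

lemma bump_has_derivative:
  assumes "2 \<le> n"
  shows "(bump n has_real_derivative real n * bump (n - 1) u * (- 2 * u)) (at u)"
proof -
  have zero: "(0::real) ^ (n - 1) = 0" using assms by (simp add: power_0_left)
  have pos: "((\<lambda>v. max 0 v ^ n) has_real_derivative real n * max 0 v ^ (n - 1)) (at v)" for v :: real
  proof (rule linorder_cases[of v 0])
    assume v: "v < 0"
    have "((\<lambda>v. 0) has_real_derivative 0) (at v)" by simp
    then have "((\<lambda>v. max 0 v ^ n) has_real_derivative 0) (at v)"
      by (rule has_field_derivative_transform_within_open[where S = "{..<0}"]) (use v assms in auto)
    moreover have "max 0 v = 0" using v by simp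
    ultimately show ?thesis by (simp only: zero mult_zero_right)
  next
    assume v: "v > 0"
    have "((\<lambda>v. v ^ n) has_real_derivative real n * v ^ (n - 1)) (at v)"
      by (auto intro!: derivative_eq_intros)
    then have "((\<lambda>v. max 0 v ^ n) has_real_derivative real n * v ^ (n - 1)) (at v)"
      by (rule has_field_derivative_transform_within_open[where S = "{0<..}"]) (use v assms in auto)
    then show ?thesis using v by simp
  next
    assume v: "v = 0"
    \<comment> \<open>At the kink the difference quotient is at most
      \<open>\<bar>h\<bar> ^ (n - 1)\<close>, which tends to 0 because
      \<open>n \<ge> 2\<close>.\<close>
    have "((\<lambda>h::real. max 0 h ^ n / h) \<longlongrightarrow> 0) (at 0)"
    proof (rule Lim_null_comparison)
      have "((\<lambda>h::real. \<bar>h\<bar> ^ (n - 1)) \<longlongrightarrow> \<bar>0\<bar> ^ (n - 1)) (at 0)" by (intro tendsto_intros)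
      then show "((\<lambda>h::real. \<bar>h\<bar> ^ (n - 1)) \<longlongrightarrow> 0) (at 0)" by (simp only: abs_zero zero)
      have "norm (max 0 h ^ n / h) \<le> \<bar>h\<bar> ^ (n - 1)" for h :: real
      proof (cases "h > 0")
        case True
        then show ?thesis using assms power_minus_mult[of n h] by (simp add: field_simps)
      next
        case False
        then have *: "max 0 h ^ n = 0" using assms by (simp add: power_0_left)
        show ?thesis unfolding * by simp
      qed
      then show "\<forall>\<^sub>F h in at (0::real). norm (max 0 h ^ n / h) \<le> \<bar>h\<bar> ^ (n - 1)" by simp
    qed
    then show ?thesis using v assms by (simp add: DERIV_def power_0_left)
  qed
  have "((\<lambda>u. 1 - u\<^sup>2) has_real_derivative - 2 * u) (at u)"
    by (auto intro!: derivative_eq_intros)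
  from DERIV_chain2[OF pos this] show ?thesis by (simp add: bump_def[abs_def])
qed

lemma bump_mult_poly_bounded:
  assumes "0 < n"
  shows "\<exists>B. \<forall>u. \<bar>bump n u * poly q u\<bar> \<le> B"
proof -
  have "compact ((\<lambda>u. bump n u * poly q u) ` {-1..1})"
    unfolding bump_def by (intro compact_continuous_image continuous_intros) auto
  then obtain B where B: "\<And>u. u \<in> {-1..1} \<Longrightarrow> \<bar>bump n u * poly q u\<bar> \<le> B"
    by (force dest!: compact_imp_bounded simp: bounded_iff)
  have "\<bar>bump n u * poly q u\<bar> \<le> B" for u
  proof (cases "u \<in> {-1..1}")
    case False
    then have "bump n u = 0" by (intro bump_eq_0 assms) auto
    moreover have "0 \<le> B" using B[of 0] by auto
    ultimately show ?thesis by simp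
  qed (rule B)
  then show ?thesis by blast
qed

text \<open>The i-th derivative is \<open>bump (Suc n - i)\<close> times a polynomial
  \<open>Q i\<close>: differentiating the bump lowers its exponent by one, and in the other term of
  the product rule one factor \<open>1 - x\<^sup>2\<close> is moved into the polynomial. Starting
  from exponent \<open>n + 1\<close> leaves exponent 1 after \<open>n\<close> steps, so all these
  derivatives are bounded and of compact support.\<close>

lemma bounded_derivatives_bump:
  "\<exists>\<phi>. bounded_derivatives n \<phi> \<and> \<phi> 0 = bump (Suc n)"
proof -
  define Q :: "nat \<Rightarrow> real poly" where
    "Q = rec_nat 1 (\<lambda>i q. smult (real (Suc n - i)) ([:0, -2:] * q) + [:1, 0, -1:] * pderiv q)"
  have Q_Suc: "poly (Q (Suc i)) x =
      real (Suc n - i) * (- 2 * x * poly (Q i) x) + (1 - x\<^sup>2) * poly (pderiv (Q i)) x" for i x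
    unfolding Q_def by (simp add: power2_eq_square algebra_simps)
  define \<phi> where "\<phi> i u = bump (Suc n - i) u * poly (Q i) u" for i u
  have "(\<phi> i has_real_derivative \<phi> (Suc i) x) (at x)" if "i < n" for i x
  proof -
    \<comment> \<open>The factor can be split off outside the support as well: both exponents are
      positive, so both sides vanish there.\<close>
    have eq: "bump (Suc n - i) x = bump (n - i) x * (1 - x\<^sup>2)"
    proof (cases "1 - x\<^sup>2 \<le> 0")
      case True
      then have "max 0 (1 - x\<^sup>2) = 0" by simp
      then show ?thesis unfolding bump_def using that by (simp only:) (simp add: power_0_left)
    next
      case False
      then have "max 0 (1 - x\<^sup>2) = 1 - x\<^sup>2" by simp
      moreover have "Suc n - i = Suc (n - i)" using that by simp
      ultimately show ?thesis unfolding bump_def by (simp only: power_Suc2)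
    qed
    have "(\<phi> i has_real_derivative real (Suc n - i) * bump (Suc n - i - 1) x * (- 2 * x) * poly (Q i) x +
        poly (pderiv (Q i)) x * bump (Suc n - i) x) (at x)"
      unfolding \<phi>_def by (rule DERIV_mult[OF bump_has_derivative poly_DERIV]) (use that in auto)
    also have "real (Suc n - i) * bump (Suc n - i - 1) x * (- 2 * x) * poly (Q i) x +
        poly (pderiv (Q i)) x * bump (Suc n - i) x = \<phi> (Suc i) x"
    proof -
      have "Suc n - i - 1 = n - i" "Suc n - Suc i = n - i" using that by auto
      moreover have "N * C * (- 2 * x) * P + P' * (C * (1 - x\<^sup>2)) =
          C * (N * (- 2 * x * P) + (1 - x\<^sup>2) * P')" for N C P P' :: real
        by (simp add: algebra_simps)
      ultimately show ?thesis unfolding \<phi>_def Q_Suc eq by (simp only:)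
    qed
    finally show ?thesis .
  qed
  moreover have "\<exists>B. \<forall>x. \<bar>\<phi> i x\<bar> \<le> B" if "i \<le> n" for i
    unfolding \<phi>_def by (rule bump_mult_poly_bounded) (use that in simp)
  ultimately have "bounded_derivatives n \<phi>"
    unfolding bounded_derivatives_def by simp
  moreover have "\<phi> 0 = bump (Suc n)"
  proof
    have "Q 0 = 1" by (simp add: Q_def)
    then show "\<phi> 0 u = bump (Suc n) u" for u by (simp add: \<phi>_def)
  qed
  ultimately show ?thesis by (intro exI[of _ \<phi>] conjI)
qed

section \<open>Characteristic functions and finite-dimensional laws\<close>

text \<open>The value at \<open>t = 0\<close> is the total mass, so two nonzero measures can be
  normalised to probabilities and compared by Levy's theorem; mass zero is treated apart.\<close>

lemma finite_measure_char_unique: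
  fixes M1 M2 :: "real measure"
  assumes "finite_measure M1" "finite_measure M2"
    and sets: "sets M1 = sets borel" "sets M2 = sets borel"
    and char: "\<And>t. (CLINT x|M1. iexp (t * x)) = (CLINT x|M2. iexp (t * x))"
  shows "M1 = M2"
proof -
  interpret M1: finite_measure M1 by fact
  interpret M2: finite_measure M2 by fact
  have [measurable_cong]: "sets M1 = sets borel" "sets M2 = sets borel" by fact+
  have space: "space M1 = UNIV" "space M2 = UNIV" using sets by (auto dest: sets_eq_imp_space_eq)
  define c where "c = measure M1 UNIV"
  have c2: "measure M2 UNIV = c" using char[of 0] by (simp add: c_def space)
  show ?thesis
  proof (cases "c = 0")
    case True
    then have "emeasure M1 (space M1) = 0" "emeasure M2 (space M2) = 0"
      using c2 by (simp_all add: c_def space M1.emeasure_eq_measure M2.emeasure_eq_measure)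
    then have "emeasure M1 A = 0" "emeasure M2 A = 0" for A
      by (metis emeasure_space le_zero_eq)+
    then show ?thesis using sets by (intro measure_eqI) auto
  next
    case False
    then have c: "0 < c" using measure_nonneg[of M1 UNIV] unfolding c_def by linarith
    have rd: "real_distribution (density N (\<lambda>_. ennreal (1 / c)))"
      if "finite_measure N" "sets N = sets borel" "measure N UNIV = c" for N
    proof -
      interpret finite_measure N by fact
      have sp: "space N = UNIV" using that by (auto dest: sets_eq_imp_space_eq)
      have "emeasure (density N (\<lambda>_. ennreal (1 / c))) UNIV = ennreal (1 / c) * ennreal c"
        using that sp by (subst emeasure_density_const) (auto simp: emeasure_eq_measure)
      also have "\<dots> = 1" using c by (simp flip: ennreal_mult)
      finally have "prob_space (density N (\<lambda>_. ennreal (1 / c)))"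
        by (intro prob_spaceI) (simp add: sp)
      then show ?thesis
        by (simp add: real_distribution_def real_distribution_axioms_def that sp)
    qed
    have "char (density M1 (\<lambda>_. ennreal (1 / c))) = char (density M2 (\<lambda>_. ennreal (1 / c)))"
      using c char by (intro ext) (simp add: char_def integral_density)
    then have eq: "density M1 (\<lambda>_. ennreal (1 / c)) = density M2 (\<lambda>_. ennreal (1 / c))"
      using assms c2 by (intro Levy_uniqueness rd) (auto simp: c_def)
    show ?thesis
    proof (rule measure_eqI)
      fix A assume A: "A \<in> sets M1"
      then have "ennreal (1 / c) * emeasure M1 A = ennreal (1 / c) * emeasure M2 A"
        using arg_cong[OF eq, of "\<lambda>M. emeasure M A"] sets by (simp add: emeasure_density_const)
      then show "emeasure M1 A = emeasure M2 A"
        using c by (simp add: ennreal_mult_cancel_left)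
    qed (simp add: sets)
  qed
qed

text \<open>Joint information on \<open>X\<close> and further variables is encoded by letting the
  latter enter as a nonnegative weight, which keeps the uniqueness theorem on the line.\<close>

lemma weighted_distr_eqI:
  fixes X1 :: "'a \<Rightarrow> real" and X2 :: "'b \<Rightarrow> real"
  assumes "prob_space N1" "prob_space N2"
    and [measurable]: "X1 \<in> borel_measurable N1" "X2 \<in> borel_measurable N2"
      "w1 \<in> borel_measurable N1" "w2 \<in> borel_measurable N2"
    and w: "\<And>\<omega>. 0 \<le> w1 \<omega> \<and> w1 \<omega> \<le> C" "\<And>\<omega>. 0 \<le> w2 \<omega> \<and> w2 \<omega> \<le> C"
    and char: "\<And>s. (CLINT \<omega>|N1. w1 \<omega> *\<^sub>R iexp (s * X1 \<omega>)) = (CLINT \<omega>|N2. w2 \<omega> *\<^sub>R iexp (s * X2 \<omega>))"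
  shows "distr (density N1 (\<lambda>\<omega>. ennreal (w1 \<omega>))) borel X1 =
         distr (density N2 (\<lambda>\<omega>. ennreal (w2 \<omega>))) borel X2"
proof (rule finite_measure_char_unique)
  have fin: "finite_measure (distr (density N (\<lambda>\<omega>. ennreal (w \<omega>))) borel X)"
    if "prob_space N" "X \<in> borel_measurable N" "w \<in> borel_measurable N" "\<And>\<omega>. w \<omega> \<le> C" for N w and X :: "'c \<Rightarrow> real"
  proof (rule finite_measureI)
    interpret prob_space N by fact
    have "emeasure (distr (density N (\<lambda>\<omega>. ennreal (w \<omega>))) borel X) UNIV = (\<integral>\<^sup>+\<omega>. ennreal (w \<omega>) \<partial>N)"
      using that by (simp add: emeasure_distr emeasure_density cong: nn_integral_cong)
    also have "\<dots> \<le> (\<integral>\<^sup>+\<omega>. ennreal C \<partial>N)" using that by (intro nn_integral_mono ennreal_leI)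
    also have "\<dots> < \<top>" by (simp add: emeasure_space_1 )
    finally show "emeasure (distr (density N (\<lambda>\<omega>. ennreal (w \<omega>))) borel X)
        (space (distr (density N (\<lambda>\<omega>. ennreal (w \<omega>))) borel X)) \<noteq> \<infinity>" by simp
  qed
  show "finite_measure (distr (density N1 (\<lambda>\<omega>. ennreal (w1 \<omega>))) borel X1)"
    "finite_measure (distr (density N2 (\<lambda>\<omega>. ennreal (w2 \<omega>))) borel X2)"
    using w by (auto intro!: fin assms)
  show "(CLINT x|distr (density N1 (\<lambda>\<omega>. ennreal (w1 \<omega>))) borel X1. iexp (t * x)) =
      (CLINT x|distr (density N2 (\<lambda>\<omega>. ennreal (w2 \<omega>))) borel X2. iexp (t * x))" for t
    using w char[of t] by (simp add: integral_distr integral_density)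
qed auto

lemma integral_distr_density:
  fixes k :: "real \<Rightarrow> 'b::{banach, second_countable_topology}"
  assumes [measurable]: "X \<in> borel_measurable N" "w \<in> borel_measurable N" "k \<in> borel_measurable borel"
    and "\<And>\<omega>. 0 \<le> w \<omega>"
  shows "(\<integral>x. k x \<partial>distr (density N (\<lambda>\<omega>. ennreal (w \<omega>))) borel X) = (\<integral>\<omega>. w \<omega> *\<^sub>R k (X \<omega>) \<partial>N)"
  using assms by (subst integral_distr) (auto simp: integral_density)

lemma iexp_add: "iexp (x + y) = iexp x * iexp y"
  by (simp add: ring_distribs exp_add)

lemma cos_eq_iexp: "complex_of_real (cos x) = (iexp x + iexp (- x)) / 2"
  by (simp add: cos_exp_eq flip: cos_of_real)

text \<open>With the sine written as a phase-shifted cosine, the weights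
  \<open>2 + cos (t + p)\<close> for varying \<open>p\<close> recover the real and the imaginary
  part alike.\<close>

lemma iexp_eq_cos: "iexp x = complex_of_real (cos x) + \<i> * complex_of_real (cos (x - pi / 2))"
  by (simp add: cos_diff cis_conv_exp[symmetric] complex_eq_iff)

text \<open>
  The indices are moved one at a time from the exponential to the indicators; the weights
  \<^term>\<open>2 + cos (\<theta> + p)\<close> are positive, so each step only needs the uniqueness theorem on the line.
\<close>

lemma char_vector_unique:
  fixes X1 :: "'i \<Rightarrow> 'a \<Rightarrow> real" and X2 :: "'i \<Rightarrow> 'b \<Rightarrow> real"
  assumes N: "prob_space N1" "prob_space N2" and I: "finite I"
    and meas: "\<And>i. i \<in> I \<Longrightarrow> X1 i \<in> borel_measurable N1" "\<And>i. i \<in> I \<Longrightarrow> X2 i \<in> borel_measurable N2"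
    and char: "\<And>c. (CLINT \<omega>|N1. iexp (\<Sum>i\<in>I. c i * X1 i \<omega>)) = (CLINT \<omega>|N2. iexp (\<Sum>i\<in>I. c i * X2 i \<omega>))"
  shows "distr N1 (\<Pi>\<^sub>M i\<in>I. borel) (\<lambda>\<omega>. \<lambda>i\<in>I. X1 i \<omega>) = distr N2 (\<Pi>\<^sub>M i\<in>I. borel) (\<lambda>\<omega>. \<lambda>i\<in>I. X2 i \<omega>)"
proof -
  interpret N1: prob_space N1 by fact
  interpret N2: prob_space N2 by fact
  \<comment> \<open>The set \<open>A\<close> holds the indices already turned into indicators,
    \<open>B\<close> those still in the exponential. For empty \<open>A\<close> this is the
    hypothesis; the induction step moves \<open>a\<close> from \<open>B\<close> to
    \<open>A\<close>.\<close>
  have step: "(CLINT \<omega>|N1. of_real (\<Prod>a\<in>A. indicator (S a) (X1 a \<omega>)) * iexp (\<Sum>b\<in>B. c b * X1 b \<omega>)) =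
        (CLINT \<omega>|N2. of_real (\<Prod>a\<in>A. indicator (S a) (X2 a \<omega>)) * iexp (\<Sum>b\<in>B. c b * X2 b \<omega>))"
    if "finite A" "A \<subseteq> I" "B \<subseteq> I" "A \<inter> B = {}" "\<And>a. S a \<in> sets borel" for A B S c
    using that
  proof (induction A arbitrary: B c rule: finite_induct)
    case empty
    have "(\<Sum>b\<in>I. (if b \<in> B then c b else 0) * X b \<omega>) = (\<Sum>b\<in>B. c b * X b \<omega>)"
      for X :: "'i \<Rightarrow> 'c \<Rightarrow> real" and \<omega>
      using empty I by (intro sum.mono_neutral_cong_right) auto
    note eq = this[of X1] this[of X2]
    show ?case using char[of "\<lambda>b. if b \<in> B then c b else 0"] by (simp add: eq)
  next
    case (insert a A)
    have [simp]: "finite B" using insert.prems I finite_subset by auto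
    have aB: "a \<notin> B" "a \<in> I" "A \<subseteq> I" using insert by auto
    have [measurable]: "X1 b \<in> borel_measurable N1" "X2 b \<in> borel_measurable N2"
      if "b \<in> insert a (A \<union> B)" for b using meas[of b] that insert.prems by auto
    have [measurable]: "S a \<in> sets borel" for a by (rule insert.prems)
    have [measurable]: "X1 a \<in> borel_measurable N1" "X2 a \<in> borel_measurable N2"
      using meas aB by auto
    define F1 where "F1 \<omega> = (\<Prod>a\<in>A. indicator (S a) (X1 a \<omega>) :: real)" for \<omega>
    define F2 where "F2 \<omega> = (\<Prod>a\<in>A. indicator (S a) (X2 a \<omega>) :: real)" for \<omega>
    define T1 where "T1 \<omega> = (\<Sum>b\<in>B. c b * X1 b \<omega>)" for \<omega>
    define T2 where "T2 \<omega> = (\<Sum>b\<in>B. c b * X2 b \<omega>)" for \<omega>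
    have [measurable]: "F1 \<in> borel_measurable N1" "F2 \<in> borel_measurable N2"
      "T1 \<in> borel_measurable N1" "T2 \<in> borel_measurable N2"
      unfolding F1_def F2_def T1_def T2_def by measurable
    have F: "0 \<le> F1 \<omega> \<and> F1 \<omega> \<le> 1" "0 \<le> F2 \<omega>' \<and> F2 \<omega>' \<le> 1" for \<omega> \<omega>'
      unfolding F1_def F2_def by (auto intro!: prod_nonneg prod_le_1 simp: indicator_def)
    have int1: "integrable N1 (\<lambda>\<omega>. of_real (F1 \<omega>) * iexp (s * X1 a \<omega> + r * T1 \<omega>))" for s r
      by (rule N1.integrable_const_bound[where B = 1]) (use F in \<open>auto simp: norm_mult\<close>)
    have int2: "integrable N2 (\<lambda>\<omega>. of_real (F2 \<omega>) * iexp (s * X2 a \<omega> + r * T2 \<omega>))" for s r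
      by (rule N2.integrable_const_bound[where B = 1]) (use F in \<open>auto simp: norm_mult\<close>)
    have hyp: "(CLINT \<omega>|N1. of_real (F1 \<omega>) * iexp (s * X1 a \<omega> + r * T1 \<omega>)) =
        (CLINT \<omega>|N2. of_real (F2 \<omega>) * iexp (s * X2 a \<omega> + r * T2 \<omega>))" for s r
    proof -
      have "(\<Sum>b\<in>insert a B. (if b = a then s else r * c b) * X b \<omega>) =
          s * X a \<omega> + r * (\<Sum>b\<in>B. c b * X b \<omega>)" for X :: "'i \<Rightarrow> 'c \<Rightarrow> real" and \<omega>
        using aB by (simp add: sum_distrib_left mult_ac) (intro sum.cong, auto)
      note eq = this[of X1] this[of X2]
      show ?thesis
        using insert.IH[of "insert a B" "\<lambda>b. if b = a then s else r * c b"] insert.prems insert.hyps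
        unfolding F1_def F2_def T1_def T2_def eq by auto
    qed
    have d0: "distr (density N1 (\<lambda>\<omega>. ennreal (F1 \<omega>))) borel (X1 a) =
        distr (density N2 (\<lambda>\<omega>. ennreal (F2 \<omega>))) borel (X2 a)"
      by (rule weighted_distr_eqI[where C = 1])
        (use F hyp[of _ 0] N in \<open>auto simp: scaleR_conv_of_real\<close>)
    have d: "distr (density N1 (\<lambda>\<omega>. ennreal (F1 \<omega> * (2 + cos (T1 \<omega> + p))))) borel (X1 a) =
        distr (density N2 (\<lambda>\<omega>. ennreal (F2 \<omega> * (2 + cos (T2 \<omega> + p))))) borel (X2 a)" for p
    proof (rule weighted_distr_eqI[where C = 3])
      have bnd: "0 \<le> f * (2 + cos t) \<and> f * (2 + cos t) \<le> 3" if "0 \<le> f \<and> f \<le> 1" for f t :: real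
      proof -
        have "0 \<le> 2 + cos t" "2 + cos t \<le> 3" using cos_ge_minus_one[of t] cos_le_one[of t] by linarith+
        then show ?thesis using that mult_mono[of f 1 "2 + cos t" 3] by auto
      qed
      show "0 \<le> F1 \<omega> * (2 + cos (T1 \<omega> + p)) \<and> F1 \<omega> * (2 + cos (T1 \<omega> + p)) \<le> 3" for \<omega>
        by (intro bnd F)
      show "0 \<le> F2 \<omega> * (2 + cos (T2 \<omega> + p)) \<and> F2 \<omega> * (2 + cos (T2 \<omega> + p)) \<le> 3" for \<omega>
        by (intro bnd F)
      fix s
      \<comment> \<open>The weight splits into exponentials of \<open>0 * t\<close>,
        \<open>1 * t\<close> and \<open>(-1) * t\<close>, and \<open>hyp\<close> covers each of them
        through its free factor \<open>r\<close>.\<close>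
      have expand: "(f * (2 + cos (t + p))) *\<^sub>R iexp (s * x) =
          2 * (of_real f * iexp (s * x + 0 * t)) + iexp p / 2 * (of_real f * iexp (s * x + 1 * t))
          + iexp (- p) / 2 * (of_real f * iexp (s * x + (- 1) * t))" for f t x :: real
      proof -
        have "iexp (t + p) = iexp t * iexp p" "iexp (- (t + p)) = iexp (- t) * iexp (- p)"
          "iexp (s * x + 1 * t) = iexp (s * x) * iexp t"
          "iexp (s * x + (- 1) * t) = iexp (s * x) * iexp (- t)"
          by (simp_all only: iexp_add[symmetric] minus_add_distrib mult_1 mult_minus1)
        then show ?thesis unfolding scaleR_conv_of_real of_real_mult of_real_add cos_eq_iexp
          by (simp only:) (simp add: field_simps)
      qed
      show "(CLINT \<omega>|N1. (F1 \<omega> * (2 + cos (T1 \<omega> + p))) *\<^sub>R iexp (s * X1 a \<omega>)) =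
          (CLINT \<omega>|N2. (F2 \<omega> * (2 + cos (T2 \<omega> + p))) *\<^sub>R iexp (s * X2 a \<omega>))"
        unfolding expand using int1 int2
        by (simp only: Bochner_Integration.integral_add Bochner_Integration.integrable_add
            integrable_mult_right integral_mult_right_zero hyp)
    qed (use N in auto)
    have P1: "(\<integral>\<omega>. F1 \<omega> * indicator (S a) (X1 a \<omega>) \<partial>N1) = (\<integral>\<omega>. F2 \<omega> * indicator (S a) (X2 a \<omega>) \<partial>N2)"
      using arg_cong[OF d0, of "\<lambda>M. \<integral>x. indicat_real (S a) x \<partial>M"] F
      by (subst (asm) (1 2) integral_distr_density) auto
    \<comment> \<open>The summand 2, which made the weight positive, is removed again by subtracting
      twice \<open>P1\<close>.\<close>
    have cosP: "(\<integral>\<omega>. F1 \<omega> * cos (T1 \<omega> + p) * indicator (S a) (X1 a \<omega>) \<partial>N1) =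
        (\<integral>\<omega>. F2 \<omega> * cos (T2 \<omega> + p) * indicator (S a) (X2 a \<omega>) \<partial>N2)" for p
    proof -
      have expand: "(f * (2 + t)) * i = 2 * (f * i) + f * t * i" for f t i :: real
        by (simp add: algebra_simps)
      have nn: "0 \<le> 2 + cos t" for t :: real using cos_ge_minus_one[of t] by linarith
      have i1: "integrable N1 (\<lambda>\<omega>. F1 \<omega> * indicator (S a) (X1 a \<omega>))"
        by (rule N1.integrable_const_bound[where B = 1]) (use F in \<open>auto simp: indicator_def\<close>)
      have i2: "integrable N2 (\<lambda>\<omega>. F2 \<omega> * indicator (S a) (X2 a \<omega>))"
        by (rule N2.integrable_const_bound[where B = 1]) (use F in \<open>auto simp: indicator_def\<close>)
      have j1: "integrable N1 (\<lambda>\<omega>. F1 \<omega> * cos (T1 \<omega> + p) * indicator (S a) (X1 a \<omega>))"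
        by (rule N1.integrable_const_bound[where B = 1])
          (use F in \<open>auto simp: indicator_def abs_mult intro!: mult_le_one\<close>)
      have j2: "integrable N2 (\<lambda>\<omega>. F2 \<omega> * cos (T2 \<omega> + p) * indicator (S a) (X2 a \<omega>))"
        by (rule N2.integrable_const_bound[where B = 1])
          (use F in \<open>auto simp: indicator_def abs_mult intro!: mult_le_one\<close>)
      have "(\<integral>\<omega>. (F1 \<omega> * (2 + cos (T1 \<omega> + p))) * indicator (S a) (X1 a \<omega>) \<partial>N1) =
          (\<integral>\<omega>. (F2 \<omega> * (2 + cos (T2 \<omega> + p))) * indicator (S a) (X2 a \<omega>) \<partial>N2)"
        using arg_cong[OF d[of p], of "\<lambda>M. \<integral>x. indicat_real (S a) x \<partial>M"] F nn
        by (subst (asm) (1 2) integral_distr_density) auto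
      moreover have "(\<integral>\<omega>. (F1 \<omega> * (2 + cos (T1 \<omega> + p))) * indicator (S a) (X1 a \<omega>) \<partial>N1) =
         2 * (\<integral>\<omega>. F1 \<omega> * indicator (S a) (X1 a \<omega>) \<partial>N1) + (\<integral>\<omega>. F1 \<omega> * cos (T1 \<omega> + p) * indicator (S a) (X1 a \<omega>) \<partial>N1)"
        unfolding expand using i1 j1
        by (simp only: Bochner_Integration.integral_add integrable_mult_right integral_mult_right_zero)
      moreover have "(\<integral>\<omega>. (F2 \<omega> * (2 + cos (T2 \<omega> + p))) * indicator (S a) (X2 a \<omega>) \<partial>N2) =
         2 * (\<integral>\<omega>. F2 \<omega> * indicator (S a) (X2 a \<omega>) \<partial>N2) + (\<integral>\<omega>. F2 \<omega> * cos (T2 \<omega> + p) * indicator (S a) (X2 a \<omega>) \<partial>N2)"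
        unfolding expand using i2 j2
        by (simp only: Bochner_Integration.integral_add integrable_mult_right integral_mult_right_zero)
      ultimately show ?thesis using P1 by simp
    qed
    have split: "of_real (indicator (S a) x * f) * iexp t =
        of_real (f * cos (t + 0) * indicator (S a) x) + \<i> * of_real (f * cos (t + - (pi / 2)) * indicator (S a) x)"
      for f t x :: real by (simp add: iexp_eq_cos[of t] algebra_simps)
    have k1: "integrable N1 (\<lambda>\<omega>. complex_of_real (F1 \<omega> * cos (T1 \<omega> + p) * indicator (S a) (X1 a \<omega>)))" for p
      by (rule N1.integrable_const_bound[where B = 1])
        (use F in \<open>auto simp: indicator_def norm_mult intro!: mult_le_one\<close>)
    have k2: "integrable N2 (\<lambda>\<omega>. complex_of_real (F2 \<omega> * cos (T2 \<omega> + p) * indicator (S a) (X2 a \<omega>)))" for p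
      by (rule N2.integrable_const_bound[where B = 1])
        (use F in \<open>auto simp: indicator_def norm_mult intro!: mult_le_one\<close>)
    have prod: "(\<Prod>a\<in>insert a A. indicator (S a) (X a \<omega>)) = indicator (S a) (X a \<omega>) * (\<Prod>a\<in>A. indicator (S a) (X a \<omega>) :: real)"
      for X :: "'i \<Rightarrow> 'c \<Rightarrow> real" and \<omega> using insert.hyps by simp
    show ?case
      unfolding prod[of X1] prod[of X2] F1_def[symmetric] F2_def[symmetric] T1_def[symmetric] T2_def[symmetric] split
      using k1 k2
      by (simp only: Bochner_Integration.integral_add integrable_mult_right integral_mult_right_zero
          integral_complex_of_real cosP)
  qed
  have vec1: "(\<lambda>\<omega>. \<lambda>i\<in>I. X1 i \<omega>) \<in> measurable N1 (\<Pi>\<^sub>M i\<in>I. borel)"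
    using meas by (intro measurable_restrict) auto
  have vec2: "(\<lambda>\<omega>. \<lambda>i\<in>I. X2 i \<omega>) \<in> measurable N2 (\<Pi>\<^sub>M i\<in>I. borel)"
    using meas by (intro measurable_restrict) auto
  show ?thesis
  proof (rule measure_eqI_PiM_infinite)
    show "finite_measure (distr N1 (\<Pi>\<^sub>M i\<in>I. borel) (\<lambda>\<omega>. \<lambda>i\<in>I. X1 i \<omega>))"
      using vec1 by (intro N1.finite_measure_distr)
    fix S :: "'i \<Rightarrow> real set" and J
    assume J: "finite J" "J \<subseteq> I" "\<And>i. i \<in> J \<Longrightarrow> S i \<in> sets borel"
    \<comment> \<open>Outside \<open>J\<close> nothing is known about \<open>S\<close>; the empty
      set makes \<open>S'\<close> Borel at every index, as \<open>step\<close> asks.\<close>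
    define S' where "S' i = (if i \<in> J then S i else {})" for i
    have S': "S' i \<in> sets borel" for i using J by (simp add: S'_def)
    have pr: "emeasure (distr N (\<Pi>\<^sub>M i\<in>I. borel) (\<lambda>\<omega>. \<lambda>i\<in>I. X i \<omega>)) (prod_emb I (\<lambda>_. borel) J (Pi\<^sub>E J S)) =
        ennreal (\<integral>\<omega>. (\<Prod>a\<in>J. indicator (S' a) (X a \<omega>)) \<partial>N)"
      if "prob_space N" "\<And>i. i \<in> I \<Longrightarrow> X i \<in> borel_measurable N" for N and X :: "'i \<Rightarrow> 'c \<Rightarrow> real"
    proof -
      interpret prob_space N by fact
      have "emeasure (distr N (\<Pi>\<^sub>M i\<in>I. borel) (\<lambda>\<omega>. \<lambda>i\<in>I. X i \<omega>)) (prod_emb I (\<lambda>_. borel) J (Pi\<^sub>E J S)) =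
         emeasure N ((\<lambda>\<omega>. \<lambda>i\<in>I. X i \<omega>) -` prod_emb I (\<lambda>_. borel) J (Pi\<^sub>E J S) \<inter> space N)"
        using that J by (intro emeasure_distr measurable_restrict sets_PiM_I) auto
      also have "\<dots> = emeasure N {\<omega> \<in> space N. \<forall>j\<in>J. X j \<omega> \<in> S j}"
        using J by (intro arg_cong[where f = "emeasure N"]) (auto simp: prod_emb_def PiE_iff, metis subsetD)
      also have "\<dots> = ennreal (\<integral>\<omega>. indicator {\<omega> \<in> space N. \<forall>j\<in>J. X j \<omega> \<in> S j} \<omega> \<partial>N)"
        by (simp add: emeasure_eq_measure Int_absorb2 subset_eq)
      also have "(\<integral>\<omega>. indicator {\<omega> \<in> space N. \<forall>j\<in>J. X j \<omega> \<in> S j} \<omega> \<partial>N) =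
          (\<integral>\<omega>. (\<Prod>a\<in>J. indicat_real (S' a) (X a \<omega>)) \<partial>N)"
      proof (rule Bochner_Integration.integral_cong[OF refl])
        fix \<omega> assume "\<omega> \<in> space N"
        moreover have "(\<Prod>a\<in>J. indicat_real (S' a) (X a \<omega>)) = 0" if "j \<in> J" "X j \<omega> \<notin> S j" for j
          using that J by (intro prod_zero bexI[of _ j]) (auto simp: S'_def)
        moreover have "(\<Prod>a\<in>J. indicat_real (S' a) (X a \<omega>)) = 1" if "\<forall>j\<in>J. X j \<omega> \<in> S j"
          using that by (intro prod.neutral) (auto simp: S'_def)
        ultimately show "indicator {\<omega> \<in> space N. \<forall>j\<in>J. X j \<omega> \<in> S j} \<omega> = (\<Prod>a\<in>J. indicat_real (S' a) (X a \<omega>))"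
          by (cases "\<forall>j\<in>J. X j \<omega> \<in> S j") auto
      qed
      finally show ?thesis .
    qed
    have "complex_of_real (\<integral>\<omega>. (\<Prod>a\<in>J. indicator (S' a) (X1 a \<omega>)) \<partial>N1) =
        complex_of_real (\<integral>\<omega>. (\<Prod>a\<in>J. indicator (S' a) (X2 a \<omega>)) \<partial>N2)"
      using step[of J "{}" S' "\<lambda>_. 0"] J S' by (simp flip: integral_complex_of_real)
    then show "emeasure (distr N1 (\<Pi>\<^sub>M i\<in>I. borel) (\<lambda>\<omega>. \<lambda>i\<in>I. X1 i \<omega>)) (prod_emb I (\<lambda>_. borel) J (Pi\<^sub>E J S)) =
        emeasure (distr N2 (\<Pi>\<^sub>M i\<in>I. borel) (\<lambda>\<omega>. \<lambda>i\<in>I. X2 i \<omega>)) (prod_emb I (\<lambda>_. borel) J (Pi\<^sub>E J S))"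
      using pr[of N1 X1] pr[of N2 X2] N meas by simp
  qed auto
qed

section \<open>Centred Gaussian variables\<close>

text \<open>Both cases occur: each value of the sheet on a coordinate hyperplane is almost surely 0.
  In both, the second moment is finite and determines the law.\<close>

lemma (in prob_space) centered_gaussian_cases:
  assumes "gaussian_rv M Y" "expectation Y = 0"
  obtains (degenerate) "AE \<omega> in M. Y \<omega> = 0" "integrable M (\<lambda>\<omega>. (Y \<omega>)\<^sup>2)" "expectation (\<lambda>\<omega>. (Y \<omega>)\<^sup>2) = 0"
  | (normal) \<sigma> where "0 < \<sigma>" "distributed M lborel Y (\<lambda>x. ennreal (normal_density 0 \<sigma> x))"
      "integrable M (\<lambda>\<omega>. (Y \<omega>)\<^sup>2)" "expectation (\<lambda>\<omega>. (Y \<omega>)\<^sup>2) = \<sigma>\<^sup>2"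
proof -
  have [measurable]: "Y \<in> borel_measurable M" using assms by (simp add: gaussian_rv_def)
  from assms(1) consider \<mu> where "AE \<omega> in M. Y \<omega> = \<mu>"
    | \<mu> \<sigma> where "0 < \<sigma>" "distributed M lborel Y (\<lambda>x. ennreal (normal_density \<mu> \<sigma> x))"
    unfolding gaussian_rv_def by blast
  then show thesis
  proof cases
    case 1
    have "expectation Y = expectation (\<lambda>\<omega>. \<mu>)" using 1 by (intro integral_cong_AE) auto
    then have "\<mu> = 0" using assms(2) by (simp add: prob_space)
    with 1 have ae: "AE \<omega> in M. Y \<omega> = 0" by simp
    then have ae2: "AE \<omega> in M. (Y \<omega>)\<^sup>2 = 0" by auto
    have "integrable M (\<lambda>\<omega>. (Y \<omega>)\<^sup>2)"
      by (subst integrable_cong_AE[OF _ _ ae2]) auto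
    moreover have "expectation (\<lambda>\<omega>. (Y \<omega>)\<^sup>2) = expectation (\<lambda>\<omega>. 0)"
      using ae2 by (intro integral_cong_AE) auto
    ultimately show thesis using degenerate ae by simp
  next
    case 2
    have \<mu>: "\<mu> = 0" using normal_distributed_expectation[OF 2] assms(2) by simp
    have "expectation (\<lambda>\<omega>. (Y \<omega>)\<^sup>2) = \<sigma>\<^sup>2"
      using normal_distributed_variance[OF 2] assms(2) by simp
    moreover have "integrable M (\<lambda>\<omega>. (Y \<omega>)\<^sup>2)"
      by (rule iffD1[OF distributed_integrable[OF 2(2)]])
        (use integrable_normal_moment[where \<mu> = \<mu> and \<sigma> = \<sigma> and k = 2] \<mu> 2(1) in simp_all)
    ultimately show thesis using normal 2 \<mu> by simp
  qed
qed

lemma (in prob_space) centered_gaussian_char: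
  assumes "gaussian_rv M Y" "expectation Y = 0"
  shows "(CLINT \<omega>|M. iexp (Y \<omega>)) = of_real (exp (- expectation (\<lambda>\<omega>. (Y \<omega>)\<^sup>2) / 2))"
  using assms
proof (cases rule: centered_gaussian_cases)
  case degenerate
  have [measurable]: "Y \<in> borel_measurable M" using assms by (simp add: gaussian_rv_def)
  have "(CLINT \<omega>|M. iexp (Y \<omega>)) = (CLINT \<omega>|M. 1)"
    using degenerate by (intro integral_cong_AE) auto
  then show ?thesis using degenerate by (simp add: prob_space)
next
  case (normal \<sigma>)
  have [measurable]: "Y \<in> borel_measurable M" using assms by (simp add: gaussian_rv_def)
  have "distributed M lborel (\<lambda>\<omega>. Y \<omega> / \<sigma>) (\<lambda>x. ennreal (std_normal_density x))"
    using normal_standard_normal_convert[OF normal(1), of Y 0] normal by simp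
  then have "distr M lborel (\<lambda>\<omega>. Y \<omega> / \<sigma>) = std_normal_distribution"
    by (rule distributed_distr_eq_density)
  then have "char (distr M lborel (\<lambda>\<omega>. Y \<omega> / \<sigma>)) \<sigma> = of_real (exp (- \<sigma>\<^sup>2 / 2))"
    by (simp add: char_std_normal_distribution)
  moreover have "char (distr M lborel (\<lambda>\<omega>. Y \<omega> / \<sigma>)) \<sigma> = (CLINT \<omega>|M. iexp (Y \<omega>))"
    using normal(1) unfolding char_def by (subst integral_distr) auto
  ultimately show ?thesis using normal by simp
qed

text \<open>Completing the square turns the centred normal density of variance \<open>q\<close>
  times \<open>exp (x - q / 2)\<close> into the normal density with mean \<open>q\<close>: the
  Cameron-Martin formula in dimension one. The equality holds for every measurable \<open>k\<close>,
  since both sides become integrals of the same function up to translation.\<close>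

lemma (in prob_space) centered_gaussian_exp_shift:
  fixes k :: "real \<Rightarrow> 'b::{banach, second_countable_topology}"
  assumes "gaussian_rv M Y" "expectation Y = 0" and q: "q = expectation (\<lambda>\<omega>. (Y \<omega>)\<^sup>2)"
    and [measurable]: "k \<in> borel_measurable borel"
  shows "expectation (\<lambda>\<omega>. exp (Y \<omega> - q / 2) *\<^sub>R k (Y \<omega>)) = expectation (\<lambda>\<omega>. k (Y \<omega> + q))"
    and "integrable M (\<lambda>\<omega>. k (Y \<omega> + q)) \<Longrightarrow> integrable M (\<lambda>\<omega>. exp (Y \<omega> - q / 2) *\<^sub>R k (Y \<omega>))"
proof -
  have [measurable]: "Y \<in> borel_measurable M" using assms by (simp add: gaussian_rv_def)
  have "expectation (\<lambda>\<omega>. exp (Y \<omega> - q / 2) *\<^sub>R k (Y \<omega>)) = expectation (\<lambda>\<omega>. k (Y \<omega> + q)) \<and>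
     (integrable M (\<lambda>\<omega>. k (Y \<omega> + q)) \<longrightarrow> integrable M (\<lambda>\<omega>. exp (Y \<omega> - q / 2) *\<^sub>R k (Y \<omega>)))"
    using assms(1,2)
  proof (cases rule: centered_gaussian_cases)
    case degenerate
    then have ae: "AE \<omega> in M. exp (Y \<omega> - q / 2) *\<^sub>R k (Y \<omega>) = k (Y \<omega> + q)"
      by (auto simp: q)
    show ?thesis
      using ae by (auto intro!: integral_cong_AE simp: integrable_cong_AE[OF _ _ ae])
  next
    case (normal \<sigma>)
    have D: "distr M lborel Y = density lborel (\<lambda>x. ennreal (normal_density 0 \<sigma> x))"
      using normal by (intro distributed_distr_eq_density)
    have ex: "expectation (\<lambda>\<omega>. f (Y \<omega>)) = (\<integral>x. normal_density 0 \<sigma> x *\<^sub>R f x \<partial>lborel)"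
      if [measurable]: "f \<in> borel_measurable borel" for f :: "real \<Rightarrow> 'b"
    proof -
      have "expectation (\<lambda>\<omega>. f (Y \<omega>)) = (\<integral>x. f x \<partial>distr M lborel Y)" by (simp add: integral_distr)
      then show ?thesis by (simp add: D integral_density)
    qed
    have int: "integrable M (\<lambda>\<omega>. f (Y \<omega>)) \<longleftrightarrow> integrable lborel (\<lambda>x. normal_density 0 \<sigma> x *\<^sub>R f x)"
      if [measurable]: "f \<in> borel_measurable borel" for f :: "real \<Rightarrow> 'b"
    proof -
      have "integrable M (\<lambda>\<omega>. f (Y \<omega>)) \<longleftrightarrow> integrable (distr M lborel Y) f"
        by (simp add: integrable_distr_eq)
      then show ?thesis by (simp add: D integrable_density)
    qed
    have qs: "q = \<sigma>\<^sup>2" using normal q by simp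
    have nd: "normal_density 0 \<sigma> x * exp (x - q / 2) = normal_density 0 \<sigma> (x - q)" for x
    proof -
      have "- (x\<^sup>2) / (2 * \<sigma>\<^sup>2) + (x - \<sigma>\<^sup>2 / 2) = - ((x - \<sigma>\<^sup>2)\<^sup>2) / (2 * \<sigma>\<^sup>2)"
        using normal(1) by (simp add: field_simps power2_eq_square)
      then show ?thesis unfolding normal_density_def qs by (simp flip: exp_add)
    qed
    have "expectation (\<lambda>\<omega>. exp (Y \<omega> - q / 2) *\<^sub>R k (Y \<omega>)) =
        (\<integral>x. normal_density 0 \<sigma> (x - q) *\<^sub>R k x \<partial>lborel)"
      by (subst ex) (simp_all add: nd)
    also have "\<dots> = (\<integral>x. normal_density 0 \<sigma> x *\<^sub>R k (x + q) \<partial>lborel)"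
      by (subst lborel_integral_real_affine[where c = 1 and t = q]) (simp_all add: add.commute)
    also have "\<dots> = expectation (\<lambda>\<omega>. k (Y \<omega> + q))"
      by (rule ex[symmetric]) simp
    finally have "expectation (\<lambda>\<omega>. exp (Y \<omega> - q / 2) *\<^sub>R k (Y \<omega>)) = expectation (\<lambda>\<omega>. k (Y \<omega> + q))" .
    moreover have "integrable M (\<lambda>\<omega>. exp (Y \<omega> - q / 2) *\<^sub>R k (Y \<omega>)) \<longleftrightarrow>
        integrable lborel (\<lambda>x. normal_density 0 \<sigma> (x - q) *\<^sub>R k x)"
      by (subst int) (simp_all add: nd)
    moreover have "integrable lborel (\<lambda>x. normal_density 0 \<sigma> (x - q) *\<^sub>R k x) \<longleftrightarrow>
        integrable lborel (\<lambda>x. normal_density 0 \<sigma> x *\<^sub>R k (x + q))"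
      using lborel_integrable_real_affine_iff[of 1 "\<lambda>x. normal_density 0 \<sigma> (x - q) *\<^sub>R k x" q]
      by (simp add: add.commute)
    moreover have "integrable lborel (\<lambda>x. normal_density 0 \<sigma> x *\<^sub>R k (x + q)) \<longleftrightarrow>
        integrable M (\<lambda>\<omega>. k (Y \<omega> + q))"
      by (rule int[symmetric]) simp
    ultimately show ?thesis by simp
  qed
  then show "expectation (\<lambda>\<omega>. exp (Y \<omega> - q / 2) *\<^sub>R k (Y \<omega>)) = expectation (\<lambda>\<omega>. k (Y \<omega> + q))"
    "integrable M (\<lambda>\<omega>. k (Y \<omega> + q)) \<Longrightarrow> integrable M (\<lambda>\<omega>. exp (Y \<omega> - q / 2) *\<^sub>R k (Y \<omega>))"
    by auto
qed

text \<open>The consequence of independence that is needed later, drawn from the factorised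
  characteristic function. The weight \<open>2 + cos (Y \<omega> + p)\<close> changes the law of
  \<open>Z\<close> by a constant factor \<open>C\<close> only, so \<open>k\<close> may be unbounded,
  as is the exponential density in \<open>cameron_martin\<close>.\<close>

lemma (in prob_space) expectation_iexp_mult:
  fixes k :: "real \<Rightarrow> complex"
  assumes [measurable]: "Y \<in> borel_measurable M" "Z \<in> borel_measurable M" "k \<in> borel_measurable borel"
    and char: "\<And>s u. (CLINT \<omega>|M. iexp (s * Z \<omega> + u * Y \<omega>)) = (CLINT \<omega>|M. iexp (s * Z \<omega>)) * (CLINT \<omega>|M. iexp (u * Y \<omega>))"
    and k: "integrable M (\<lambda>\<omega>. k (Z \<omega>))"
  shows "(CLINT \<omega>|M. iexp (Y \<omega>) * k (Z \<omega>)) = (CLINT \<omega>|M. iexp (Y \<omega>)) * (CLINT \<omega>|M. k (Z \<omega>))"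
proof -
  have nn: "0 \<le> 2 + cos t" for t :: real using cos_ge_minus_one[of t] by linarith
  have ci: "integrable M (\<lambda>\<omega>. cos (Y \<omega> + p))" for p
    by (rule integrable_const_bound[where B = 1]) auto
  have cos_k: "integrable M (\<lambda>\<omega>. of_real (cos (Y \<omega> + p)) * k (Z \<omega>))" for p
    using k by (rule Bochner_Integration.integrable_bound)
      (auto simp: norm_mult intro!: mult_left_le_one_le)
  have cos: "(CLINT \<omega>|M. of_real (cos (Y \<omega> + p)) * k (Z \<omega>)) =
      of_real (expectation (\<lambda>\<omega>. cos (Y \<omega> + p))) * (CLINT \<omega>|M. k (Z \<omega>))" for p
  proof -
    define C where "C = expectation (\<lambda>\<omega>. 2 + cos (Y \<omega> + p))"
    have C: "0 \<le> C" unfolding C_def using nn by (intro integral_nonneg_AE) auto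
    have C': "C = 2 + expectation (\<lambda>\<omega>. cos (Y \<omega> + p))"
      unfolding C_def using ci by (simp add: prob_space)
    have iexp_int: "integrable M (\<lambda>\<omega>. iexp (s * Z \<omega> + u * Y \<omega>))" for s u
      by (rule integrable_const_bound[where B = 1]) auto
    have cosp: "complex_of_real (cos (t + p)) = iexp p / 2 * iexp (1 * t) + iexp (- p) / 2 * iexp ((-1) * t)" for t
    proof -
      have "iexp (t + p) = iexp p * iexp (1 * t)" "iexp (- (t + p)) = iexp (- p) * iexp ((- 1) * t)"
        by (simp_all only: iexp_add[symmetric]) (simp_all add: add.commute)
      then show ?thesis unfolding cos_eq_iexp by (simp only: add_divide_distrib times_divide_eq_left)
    qed
    have "distr (density M (\<lambda>\<omega>. ennreal (2 + cos (Y \<omega> + p)))) borel Z =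
        distr (density M (\<lambda>\<omega>. ennreal C)) borel Z"
    proof (rule weighted_distr_eqI[where C = "max 3 C"])
      show "0 \<le> 2 + cos (Y \<omega> + p) \<and> 2 + cos (Y \<omega> + p) \<le> max 3 C" for \<omega>
        using nn[of "Y \<omega> + p"] cos_le_one[of "Y \<omega> + p"] by linarith
      fix s
      have e1: "(2 + cos (Y \<omega> + p)) *\<^sub>R iexp (s * Z \<omega>) = 2 * iexp (s * Z \<omega> + 0 * Y \<omega>) +
          iexp p / 2 * iexp (s * Z \<omega> + 1 * Y \<omega>) + iexp (- p) / 2 * iexp (s * Z \<omega> + (-1) * Y \<omega>)" for \<omega>
      proof -
        have "complex_of_real (2 + cos (Y \<omega> + p)) = 2 + complex_of_real (cos (Y \<omega> + p))" by simp
        then show ?thesis unfolding scaleR_conv_of_real cosp iexp_add by (simp only:) (simp add: field_simps)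
      qed
      have "of_real (expectation (\<lambda>\<omega>. cos (Y \<omega> + p))) = (CLINT \<omega>|M. complex_of_real (cos (Y \<omega> + p)))"
        by (simp only: integral_complex_of_real)
      also have "\<dots> = iexp p / 2 * (CLINT \<omega>|M. iexp (1 * Y \<omega>)) + iexp (- p) / 2 * (CLINT \<omega>|M. iexp ((-1) * Y \<omega>))"
        unfolding cosp using iexp_int[of 0 1] iexp_int[of 0 "-1"]
        by (subst Bochner_Integration.integral_add) auto
      finally have e2: "of_real (expectation (\<lambda>\<omega>. cos (Y \<omega> + p))) =
        iexp p / 2 * (CLINT \<omega>|M. iexp (1 * Y \<omega>)) + iexp (- p) / 2 * (CLINT \<omega>|M. iexp ((-1) * Y \<omega>))" .
      have e3: "(CLINT \<omega>|M. iexp (0 * Y \<omega>)) = 1" by (simp add: prob_space)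
      have "(CLINT \<omega>|M. (2 + cos (Y \<omega> + p)) *\<^sub>R iexp (s * Z \<omega>)) =
          2 * (CLINT \<omega>|M. iexp (s * Z \<omega> + 0 * Y \<omega>)) +
          iexp p / 2 * (CLINT \<omega>|M. iexp (s * Z \<omega> + 1 * Y \<omega>)) +
          iexp (- p) / 2 * (CLINT \<omega>|M. iexp (s * Z \<omega> + (-1) * Y \<omega>))"
        unfolding e1 using iexp_int
        by (simp only: Bochner_Integration.integral_add Bochner_Integration.integrable_add
            integrable_mult_right integral_mult_right_zero)
      also have "\<dots> = of_real C * (CLINT \<omega>|M. iexp (s * Z \<omega>))"
      proof -
        have "complex_of_real C = 2 + of_real (expectation (\<lambda>\<omega>. cos (Y \<omega> + p)))" by (simp add: C')
        then show ?thesis unfolding char e3 e2 by (simp only:) (simp add: field_simps)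
      qed
      also have "\<dots> = (CLINT \<omega>|M. C *\<^sub>R iexp (s * Z \<omega>))"
        by (simp add: scaleR_conv_of_real)
      finally show "(CLINT \<omega>|M. (2 + cos (Y \<omega> + p)) *\<^sub>R iexp (s * Z \<omega>)) = (CLINT \<omega>|M. C *\<^sub>R iexp (s * Z \<omega>))" .
    qed (use C prob_space_axioms in auto)
    from arg_cong[OF this, of "\<lambda>M. \<integral>x. k x \<partial>M"]
    have "(CLINT \<omega>|M. (2 + cos (Y \<omega> + p)) *\<^sub>R k (Z \<omega>)) = (CLINT \<omega>|M. C *\<^sub>R k (Z \<omega>))"
      using nn C by (subst (asm) (1 2) integral_distr_density) auto
    moreover have "(CLINT \<omega>|M. (2 + cos (Y \<omega> + p)) *\<^sub>R k (Z \<omega>)) =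
        2 * (CLINT \<omega>|M. k (Z \<omega>)) + (CLINT \<omega>|M. of_real (cos (Y \<omega> + p)) * k (Z \<omega>))"
    proof -
      show ?thesis using k cos_k[of p] by (simp add: scaleR_conv_of_real ring_distribs)
    qed
    moreover have "(CLINT \<omega>|M. C *\<^sub>R k (Z \<omega>)) = of_real C * (CLINT \<omega>|M. k (Z \<omega>))"
      by (simp add: scaleR_conv_of_real)
    ultimately show ?thesis unfolding C' by (simp add: ring_distribs)
  qed
  note int = cos_k[of 0] cos_k[of "- (pi / 2)"]
  have "iexp (Y \<omega>) * k (Z \<omega>) = of_real (cos (Y \<omega> + 0)) * k (Z \<omega>) + \<i> * (of_real (cos (Y \<omega> + - (pi / 2))) * k (Z \<omega>))" for \<omega>
    by (simp add: iexp_eq_cos[of "Y \<omega>"] algebra_simps)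
  then have eq: "(CLINT \<omega>|M. iexp (Y \<omega>) * k (Z \<omega>)) =
      of_real (expectation (\<lambda>\<omega>. cos (Y \<omega> + 0))) * (CLINT \<omega>|M. k (Z \<omega>)) +
      \<i> * (of_real (expectation (\<lambda>\<omega>. cos (Y \<omega> + - (pi / 2)))) * (CLINT \<omega>|M. k (Z \<omega>)))"
    using int by (simp only: Bochner_Integration.integral_add integrable_mult_right integral_mult_right_zero cos)
  have "(CLINT \<omega>|M. iexp (Y \<omega>)) =
      of_real (expectation (\<lambda>\<omega>. cos (Y \<omega> + 0))) + \<i> * of_real (expectation (\<lambda>\<omega>. cos (Y \<omega> + - (pi / 2))))"
  proof -
    have "(CLINT \<omega>|M. iexp (Y \<omega>)) = (CLINT \<omega>|M. of_real (cos (Y \<omega> + 0)) + \<i> * of_real (cos (Y \<omega> + - (pi / 2))))"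
      by (simp add: iexp_eq_cos[of "Y _"])
    also have "\<dots> = (CLINT \<omega>|M. of_real (cos (Y \<omega> + 0))) + \<i> * (CLINT \<omega>|M. of_real (cos (Y \<omega> + - (pi / 2))))"
      by (subst Bochner_Integration.integral_add) (use ci[of 0] ci[of "- (pi / 2)"] in \<open>auto intro!: integrable_mult_right integrable_of_real\<close>)
    finally show ?thesis by (simp only: integral_complex_of_real)
  qed
  then show ?thesis unfolding eq by (simp only: distrib_right mult.assoc)
qed

section \<open>The Cameron-Martin formula\<close>

definition square_integrable :: "'a measure \<Rightarrow> ('a \<Rightarrow> real) \<Rightarrow> bool" where
  "square_integrable N f \<longleftrightarrow> f \<in> borel_measurable N \<and> integrable N (\<lambda>x. (f x)\<^sup>2)"

lemma square_integrable_mult: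
  assumes "square_integrable N f" "square_integrable N g"
  shows "integrable N (\<lambda>x. f x * g x)"
proof (rule Bochner_Integration.integrable_bound)
  show "integrable N (\<lambda>x. (f x)\<^sup>2 + (g x)\<^sup>2)"
    using assms unfolding square_integrable_def by (intro Bochner_Integration.integrable_add) auto
  have *: "\<bar>x * y\<bar> \<le> \<bar>x\<^sup>2 + y\<^sup>2\<bar>" for x y :: real
    using sum_squares_bound[of "\<bar>x\<bar>" "\<bar>y\<bar>"] abs_ge_zero[of "x * y"] unfolding abs_mult power2_abs by linarith
  show "AE x in N. norm (f x * g x) \<le> norm ((f x)\<^sup>2 + (g x)\<^sup>2)"
    unfolding real_norm_def by (rule AE_I2) (rule *)
  show "(\<lambda>x. f x * g x) \<in> borel_measurable N"
    using assms unfolding square_integrable_def by (intro borel_measurable_times) auto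
qed

locale centered_gaussian_process = prob_space M for M :: "'w measure" +
  fixes X :: "'t \<Rightarrow> 'w \<Rightarrow> real"
  assumes gaussian: "gaussian_process M X" and mean: "expectation (X t) = 0"
begin

lemma gaussian_rv_sum: "finite I \<Longrightarrow> gaussian_rv M (\<lambda>\<omega>. \<Sum>t\<in>I. c t * X t \<omega>)"
  using gaussian by (simp add: gaussian_process_def)

lemma gaussian_rv_X: "gaussian_rv M (X t)"
  using gaussian_rv_sum[of "{t}" "\<lambda>_. 1"] by simp

lemma X_measurable[measurable]: "X t \<in> borel_measurable M"
  using gaussian_rv_X by (simp add: gaussian_rv_def)

lemma integrable_X_squared: "integrable M (\<lambda>\<omega>. (X t \<omega>)\<^sup>2)"
  by (rule centered_gaussian_cases[OF gaussian_rv_X mean])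

lemma integrable_X: "integrable M (X t)"
  using X_measurable integrable_X_squared by (rule square_integrable_imp_integrable)

lemma integrable_X_mult: "integrable M (\<lambda>\<omega>. X s \<omega> * X t \<omega>)"
  by (rule square_integrable_mult) (simp_all add: square_integrable_def integrable_X_squared)

lemma expectation_sum: "expectation (\<lambda>\<omega>. \<Sum>t\<in>I. c t * X t \<omega>) = 0"
  by (simp add: Bochner_Integration.integral_sum integrable_X mean)

lemma integrable_sum_mult_sum:
  "integrable M (\<lambda>\<omega>. (\<Sum>s\<in>I. c s * X s \<omega>) * (\<Sum>t\<in>J. d t * X t \<omega>))"
proof -
  have "(\<Sum>s\<in>I. c s * X s \<omega>) * (\<Sum>t\<in>J. d t * X t \<omega>) =
      (\<Sum>s\<in>I. \<Sum>t\<in>J. (c s * d t) * (X s \<omega> * X t \<omega>))" for \<omega>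
    by (simp add: sum_product mult_ac)
  then show ?thesis using integrable_X_mult by simp
qed

lemma expectation_iexp_sum:
  assumes "finite I"
  shows "(CLINT \<omega>|M. iexp (\<Sum>t\<in>I. c t * X t \<omega>)) = of_real (exp (- expectation (\<lambda>\<omega>. (\<Sum>t\<in>I. c t * X t \<omega>)\<^sup>2) / 2))"
  using assms by (intro centered_gaussian_char gaussian_rv_sum expectation_sum)

text \<open>Compare characteristic functions. A linear combination \<open>V\<close> splits into
  \<open>a * Z\<close> and a part \<open>Y\<close> uncorrelated with \<open>Z\<close>, from which
  \<open>expectation_iexp_mult\<close> separates it. The density acts on \<open>Z\<close> alone and
  shifts it by \<open>q\<close>, so \<open>V\<close> moves by \<open>a * q\<close>, which equals
  \<open>\<Sum>t\<in>I. d t * b t\<close>.\<close>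

lemma cameron_martin:
  assumes I: "finite I"
    and Z_def: "\<And>\<omega>. Z \<omega> = (\<Sum>t\<in>I. c t * X t \<omega>)"
    and q_def: "q = expectation (\<lambda>\<omega>. (Z \<omega>)\<^sup>2)"
    and b_def: "\<And>t. b t = expectation (\<lambda>\<omega>. X t \<omega> * Z \<omega>)"
  shows "prob_space (density M (\<lambda>\<omega>. exp (Z \<omega> - q / 2)))"
    and "distr (density M (\<lambda>\<omega>. exp (Z \<omega> - q / 2))) (\<Pi>\<^sub>M t\<in>I. borel) (\<lambda>\<omega>. \<lambda>t\<in>I. X t \<omega>) =
         distr M (\<Pi>\<^sub>M t\<in>I. borel) (\<lambda>\<omega>. \<lambda>t\<in>I. X t \<omega> + b t)"
proof -
  have Z: "Z = (\<lambda>\<omega>. \<Sum>t\<in>I. c t * X t \<omega>)" using Z_def by (rule ext)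
  have [measurable]: "Z \<in> borel_measurable M" unfolding Z by measurable
  have gZ: "gaussian_rv M Z" and mZ: "expectation Z = 0"
    unfolding Z by (rule gaussian_rv_sum[OF I], rule expectation_sum)
  note shift = centered_gaussian_exp_shift[OF gZ mZ q_def]
  have one: "(\<lambda>_::real. 1::real) \<in> borel_measurable borel" by (rule borel_measurable_const)
  have exp1: "expectation (\<lambda>\<omega>. 1 :: real) = 1" by (simp add: prob_space)
  have iw: "integrable M (\<lambda>\<omega>. exp (Z \<omega> - q / 2))"
    using shift(2)[OF one integrable_const] unfolding real_scaleR_def mult_1_right .
  have ew: "expectation (\<lambda>\<omega>. exp (Z \<omega> - q / 2)) = 1"
    using shift(1)[OF one] unfolding real_scaleR_def mult_1_right exp1 .
  show Q: "prob_space (density M (\<lambda>\<omega>. exp (Z \<omega> - q / 2)))"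
  proof (rule prob_spaceI)
    have "emeasure (density M (\<lambda>\<omega>. ennreal (exp (Z \<omega> - q / 2)))) (space M) = (\<integral>\<^sup>+\<omega>. ennreal (exp (Z \<omega> - q / 2)) \<partial>M)"
      by (simp add: emeasure_density cong: nn_integral_cong)
    also have "\<dots> = ennreal (expectation (\<lambda>\<omega>. exp (Z \<omega> - q / 2)))"
      using iw by (intro nn_integral_eq_integral) auto
    finally show "emeasure (density M (\<lambda>\<omega>. exp (Z \<omega> - q / 2))) (space (density M (\<lambda>\<omega>. exp (Z \<omega> - q / 2)))) = 1"
      by (simp add: ew)
  qed
  show "distr (density M (\<lambda>\<omega>. exp (Z \<omega> - q / 2))) (\<Pi>\<^sub>M t\<in>I. borel) (\<lambda>\<omega>. \<lambda>t\<in>I. X t \<omega>) =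
         distr M (\<Pi>\<^sub>M t\<in>I. borel) (\<lambda>\<omega>. \<lambda>t\<in>I. X t \<omega> + b t)"
  proof (rule char_vector_unique[OF Q prob_space_axioms I])
    fix d
    define V where "V \<omega> = (\<Sum>t\<in>I. d t * X t \<omega>)" for \<omega>
    \<comment> \<open>The regression coefficient of \<open>V\<close> on \<open>Z\<close>. For
      \<open>q = 0\<close> the division gives \<open>a = 0\<close>, and \<open>aq\<close> still
      holds because \<open>Z\<close> vanishes almost surely.\<close>
    define a where "a = expectation (\<lambda>\<omega>. V \<omega> * Z \<omega>) / q"
    define Y where "Y \<omega> = V \<omega> - a * Z \<omega>" for \<omega>
    have [measurable]: "V \<in> borel_measurable M" "Y \<in> borel_measurable M"
      unfolding Y_def[abs_def] V_def[abs_def] by measurable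
    have iVZ: "integrable M (\<lambda>\<omega>. V \<omega> * Z \<omega>)" and iZZ: "integrable M (\<lambda>\<omega>. (Z \<omega>)\<^sup>2)"
      unfolding V_def Z power2_eq_square by (rule integrable_sum_mult_sum)+
    have aq: "a * q = expectation (\<lambda>\<omega>. V \<omega> * Z \<omega>)"
    proof (cases "q = 0")
      case True
      then have "AE \<omega> in M. (Z \<omega>)\<^sup>2 = 0"
        using integral_nonneg_eq_0_iff_AE[OF iZZ] by (simp add: q_def)
      then have "AE \<omega> in M. V \<omega> * Z \<omega> = 0" by auto
      then have "expectation (\<lambda>\<omega>. V \<omega> * Z \<omega>) = expectation (\<lambda>\<omega>. 0)"
        by (intro integral_cong_AE) auto
      with True show ?thesis by simp
    qed (simp add: a_def)
    have YZ: "expectation (\<lambda>\<omega>. Y \<omega> * Z \<omega>) = 0"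
    proof -
      have "expectation (\<lambda>\<omega>. Y \<omega> * Z \<omega>) = expectation (\<lambda>\<omega>. V \<omega> * Z \<omega> - a * (Z \<omega>)\<^sup>2)"
        by (simp add: Y_def left_diff_distrib power2_eq_square mult.assoc)
      also have "\<dots> = expectation (\<lambda>\<omega>. V \<omega> * Z \<omega>) - a * q"
        using iVZ iZZ by (subst Bochner_Integration.integral_diff) (auto simp: q_def)
      finally show ?thesis using aq by simp
    qed
    have Y: "Y = (\<lambda>\<omega>. \<Sum>t\<in>I. (d t - a * c t) * X t \<omega>)"
      unfolding Y_def[abs_def] V_def Z by (simp add: algebra_simps sum_subtractf sum_distrib_left)
    have iYZ: "integrable M (\<lambda>\<omega>. Y \<omega> * Z \<omega>)" and iYY: "integrable M (\<lambda>\<omega>. (Y \<omega>)\<^sup>2)"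
      unfolding Y Z power2_eq_square by (rule integrable_sum_mult_sum)+
    \<comment> \<open>The mixed term of the variance disappears by \<open>YZ\<close>, which is why
      the characteristic function factorises.\<close>
    have char: "(CLINT \<omega>|M. iexp (s * Z \<omega> + u * Y \<omega>)) = of_real (exp (- (s\<^sup>2 * q + u\<^sup>2 * expectation (\<lambda>\<omega>. (Y \<omega>)\<^sup>2)) / 2))" for s u
    proof -
      have comb: "s * Z \<omega> + u * Y \<omega> = (\<Sum>t\<in>I. (s * c t + u * (d t - a * c t)) * X t \<omega>)" for \<omega>
        unfolding Y Z by (simp add: distrib_right sum.distrib sum_distrib_left mult.assoc)
      have "expectation (\<lambda>\<omega>. (s * Z \<omega> + u * Y \<omega>)\<^sup>2) =
          expectation (\<lambda>\<omega>. s\<^sup>2 * (Z \<omega>)\<^sup>2 + u\<^sup>2 * (Y \<omega>)\<^sup>2 + (2 * s * u) * (Y \<omega> * Z \<omega>))"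
        by (simp add: power2_eq_square algebra_simps)
      also have "\<dots> = s\<^sup>2 * q + u\<^sup>2 * expectation (\<lambda>\<omega>. (Y \<omega>)\<^sup>2)"
        using iZZ iYY iYZ YZ by (simp add: q_def)
      finally show ?thesis
        using expectation_iexp_sum[OF I, of "\<lambda>t. s * c t + u * (d t - a * c t)"]
        by (simp flip: comb)
    qed
    define k where "k z = exp (z - q / 2) *\<^sub>R iexp (a * z)" for z
    have [measurable]: "k \<in> borel_measurable borel" unfolding k_def[abs_def] by measurable
    have iV: "iexp (V \<omega>) = iexp (Y \<omega>) * iexp (a * Z \<omega>)" for \<omega>
      by (simp add: Y_def flip: exp_add) (simp add: algebra_simps)
    have "(CLINT \<omega>|density M (\<lambda>\<omega>. exp (Z \<omega> - q / 2)). iexp (V \<omega>)) = (CLINT \<omega>|M. iexp (Y \<omega>) * k (Z \<omega>))"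
      by (subst integral_density) (auto simp: iV k_def)
    also have "\<dots> = (CLINT \<omega>|M. iexp (Y \<omega>)) * (CLINT \<omega>|M. k (Z \<omega>))"
    proof (rule expectation_iexp_mult)
      show "(CLINT \<omega>|M. iexp (s * Z \<omega> + u * Y \<omega>)) = (CLINT \<omega>|M. iexp (s * Z \<omega>)) * (CLINT \<omega>|M. iexp (u * Y \<omega>))" for s u
      proof -
        have "(CLINT \<omega>|M. iexp (s * Z \<omega>)) = (CLINT \<omega>|M. iexp (s * Z \<omega> + 0 * Y \<omega>))"
          "(CLINT \<omega>|M. iexp (u * Y \<omega>)) = (CLINT \<omega>|M. iexp (0 * Z \<omega> + u * Y \<omega>))" by simp_all
        then show ?thesis unfolding char by (simp add: add_divide_distrib diff_divide_distrib flip: of_real_mult exp_add)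
      qed
      show "integrable M (\<lambda>\<omega>. k (Z \<omega>))"
        unfolding k_def by (rule shift(2)) (auto intro!: integrable_const_bound[where B = 1])
    qed auto
    also have "(CLINT \<omega>|M. k (Z \<omega>)) = (CLINT \<omega>|M. iexp (a * (Z \<omega> + q)))"
      unfolding k_def by (rule shift(1)) simp
    also have "\<dots> = (CLINT \<omega>|M. iexp (a * q) * iexp (a * Z \<omega>))"
      by (intro Bochner_Integration.integral_cong refl) (simp add: algebra_simps flip: exp_add)
    also have "\<dots> = iexp (a * q) * (CLINT \<omega>|M. iexp (a * Z \<omega>))" by simp
    also have "(CLINT \<omega>|M. iexp (Y \<omega>)) * (iexp (a * q) * (CLINT \<omega>|M. iexp (a * Z \<omega>))) =
        iexp (a * q) * (CLINT \<omega>|M. iexp (a * Z \<omega> + 1 * Y \<omega>))"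
    proof -
      have "(CLINT \<omega>|M. iexp (Y \<omega>)) = (CLINT \<omega>|M. iexp (0 * Z \<omega> + 1 * Y \<omega>))"
        "(CLINT \<omega>|M. iexp (a * Z \<omega>)) = (CLINT \<omega>|M. iexp (a * Z \<omega> + 0 * Y \<omega>))" by simp_all
      then show ?thesis unfolding char by (simp add: add_divide_distrib diff_divide_distrib flip: of_real_mult exp_add)
    qed
    also have "\<dots> = (CLINT \<omega>|M. iexp (a * q) * iexp (V \<omega>))" by (simp add: Y_def)
    also have "\<dots> = (CLINT \<omega>|M. iexp (\<Sum>t\<in>I. d t * (X t \<omega> + b t)))"
    proof -
      have "(\<Sum>t\<in>I. d t * b t) = expectation (\<lambda>\<omega>. \<Sum>t\<in>I. d t * (X t \<omega> * Z \<omega>))"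
      proof -
        have "integrable M (\<lambda>\<omega>. X t \<omega> * Z \<omega>)" for t
          using integrable_sum_mult_sum[where I = "{t}" and c = "\<lambda>_. 1" and J = I and d = c] by (simp add: Z)
        then show ?thesis by (simp add: b_def)
      qed
      also have "\<dots> = a * q" unfolding aq V_def by (simp add: sum_distrib_right mult.assoc)
      finally have "(\<Sum>t\<in>I. d t * (X t \<omega> + b t)) = a * q + V \<omega>" for \<omega>
        by (simp add: distrib_left sum.distrib V_def)
      then show ?thesis by (simp only: iexp_add)
    qed
    finally show "(CLINT \<omega>|density M (\<lambda>\<omega>. exp (Z \<omega> - q / 2)). iexp (\<Sum>t\<in>I. d t * X t \<omega>)) =
       (CLINT \<omega>|M. iexp (\<Sum>t\<in>I. d t * (X t \<omega> + b t)))" by (simp only: V_def)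
  qed auto
qed

text \<open>The likelihood ratio \<open>w\<close> satisfies
  \<open>w \<le> \<tau> + w\<^sup>2 / \<tau>\<close> pointwise: compare \<open>w\<close> with
  \<tau>. Integrating over the event, with the last term enlarged to the whole space, leaves only
  the second moment of \<open>w\<close>, which is \<open>exp q\<close>.\<close>

lemma shift_prob_le:
  assumes I: "finite I"
    and Z_def: "\<And>\<omega>. Z \<omega> = (\<Sum>t\<in>I. c t * X t \<omega>)"
    and q_def: "q = expectation (\<lambda>\<omega>. (Z \<omega>)\<^sup>2)"
    and b_def: "\<And>t. t \<in> I \<Longrightarrow> b t = expectation (\<lambda>\<omega>. X t \<omega> * Z \<omega>)"
    and A[measurable]: "A \<in> sets (\<Pi>\<^sub>M t\<in>I. borel)" and \<tau>: "0 < \<tau>"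
  shows "measure (distr M (\<Pi>\<^sub>M t\<in>I. borel) (\<lambda>\<omega>. \<lambda>t\<in>I. a t + \<epsilon> * (X t \<omega> + b t))) A
     \<le> \<tau> * measure (distr M (\<Pi>\<^sub>M t\<in>I. borel) (\<lambda>\<omega>. \<lambda>t\<in>I. a t + \<epsilon> * X t \<omega>)) A + exp q / \<tau>"
proof -
  let ?P = "\<Pi>\<^sub>M t\<in>I. (borel :: real measure)"
  have Z: "Z = (\<lambda>\<omega>. \<Sum>t\<in>I. c t * X t \<omega>)" using Z_def by (rule ext)
  have [measurable]: "Z \<in> borel_measurable M" unfolding Z by measurable
  have gZ: "gaussian_rv M Z" and mZ: "expectation Z = 0"
    unfolding Z by (rule gaussian_rv_sum[OF I], rule expectation_sum)
  note shift = centered_gaussian_exp_shift[OF gZ mZ q_def]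
  define w where "w \<omega> = exp (Z \<omega> - q / 2)" for \<omega>
  have [measurable]: "w \<in> borel_measurable M" unfolding w_def[abs_def] by measurable
  have one: "(\<lambda>_::real. 1::real) \<in> borel_measurable borel" by (rule borel_measurable_const)
  have exp1: "expectation (\<lambda>\<omega>. 1 :: real) = 1" by (simp add: prob_space)
  have iw: "integrable M w"
    using shift(2)[OF one integrable_const] unfolding real_scaleR_def mult_1_right w_def[symmetric] .
  have ew: "expectation w = 1"
    using shift(1)[OF one] unfolding real_scaleR_def mult_1_right w_def[symmetric] exp1 .
  have wq: "exp ((Z \<omega> + q) - q / 2) = exp q * w \<omega>" for \<omega>
    by (simp add: w_def flip: exp_add)
  have ww: "exp (Z \<omega> - q / 2) *\<^sub>R exp (Z \<omega> - q / 2) = (w \<omega>)\<^sup>2" for \<omega>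
    by (simp add: w_def power2_eq_square)
  \<comment> \<open>The shift formula is applied to the density itself: moving \<open>Z\<close> by
    \<open>q\<close> multiplies \<open>w\<close> by \<open>exp q\<close>.\<close>
  have k: "(\<lambda>z. exp (z - q / 2)) \<in> borel_measurable borel" by measurable
  have iww: "integrable M (\<lambda>\<omega>. (w \<omega>)\<^sup>2)"
    using shift(2)[OF k] iw unfolding wq ww by (simp only: integrable_mult_right)
  have eww: "expectation (\<lambda>\<omega>. (w \<omega>)\<^sup>2) = exp q"
    using shift(1)[OF k] ew unfolding wq ww by (simp only: integral_mult_right_zero mult_1_right)
  \<comment> \<open>The affine map from values of the process to observations; through it the event
    \<open>A\<close> is pulled back to an event \<open>B\<close> for the process itself.\<close>
  define T where "T x = (\<lambda>t\<in>I. a t + \<epsilon> * x t)" for x :: "'t \<Rightarrow> real"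
  have T[measurable]: "T \<in> measurable ?P ?P" unfolding T_def[abs_def] by measurable
  have m1[measurable]: "(\<lambda>\<omega>. \<lambda>t\<in>I. X t \<omega>) \<in> measurable M ?P" by measurable
  have m2[measurable]: "(\<lambda>\<omega>. \<lambda>t\<in>I. X t \<omega> + b t) \<in> measurable M ?P" by measurable
  define B where "B = T -` A \<inter> space ?P"
  have B[measurable]: "B \<in> sets ?P" unfolding B_def by measurable
  define E where "E = (\<lambda>\<omega>. \<lambda>t\<in>I. X t \<omega>) -` B \<inter> space M"
  have E[measurable]: "E \<in> sets M" unfolding E_def by measurable
  have "T \<circ> (\<lambda>\<omega>. \<lambda>t\<in>I. X t \<omega> + b t) = (\<lambda>\<omega>. \<lambda>t\<in>I. a t + \<epsilon> * (X t \<omega> + b t))"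
    by (auto simp: T_def fun_eq_iff)
  then have "measure (distr M ?P (\<lambda>\<omega>. \<lambda>t\<in>I. a t + \<epsilon> * (X t \<omega> + b t))) A =
     measure (distr (distr M ?P (\<lambda>\<omega>. \<lambda>t\<in>I. X t \<omega> + b t)) ?P T) A"
    by (subst distr_distr) auto
  also have "\<dots> = measure (distr M ?P (\<lambda>\<omega>. \<lambda>t\<in>I. X t \<omega> + b t)) B"
    by (simp add: measure_distr B_def)
  also have "distr M ?P (\<lambda>\<omega>. \<lambda>t\<in>I. X t \<omega> + b t) = distr M ?P (\<lambda>\<omega>. \<lambda>t\<in>I. X t \<omega> + expectation (\<lambda>\<omega>. X t \<omega> * Z \<omega>))"
    using b_def by (intro arg_cong[where f = "distr M ?P"]) (auto simp: fun_eq_iff restrict_def)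
  also have "\<dots> = distr (density M w) ?P (\<lambda>\<omega>. \<lambda>t\<in>I. X t \<omega>)"
    unfolding w_def by (rule cameron_martin(2)[OF I Z_def q_def refl, symmetric])
  also have "measure (distr (density M w) ?P (\<lambda>\<omega>. \<lambda>t\<in>I. X t \<omega>)) B = measure (density M w) E"
    unfolding E_def by (subst measure_distr) (auto simp: space_density)
  also have "\<dots> = enn2real (\<integral>\<^sup>+\<omega>. ennreal (w \<omega> * indicator E \<omega>) \<partial>M)"
    by (simp add: measure_def emeasure_density ennreal_mult' w_def ennreal_indicator)
  also have "\<dots> = expectation (\<lambda>\<omega>. w \<omega> * indicator E \<omega>)"
  proof -
    have "integrable M (\<lambda>\<omega>. w \<omega> * indicator E \<omega>)" using iw by (simp add: integrable_real_mult_indicator)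
    then show ?thesis by (subst nn_integral_eq_integral) (auto simp: w_def)
  qed
  also have "\<dots> \<le> expectation (\<lambda>\<omega>. \<tau> * indicator E \<omega> + (1 / \<tau>) * (w \<omega>)\<^sup>2)"
  proof (rule integral_mono)
    show "integrable M (\<lambda>\<omega>. w \<omega> * indicator E \<omega>)" using iw by (simp add: integrable_real_mult_indicator)
    show "integrable M (\<lambda>\<omega>. \<tau> * indicator E \<omega> + (1 / \<tau>) * (w \<omega>)\<^sup>2)"
      using iww by (intro Bochner_Integration.integrable_add integrable_mult_right integrable_real_indicator)
        (auto simp: emeasure_eq_measure)
    fix \<omega>
    have w: "0 \<le> w \<omega>" by (simp add: w_def)
    have "w \<omega> \<le> \<tau> + (1 / \<tau>) * (w \<omega>)\<^sup>2"
    proof (cases "w \<omega> \<le> \<tau>")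
      case False
      then have "w \<omega> * \<tau> \<le> (w \<omega>)\<^sup>2" using w by (simp add: power2_eq_square mult_left_mono)
      then have "w \<omega> \<le> (w \<omega>)\<^sup>2 / \<tau>" using \<tau> by (simp add: field_simps)
      then show ?thesis using \<tau> by simp
    next
      case True
      moreover have "0 \<le> (1 / \<tau>) * (w \<omega>)\<^sup>2" using \<tau> by simp
      ultimately show ?thesis by linarith
    qed
    then show "w \<omega> * indicator E \<omega> \<le> \<tau> * indicator E \<omega> + (1 / \<tau>) * (w \<omega>)\<^sup>2"
      using \<tau> by (auto simp: indicator_def)
  qed
  also have "\<dots> = \<tau> * measure M E + exp q / \<tau>"
    using iww eww by (subst Bochner_Integration.integral_add) (auto simp: emeasure_eq_measure)
  also have "measure M E = measure (distr M ?P (\<lambda>\<omega>. \<lambda>t\<in>I. X t \<omega>)) B"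
    by (simp add: measure_distr E_def)
  also have "\<dots> = measure (distr (distr M ?P (\<lambda>\<omega>. \<lambda>t\<in>I. X t \<omega>)) ?P T) A"
    by (simp add: measure_distr B_def)
  also have "distr (distr M ?P (\<lambda>\<omega>. \<lambda>t\<in>I. X t \<omega>)) ?P T = distr M ?P (\<lambda>\<omega>. \<lambda>t\<in>I. a t + \<epsilon> * X t \<omega>)"
  proof -
    have "T \<circ> (\<lambda>\<omega>. \<lambda>t\<in>I. X t \<omega>) = (\<lambda>\<omega>. \<lambda>t\<in>I. a t + \<epsilon> * X t \<omega>)" by (auto simp: T_def fun_eq_iff)
    then show ?thesis by (subst distr_distr) auto
  qed
  finally show ?thesis .
qed

end

section \<open>Projection and extension to path space\<close>

lemma square_integrable_cmult:
  assumes "square_integrable N f"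
  shows "square_integrable N (\<lambda>x. c * f x)"
  using assms by (auto simp: square_integrable_def power_mult_distrib)

lemma square_integrable_add:
  assumes f: "square_integrable N f" and g: "square_integrable N g"
  shows "square_integrable N (\<lambda>x. f x + g x)"
proof -
  have "(f x + g x)\<^sup>2 = (f x)\<^sup>2 + 2 * (f x * g x) + (g x)\<^sup>2" for x
    by (simp add: power2_sum)
  moreover have "integrable N (\<lambda>x. (f x)\<^sup>2 + 2 * (f x * g x) + (g x)\<^sup>2)"
    using f g square_integrable_mult[OF f g] unfolding square_integrable_def
    by (intro Bochner_Integration.integrable_add integrable_mult_right) auto
  moreover have "(\<lambda>x. f x + g x) \<in> borel_measurable N"
    using f g unfolding square_integrable_def by (intro borel_measurable_add) auto
  ultimately show ?thesis by (simp add: square_integrable_def)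
qed

lemma square_integrable_diff:
  assumes "square_integrable N f" "square_integrable N g"
  shows "square_integrable N (\<lambda>x. f x - g x)"
  using square_integrable_add[OF assms(1) square_integrable_cmult[OF assms(2), of "-1"]] by simp

lemma square_integrable_sum:
  assumes "finite I" "\<And>t. t \<in> I \<Longrightarrow> square_integrable N (e t)"
  shows "square_integrable N (\<lambda>x. \<Sum>t\<in>I. c t * e t x)"
  using assms
proof (induction I rule: finite_induct)
  case empty
  show ?case by (simp add: square_integrable_def)
next
  case (insert t I)
  have "square_integrable N (\<lambda>x. c t * e t x + (\<Sum>t\<in>I. c t * e t x))"
    using insert by (intro square_integrable_add square_integrable_cmult) auto
  then show ?case using insert.hyps by simp
qed

text \<open>The \<open>e t\<close> may be linearly dependent, so the Gram matrix cannot simply be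
  inverted; one vector is added at a time. Both \<open>h\<close> and the new \<open>e x\<close> are
  reduced modulo the old span, and the residual \<open>R\<close> of \<open>h\<close> is then
  corrected along the residual \<open>r\<close> of \<open>e x\<close>.\<close>

lemma l2_projection:
  assumes "finite I" "\<And>t. t \<in> I \<Longrightarrow> square_integrable N (e t)" "square_integrable N h"
  shows "\<exists>c. \<forall>t\<in>I. (\<integral>x. (h x - (\<Sum>s\<in>I. c s * e s x)) * e t x \<partial>N) = 0"
  using assms
proof (induction I arbitrary: h rule: finite_induct)
  case empty
  then show ?case by simp
next
  case (insert x I)
  have sq_e: "square_integrable N (e t)" if "t \<in> insert x I" for t using insert.prems that by auto
  obtain c where c: "\<And>t. t \<in> I \<Longrightarrow> (\<integral>y. (h y - (\<Sum>s\<in>I. c s * e s y)) * e t y \<partial>N) = 0"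
    using insert.IH[of h] insert.prems by auto
  obtain c' where c': "\<And>t. t \<in> I \<Longrightarrow> (\<integral>y. (e x y - (\<Sum>s\<in>I. c' s * e s y)) * e t y \<partial>N) = 0"
    using insert.IH[of "e x"] insert.prems by auto
  define R where "R y = h y - (\<Sum>s\<in>I. c s * e s y)" for y
  define r where "r y = e x y - (\<Sum>s\<in>I. c' s * e s y)" for y
  have sqR: "square_integrable N R" and sqr: "square_integrable N r"
    unfolding R_def[abs_def] r_def[abs_def] using insert.hyps insert.prems sq_e
    by (auto intro!: square_integrable_diff square_integrable_sum)
  \<comment> \<open>If \<open>e x\<close> lies in the old span up to a null set, the division gives
    \<open>l = 0\<close> and both sides of \<open>Rr\<close> vanish.\<close>
  define l where "l = (\<integral>y. R y * r y \<partial>N) / (\<integral>y. r y * r y \<partial>N)"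
  have Rr: "(\<integral>y. R y * r y \<partial>N) = l * (\<integral>y. r y * r y \<partial>N)"
  proof (cases "(\<integral>y. r y * r y \<partial>N) = 0")
    case True
    then have "AE y in N. r y * r y = 0"
      using integral_nonneg_eq_0_iff_AE[OF square_integrable_mult[OF sqr sqr]] by simp
    then have "AE y in N. R y * r y = 0" by auto
    then have "(\<integral>y. R y * r y \<partial>N) = 0"
      using sqR sqr by (subst integral_cong_AE[where g = "\<lambda>_. 0"]) (auto simp: square_integrable_def)
    with True show ?thesis by simp
  qed (simp add: l_def)
  define d where "d s = (if s = x then l else c s - l * c' s)" for s
  have hd: "h y - (\<Sum>s\<in>insert x I. d s * e s y) = R y - l * r y" for y
  proof -
    have "(\<Sum>s\<in>insert x I. d s * e s y) = l * e x y + (\<Sum>s\<in>I. (c s - l * c' s) * e s y)"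
    proof -
      have "(\<Sum>s\<in>I. d s * e s y) = (\<Sum>s\<in>I. (c s - l * c' s) * e s y)"
        using insert.hyps by (intro sum.cong) (auto simp: d_def)
      then show ?thesis using insert.hyps by (simp add: d_def)
    qed
    then show ?thesis
      unfolding R_def r_def by (simp add: algebra_simps sum_subtractf sum_distrib_left)
  qed
  have orthI: "(\<integral>y. (R y - l * r y) * e t y \<partial>N) = 0" if "t \<in> I" for t
  proof -
    have "integrable N (\<lambda>y. R y * e t y)" "integrable N (\<lambda>y. r y * e t y)"
      using that by (auto intro!: square_integrable_mult sqR sqr sq_e)
    then have "(\<integral>y. (R y - l * r y) * e t y \<partial>N) = (\<integral>y. R y * e t y \<partial>N) - l * (\<integral>y. r y * e t y \<partial>N)"
      by (simp add: left_diff_distrib mult.assoc)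
    then show ?thesis using c[OF that] c'[OF that] by (simp add: R_def r_def)
  qed
  have "(\<integral>y. (R y - l * r y) * e x y \<partial>N) = 0"
  proof -
    have ex: "e x y = r y + (\<Sum>s\<in>I. c' s * e s y)" for y by (simp add: r_def)
    have i1: "integrable N (\<lambda>y. (R y - l * r y) * r y)"
      by (intro square_integrable_mult square_integrable_diff square_integrable_cmult sqR sqr)
    have i2: "integrable N (\<lambda>y. (R y - l * r y) * e s y)" if "s \<in> I" for s
      using that by (intro square_integrable_mult square_integrable_diff square_integrable_cmult sqR sqr sq_e) auto
    have "(\<integral>y. (R y - l * r y) * e x y \<partial>N) =
        (\<integral>y. (R y - l * r y) * r y + (\<Sum>s\<in>I. c' s * ((R y - l * r y) * e s y)) \<partial>N)"
      unfolding ex by (simp add: distrib_left sum_distrib_left mult_ac)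
    also have "\<dots> = (\<integral>y. (R y - l * r y) * r y \<partial>N) + (\<Sum>s\<in>I. c' s * (\<integral>y. (R y - l * r y) * e s y \<partial>N))"
      using i1 i2 by (subst Bochner_Integration.integral_add) auto
    also have "(\<integral>y. (R y - l * r y) * r y \<partial>N) = (\<integral>y. R y * r y \<partial>N) - l * (\<integral>y. r y * r y \<partial>N)"
      using square_integrable_mult[OF sqR sqr] square_integrable_mult[OF sqr sqr]
      by (simp add: left_diff_distrib mult.assoc)
    finally show ?thesis using Rr orthI by simp
  qed
  with orthI show ?case
    by (intro exI[of _ d] ballI) (simp only: hd, auto)
qed

context centered_gaussian_process
begin

text \<open>Equal covariances make \<open>X s\<close> and \<open>e s\<close> correspond
  isometrically. The projection \<open>v\<close> of \<open>h\<close> is therefore matched by the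
  combination \<open>Z\<close> with the same coefficients, and the variance of \<open>Z\<close> is
  the squared norm of \<open>v\<close>. Enlarging it to the norm of \<open>h\<close> frees the bound
  from \<open>I\<close>.\<close>

lemma covariance_shift_prob_le:
  assumes cov: "\<And>s t. expectation (\<lambda>\<omega>. X s \<omega> * X t \<omega>) = (\<integral>u. e s u * e t u \<partial>N)"
    and e: "\<And>t. square_integrable N (e t)" and h: "square_integrable N h"
    and I: "finite I" and A: "A \<in> sets (\<Pi>\<^sub>M t\<in>I. borel)" and \<tau>: "0 < \<tau>"
  shows "measure (distr M (\<Pi>\<^sub>M t\<in>I. borel) (\<lambda>\<omega>. \<lambda>t\<in>I. a t + \<epsilon> * (X t \<omega> + (\<integral>u. h u * e t u \<partial>N)))) A
     \<le> \<tau> * measure (distr M (\<Pi>\<^sub>M t\<in>I. borel) (\<lambda>\<omega>. \<lambda>t\<in>I. a t + \<epsilon> * X t \<omega>)) A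
       + exp (\<integral>u. (h u)\<^sup>2 \<partial>N) / \<tau>"
proof -
  obtain c where c: "\<And>t. t \<in> I \<Longrightarrow> (\<integral>u. (h u - (\<Sum>s\<in>I. c s * e s u)) * e t u \<partial>N) = 0"
    using l2_projection[OF I, of N e h] e h by blast
  define v where "v u = (\<Sum>s\<in>I. c s * e s u)" for u
  have v: "square_integrable N v"
    unfolding v_def[abs_def] using I e by (intro square_integrable_sum)
  have he: "(\<integral>u. h u * e t u \<partial>N) = (\<integral>u. v u * e t u \<partial>N)" if "t \<in> I" for t
  proof -
    have "(\<integral>u. (h u - v u) * e t u \<partial>N) = (\<integral>u. h u * e t u \<partial>N) - (\<integral>u. v u * e t u \<partial>N)"
      using square_integrable_mult[OF h e, of t] square_integrable_mult[OF v e, of t]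
      by (simp add: left_diff_distrib)
    then show ?thesis using c[OF that] by (simp add: v_def)
  qed
  define Z where "Z \<omega> = (\<Sum>s\<in>I. c s * X s \<omega>)" for \<omega>
  have XZ: "expectation (\<lambda>\<omega>. X t \<omega> * Z \<omega>) = (\<integral>u. v u * e t u \<partial>N)" for t
  proof -
    have "expectation (\<lambda>\<omega>. X t \<omega> * Z \<omega>) = expectation (\<lambda>\<omega>. \<Sum>s\<in>I. c s * (X s \<omega> * X t \<omega>))"
      by (simp add: Z_def sum_distrib_left mult_ac)
    also have "\<dots> = (\<Sum>s\<in>I. c s * (\<integral>u. e s u * e t u \<partial>N))"
      using integrable_X_mult by (simp add: cov)
    also have "\<dots> = (\<integral>u. (\<Sum>s\<in>I. c s * (e s u * e t u)) \<partial>N)"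
      using square_integrable_mult[OF e e] by simp
    finally show ?thesis by (simp add: v_def sum_distrib_right mult.assoc)
  qed
  have q: "expectation (\<lambda>\<omega>. (Z \<omega>)\<^sup>2) = (\<integral>u. (v u)\<^sup>2 \<partial>N)"
  proof -
    have iXZ: "integrable M (\<lambda>\<omega>. X t \<omega> * Z \<omega>)" for t
      using integrable_sum_mult_sum[where I = "{t}" and c = "\<lambda>_. 1" and J = I and d = c] by (simp add: Z_def)
    have "expectation (\<lambda>\<omega>. (Z \<omega>)\<^sup>2) = expectation (\<lambda>\<omega>. \<Sum>t\<in>I. c t * (X t \<omega> * Z \<omega>))"
    proof (rule Bochner_Integration.integral_cong[OF refl])
      fix \<omega>
      have "(Z \<omega>)\<^sup>2 = (\<Sum>t\<in>I. c t * X t \<omega>) * Z \<omega>" by (simp add: power2_eq_square Z_def)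
      then show "(Z \<omega>)\<^sup>2 = (\<Sum>t\<in>I. c t * (X t \<omega> * Z \<omega>))" by (simp add: sum_distrib_right mult.assoc)
    qed
    also have "\<dots> = (\<Sum>t\<in>I. c t * (\<integral>u. v u * e t u \<partial>N))"
      using iXZ by (simp add: XZ)
    also have "\<dots> = (\<integral>u. (\<Sum>t\<in>I. c t * (v u * e t u)) \<partial>N)"
      using square_integrable_mult[OF v e] by simp
    also have "\<dots> = (\<integral>u. (v u)\<^sup>2 \<partial>N)"
    proof (rule Bochner_Integration.integral_cong[OF refl])
      fix u
      have "(v u)\<^sup>2 = v u * (\<Sum>t\<in>I. c t * e t u)" by (simp add: power2_eq_square v_def)
      then show "(\<Sum>t\<in>I. c t * (v u * e t u)) = (v u)\<^sup>2" by (simp add: sum_distrib_left mult_ac)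
    qed
    finally show ?thesis .
  qed
  \<comment> \<open>Pythagoras: \<open>h - v\<close> is orthogonal to \<open>v\<close>.\<close>
  have vh: "(\<integral>u. (v u)\<^sup>2 \<partial>N) \<le> (\<integral>u. (h u)\<^sup>2 \<partial>N)"
  proof -
    have iev: "integrable N (\<lambda>u. (h u - v u) * e t u)" for t
      by (intro square_integrable_mult square_integrable_diff h v e)
    have orth: "(\<integral>u. (h u - v u) * v u \<partial>N) = 0"
    proof -
      have "(\<integral>u. (h u - v u) * v u \<partial>N) = (\<integral>u. (\<Sum>t\<in>I. c t * ((h u - v u) * e t u)) \<partial>N)"
      proof (rule Bochner_Integration.integral_cong[OF refl])
        fix u
        have "(h u - v u) * v u = (h u - v u) * (\<Sum>t\<in>I. c t * e t u)" by (simp add: v_def)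
        then show "(h u - v u) * v u = (\<Sum>t\<in>I. c t * ((h u - v u) * e t u))"
          by (simp add: sum_distrib_left mult_ac)
      qed
      also have "\<dots> = (\<Sum>t\<in>I. c t * (\<integral>u. (h u - v u) * e t u \<partial>N))" using iev by simp
      also have "\<dots> = 0" using c by (simp add: v_def)
      finally show ?thesis .
    qed
    have "(\<integral>u. (h u)\<^sup>2 \<partial>N) = (\<integral>u. (h u - v u)\<^sup>2 + 2 * ((h u - v u) * v u) + (v u)\<^sup>2 \<partial>N)"
      by (intro Bochner_Integration.integral_cong refl) (simp add: power2_eq_square algebra_simps)
    also have "\<dots> = (\<integral>u. (h u - v u)\<^sup>2 \<partial>N) + (\<integral>u. (v u)\<^sup>2 \<partial>N)"
      using square_integrable_diff[OF h v] v square_integrable_mult[OF square_integrable_diff[OF h v] v] orth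
      by (simp add: square_integrable_def)
    finally show ?thesis using integral_nonneg_AE[of "\<lambda>u. (h u - v u)\<^sup>2" N] by simp
  qed
  have "measure (distr M (\<Pi>\<^sub>M t\<in>I. borel) (\<lambda>\<omega>. \<lambda>t\<in>I. a t + \<epsilon> * (X t \<omega> + (\<integral>u. h u * e t u \<partial>N)))) A
     \<le> \<tau> * measure (distr M (\<Pi>\<^sub>M t\<in>I. borel) (\<lambda>\<omega>. \<lambda>t\<in>I. a t + \<epsilon> * X t \<omega>)) A + exp (\<integral>u. (v u)\<^sup>2 \<partial>N) / \<tau>"
    by (rule shift_prob_le[OF I Z_def q[symmetric] _ A \<tau>]) (simp add: he XZ)
  moreover have "exp (\<integral>u. (v u)\<^sup>2 \<partial>N) / \<tau> \<le> exp (\<integral>u. (h u)\<^sup>2 \<partial>N) / \<tau>"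
    using vh \<tau> by (intro divide_right_mono) auto
  ultimately show ?thesis by linarith
qed

end

section \<open>From cylinder events to measurable sets of paths\<close>

text \<open>One and the same \<open>B\<close> serves both measures, which is what lets an inequality
  between them pass from the algebra to the generated sigma-algebra.\<close>

lemma measure_approx_by_algebra:
  assumes G: "algebra \<Omega> G" and P: "finite_measure P" "sets P = sigma_sets \<Omega> G"
    and Q: "finite_measure Q" "sets Q = sigma_sets \<Omega> G"
    and A: "A \<in> sigma_sets \<Omega> G" and e: "0 < e"
  shows "\<exists>B\<in>G. measure P (sym_diff A B) < e \<and> measure Q (sym_diff A B) < e"
  using A e
proof (induction A arbitrary: e rule: sigma_sets.induct)
  case (Basic A)
  then show ?case by (intro bexI[of _ A]) auto
next
  case Empty
  interpret algebra \<Omega> G by fact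
  show ?case using Empty by (intro bexI[of _ "{}"]) auto
next
  case (Compl A)
  interpret algebra \<Omega> G by fact
  obtain B where B: "B \<in> G" "measure P (sym_diff A B) < e" "measure Q (sym_diff A B) < e"
    using Compl by blast
  have "A \<subseteq> \<Omega>" using Compl.hyps sigma_sets_into_sp[OF space_closed] by blast
  then have "sym_diff (\<Omega> - A) (\<Omega> - B) = sym_diff A B"
    using B(1) space_closed by blast
  then show ?case using B by (intro bexI[of _ "\<Omega> - B"]) auto
next
  case (Union A)
  interpret algebra \<Omega> G by fact
  let ?U = "\<Union>i. A i" and ?V = "\<lambda>n. \<Union>i<n. A i"
  have Asets: "A i \<in> sigma_sets \<Omega> G" for i by (rule Union.hyps)
  have tail: "eventually (\<lambda>n. measure R (?U - ?V n) < e / 2) sequentially"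
    if "finite_measure R" "sets R = sigma_sets \<Omega> G" for R
  proof -
    interpret finite_measure R by fact
    have A: "A i \<in> sets R" for i using Asets that by simp
    have "(\<Union>n. ?V n) = ?U" by auto
    moreover have "(\<lambda>n. measure R (?V n)) \<longlonglongrightarrow> measure R (\<Union>n. ?V n)"
      using A by (intro finite_Lim_measure_incseq) (auto simp: incseq_def, force)
    ultimately have "eventually (\<lambda>n. measure R ?U - e / 2 < measure R (?V n)) sequentially"
      using Union.prems by (intro order_tendstoD(1)[where y = "measure R ?U"]) auto
    moreover have "measure R (?U - ?V n) = measure R ?U - measure R (?V n)" for n
      using A by (intro finite_measure_Diff) auto
    ultimately show ?thesis by (auto elim!: eventually_mono)
  qed
  obtain n where n: "measure P (?U - ?V n) < e / 2" "measure Q (?U - ?V n) < e / 2"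
    using eventually_conj[OF tail[OF P] tail[OF Q]] by (auto simp: eventually_sequentially)
  \<comment> \<open>Half of \<open>e\<close> is reserved for the tail of the union, the other half
    is shared by the \<open>n\<close> approximations; \<open>n + 1\<close> in the denominator allows
    \<open>n = 0\<close>.\<close>
  define e' where "e' = e / (2 * (real n + 1))"
  have e': "0 < e'" "real n * e' \<le> e / 2"
    using Union.prems by (auto simp: e'_def field_simps)
  have "\<exists>B\<in>G. measure P (sym_diff (A i) B) < e' \<and> measure Q (sym_diff (A i) B) < e'" for i
    using Union.IH e' by blast
  then obtain B where B: "\<And>i. B i \<in> G" "\<And>i. measure P (sym_diff (A i) (B i)) < e'"
    "\<And>i. measure Q (sym_diff (A i) (B i)) < e'" by metis
  have BG: "(\<Union>i<n. B i) \<in> G" using B by (intro finite_UN) auto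
  have Bsets: "B i \<in> sigma_sets \<Omega> G" for i using B by auto
  have "measure R (sym_diff ?U (\<Union>i<n. B i)) < e"
    if R: "finite_measure R" "sets R = sigma_sets \<Omega> G" and tl: "measure R (?U - ?V n) < e / 2"
      and di: "\<And>i. measure R (sym_diff (A i) (B i)) < e'" for R
  proof -
    interpret finite_measure R by fact
    have [measurable]: "A i \<in> sets R" "B i \<in> sets R" for i using Asets Bsets that by simp_all
    have "measure R (sym_diff ?U (\<Union>i<n. B i)) \<le> measure R ((?U - ?V n) \<union> (\<Union>i<n. sym_diff (A i) (B i)))"
      by (intro finite_measure_mono) (auto, measurable)
    also have "\<dots> \<le> measure R (?U - ?V n) + measure R (\<Union>i<n. sym_diff (A i) (B i))"
      by (intro measure_Un_le) auto
    also have "measure R (\<Union>i<n. sym_diff (A i) (B i)) \<le> (\<Sum>i<n. measure R (sym_diff (A i) (B i)))"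
      by (intro finite_measure_subadditive_finite) auto
    also have "\<dots> \<le> (\<Sum>i<n. e')" using di by (intro sum_mono) (simp add: less_imp_le)
    also have "\<dots> \<le> e / 2" using e' by simp
    finally show ?thesis using tl by simp
  qed
  from this[OF P n(1) B(2)] this[OF Q n(2) B(3)] show ?case using BG by blast
qed

text \<open>The index set may be uncountable, but each measurable set is close to a cylinder set
  under both laws, and on cylinder sets \<open>fin\<close> applies with constants that do not depend
  on the indices.\<close>

lemma measure_path_space_le:
  fixes D :: "'t set"
  assumes M: "prob_space M"
    and X: "\<And>t. X t \<in> borel_measurable M" and Y: "\<And>t. Y t \<in> borel_measurable M"
    and fin: "\<And>I B. finite I \<Longrightarrow> I \<subseteq> D \<Longrightarrow> B \<in> sets (\<Pi>\<^sub>M t\<in>I. (borel :: real measure)) \<Longrightarrow>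
      measure (distr M (\<Pi>\<^sub>M t\<in>I. borel) (\<lambda>\<omega>. \<lambda>t\<in>I. Y t \<omega>)) B
        \<le> \<tau> * measure (distr M (\<Pi>\<^sub>M t\<in>I. borel) (\<lambda>\<omega>. \<lambda>t\<in>I. X t \<omega>)) B + \<delta>"
    and A: "A \<in> sets (\<Pi>\<^sub>M t\<in>D. (borel :: real measure))" and \<tau>: "0 \<le> \<tau>"
  shows "measure (distr M (\<Pi>\<^sub>M t\<in>D. borel) (\<lambda>\<omega>. \<lambda>t\<in>D. Y t \<omega>)) A
        \<le> \<tau> * measure (distr M (\<Pi>\<^sub>M t\<in>D. borel) (\<lambda>\<omega>. \<lambda>t\<in>D. X t \<omega>)) A + \<delta>"
proof (rule field_le_epsilon)
  fix e :: real assume e: "0 < e"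
  interpret prob_space M by fact
  let ?P = "\<lambda>X I. distr M (\<Pi>\<^sub>M t\<in>I. borel) (\<lambda>\<omega>. \<lambda>t\<in>I. X t \<omega>)"
  have vec: "(\<lambda>\<omega>. \<lambda>t\<in>I. Z t \<omega>) \<in> measurable M (\<Pi>\<^sub>M t\<in>I. borel)" if "\<And>t. Z t \<in> borel_measurable M" for Z and I :: "'t set"
    using that by (intro measurable_restrict) auto
  have restr: "?P Z J = distr (?P Z H) (\<Pi>\<^sub>M t\<in>J. borel) (\<lambda>f. restrict f J)"
    if "J \<subseteq> H" "\<And>t. Z t \<in> borel_measurable M" for Z J and H :: "'t set"
  proof -
    have "(\<lambda>f. restrict f J) \<circ> (\<lambda>\<omega>. \<lambda>t\<in>H. Z t \<omega>) = (\<lambda>\<omega>. \<lambda>t\<in>J. Z t \<omega>)"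
      using that by (auto simp: fun_eq_iff)
    then show ?thesis
      using that by (subst distr_distr) (auto intro: measurable_restrict_subset vec)
  qed
  \<comment> \<open>The interpretation supplies \<open>generator\<close>, the algebra of cylinder
    sets.\<close>
  interpret projective_family D "?P X" "\<lambda>_. borel"
    by (rule projective_family.intro, rule restr[OF _ X], assumption, rule prob_space_distr[OF vec[OF X]])
  have emb_eq: "measure (?P Z D) (prod_emb D (\<lambda>_. borel) J B) = measure (?P Z J) B"
    if "J \<subseteq> D" "B \<in> sets (\<Pi>\<^sub>M t\<in>J. borel)" "\<And>t. Z t \<in> borel_measurable M" for J B Z
  proof -
    have "measure (?P Z J) B = measure (distr (?P Z D) (\<Pi>\<^sub>M t\<in>J. borel) (\<lambda>f. restrict f J)) B"
      by (rule arg_cong[where f = "\<lambda>N. measure N B"], rule restr) (use that in auto)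
    also have "\<dots> = measure (?P Z D) ((\<lambda>f. restrict f J) -` B \<inter> space (?P Z D))"
      using that by (intro measure_distr) (auto intro: measurable_restrict_subset)
    finally show ?thesis by (simp add: prod_emb_def space_PiM)
  qed
  \<comment> \<open>Replacing \<open>A\<close> by a cylinder set costs \<open>e'\<close> under the
    law of \<open>Y\<close> and \<open>\<tau> * e'\<close> under that of \<open>X\<close>, in total
    \<open>e\<close>.\<close>
  define e' where "e' = e / (1 + \<tau>)"
  have e': "0 < e'" "(1 + \<tau>) * e' = e" using e \<tau> by (auto simp: e'_def field_simps)
  have PP: "finite_measure (?P Z D)" if "\<And>t. Z t \<in> borel_measurable M" for Z
    using that by (intro finite_measure_distr vec)
  have "\<exists>B\<in>generator. measure (?P X D) (sym_diff A B) < e' \<and> measure (?P Y D) (sym_diff A B) < e'"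
    using A e'(1) X Y
    by (intro measure_approx_by_algebra[OF algebra_generator]) (auto intro: PP simp: sets_PiM_generator)
  then obtain J B where J: "finite J" "J \<subseteq> D" and B: "B \<in> sets (\<Pi>\<^sub>M t\<in>J. borel)"
    and PB: "measure (?P X D) (sym_diff A (prod_emb D (\<lambda>_. borel) J B)) < e'"
    and QB: "measure (?P Y D) (sym_diff A (prod_emb D (\<lambda>_. borel) J B)) < e'"
    by (auto elim!: generator.cases)
  let ?B = "prod_emb D (\<lambda>_. borel) J B"
  have Bs: "?B \<in> sets (\<Pi>\<^sub>M t\<in>D. borel)" using J B by (intro measurable_prod_emb)
  have close: "measure R U \<le> measure R V + measure R S"
    if "finite_measure R" "sets R = sets (\<Pi>\<^sub>M t\<in>D. borel)" "U \<subseteq> V \<union> S"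
      "V \<in> sets (\<Pi>\<^sub>M t\<in>D. borel)" "S \<in> sets (\<Pi>\<^sub>M t\<in>D. (borel :: real measure))" for R U V S
  proof -
    interpret R: finite_measure R by fact
    have "measure R U \<le> measure R (V \<union> S)" using that by (intro R.finite_measure_mono) auto
    also have "\<dots> \<le> measure R V + measure R S" using that by (intro measure_Un_le) auto
    finally show ?thesis .
  qed
  have sd: "sym_diff A ?B \<in> sets (\<Pi>\<^sub>M t\<in>D. borel)" using A Bs by auto
  have "measure (?P Y D) A \<le> measure (?P Y D) ?B + measure (?P Y D) (sym_diff A ?B)"
    using sd A Bs Y by (intro close PP) auto
  moreover have "measure (?P Y D) ?B \<le> \<tau> * measure (?P X D) ?B + \<delta>"
    unfolding emb_eq[OF J(2) B, of X, OF X] emb_eq[OF J(2) B, of Y, OF Y] by (rule fin[OF J B])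
  moreover have "measure (?P X D) ?B \<le> measure (?P X D) A + measure (?P X D) (sym_diff A ?B)"
    using sd A Bs X by (intro close PP) auto
  from mult_left_mono[OF this \<tau>]
  have "\<tau> * measure (?P X D) ?B \<le> \<tau> * (measure (?P X D) A + measure (?P X D) (sym_diff A ?B))" .
  ultimately have "measure (?P Y D) A \<le> \<tau> * (measure (?P X D) A + measure (?P X D) (sym_diff A ?B)) + \<delta> +
      measure (?P Y D) (sym_diff A ?B)" by linarith
  also have "\<dots> \<le> \<tau> * (measure (?P X D) A + e') + \<delta> + e'"
    using PB QB \<tau> by (intro add_mono mult_left_mono) auto
  also have "\<dots> = \<tau> * measure (?P X D) A + \<delta> + e" using e' by (simp add: algebra_simps)
  finally show "measure (?P Y D) A \<le> \<tau> * measure (?P X D) A + \<delta> + e" .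
qed

section \<open>The Brownian sheet\<close>

text \<open>The function that represents the sheet value at \<open>t\<close> in the
  square-integrable functions: inner products of kernels are the covariances, and the integral of
  \<open>g\<close> against the kernel is the drift. As \<open>sgn 0 = 0\<close>, it vanishes when a
  coordinate of \<open>t\<close> is zero.\<close>

definition sheet_kernel :: "real ^ 'n \<Rightarrow> real ^ 'n \<Rightarrow> real" where
  "sheet_kernel t u = (\<Prod>i\<in>UNIV. sgn (t $ i)) * indicator {u. \<forall>i. u $ i \<in> closed_segment 0 (t $ i)} u"

lemma segment_box_eq_cbox:
  fixes t :: "real ^ 'n"
  shows "{u. \<forall>i. u $ i \<in> closed_segment 0 (t $ i)} = cbox (\<chi> i. min 0 (t $ i)) (\<chi> i. max 0 (t $ i))"
proof -
  have "x \<in> closed_segment 0 y \<longleftrightarrow> min 0 y \<le> x \<and> x \<le> max 0 y" for x y :: real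
    by (auto simp: closed_segment_eq_real_ivl)
  then show ?thesis by (simp add: mem_box_cart set_eq_iff)
qed

lemma square_integrable_sheet_kernel: "square_integrable lborel (sheet_kernel t)"
proof -
  let ?B = "cbox (\<chi> i. min 0 (t $ i)) (\<chi> i. max 0 (t $ i)) :: (real ^ 'a) set"
  have "(sheet_kernel t u)\<^sup>2 = (\<Prod>i\<in>UNIV. sgn (t $ i))\<^sup>2 * indicator ?B u" for u
    unfolding sheet_kernel_def segment_box_eq_cbox by (simp add: power_mult_distrib indicator_def)
  moreover have "integrable lborel (\<lambda>u. (\<Prod>i\<in>UNIV. sgn (t $ i))\<^sup>2 * indicat_real ?B u)"
    by (intro integrable_mult_right integrable_real_indicator emeasure_lborel_cbox_finite) simp
  moreover have "sheet_kernel t \<in> borel_measurable lborel"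
    unfolding sheet_kernel_def[abs_def] segment_box_eq_cbox by measurable
  ultimately show ?thesis by (simp add: square_integrable_def)
qed

text \<open>The two boxes meet in a box, so the claim splits into one-dimensional factors: segments
  from 0 with endpoints on opposite sides overlap in a single point, those on the same side in the
  shorter of the two.\<close>

lemma sheet_kernel_covariance:
  fixes s t :: "real ^ 'n"
  shows "(\<integral>u. sheet_kernel s u * sheet_kernel t u \<partial>lborel) =
    (\<Prod>i\<in>UNIV. if 0 < s $ i * t $ i then min \<bar>s $ i\<bar> \<bar>t $ i\<bar> else 0)"
proof -
  let ?B = "\<lambda>t. cbox (\<chi> i. min 0 (t $ i)) (\<chi> i. max 0 (t $ i)) :: (real ^ 'n) set"
  let ?lo = "\<chi> i. max (min 0 (s $ i)) (min 0 (t $ i)) :: real ^ 'n"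
  let ?hi = "\<chi> i. min (max 0 (s $ i)) (max 0 (t $ i)) :: real ^ 'n"
  have "(\<integral>u. sheet_kernel s u * sheet_kernel t u \<partial>lborel) =
      (\<integral>u. ((\<Prod>i\<in>UNIV. sgn (s $ i)) * (\<Prod>i\<in>UNIV. sgn (t $ i))) * indicator (?B s \<inter> ?B t) u \<partial>lborel)"
    unfolding sheet_kernel_def segment_box_eq_cbox
    by (intro Bochner_Integration.integral_cong refl) (simp add: indicator_inter_arith mult_ac)
  also have "\<dots> = (\<Prod>i\<in>UNIV. sgn (s $ i)) * (\<Prod>i\<in>UNIV. sgn (t $ i)) * measure lborel (?B s \<inter> ?B t)"
    by simp
  also have "?B s \<inter> ?B t = cbox ?lo ?hi"
    by (auto simp: mem_box_cart)
  also have "measure lborel (cbox ?lo ?hi) = (\<Prod>i\<in>UNIV. ?hi $ i - ?lo $ i)"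
  proof (rule content_cbox_cart)
    have "0 \<in> cbox ?lo ?hi" by (auto simp: mem_box_cart)
    then show "cbox ?lo ?hi \<noteq> {}" by blast
  qed
  also have "(\<Prod>i\<in>UNIV. sgn (s $ i)) * (\<Prod>i\<in>UNIV. sgn (t $ i)) * (\<Prod>i\<in>UNIV. ?hi $ i - ?lo $ i) =
      (\<Prod>i\<in>UNIV. sgn (s $ i) * sgn (t $ i) * (?hi $ i - ?lo $ i))"
    by (simp add: prod.distrib)
  also have "\<dots> = (\<Prod>i\<in>UNIV. if 0 < s $ i * t $ i then min \<bar>s $ i\<bar> \<bar>t $ i\<bar> else 0)"
  proof (rule prod.cong[OF refl])
    fix i
    have "sgn x * sgn y * (min (max 0 x) (max 0 y) - max (min 0 x) (min 0 y)) =
        (if 0 < x * y then min \<bar>x\<bar> \<bar>y\<bar> else 0)" for x y :: real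
      by (cases "0::real" x rule: linorder_cases; cases "0::real" y rule: linorder_cases)
        (auto simp: zero_less_mult_iff min_def max_def)
    then show "sgn (s $ i) * sgn (t $ i) * (?hi $ i - ?lo $ i) =
        (if 0 < s $ i * t $ i then min \<bar>s $ i\<bar> \<bar>t $ i\<bar> else 0)" by simp
  qed
  finally show ?thesis .
qed

lemma drift_eq: "drift g t = (\<integral>u. g u * sheet_kernel t u \<partial>lborel)"
proof -
  let ?B = "{u. \<forall>i. u $ i \<in> closed_segment 0 (t $ i)}"
  have "drift g t = (\<integral>u. (\<Prod>i\<in>UNIV. sgn (t $ i)) * (indicator ?B u * g u) \<partial>lborel)"
    unfolding drift_def set_lebesgue_integral_def by simp
  also have "\<dots> = (\<integral>u. g u * sheet_kernel t u \<partial>lborel)"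
    by (intro Bochner_Integration.integral_cong refl) (simp only: sheet_kernel_def mult_ac)
  finally show ?thesis .
qed

lemma integrable_mult_sheet_kernel:
  assumes "continuous_on UNIV g"
  shows "integrable lborel (\<lambda>u. g u * sheet_kernel t u)"
proof -
  let ?B = "cbox (\<chi> i. min 0 (t $ i)) (\<chi> i. max 0 (t $ i)) :: (real ^ 'a) set"
  have "continuous_on ?B g" using assms continuous_on_subset by blast
  then have "set_integrable lborel ?B g"
    unfolding set_integrable_def by (intro borel_integrable_compact) auto
  then have "integrable lborel (\<lambda>u. (\<Prod>i\<in>UNIV. sgn (t $ i)) * (indicator ?B u * g u))"
    unfolding set_integrable_def by (intro integrable_mult_right) simp
  then show ?thesis
    unfolding sheet_kernel_def segment_box_eq_cbox by (simp only: mult_ac)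
qed

text \<open>
  The likelihood ratio of the law under \<^term>\<open>g\<close> with respect to the law under \<^term>\<open>g0\<close> exceeds
  \<^term>\<open>\<tau> :: real\<close> with probability at most its second moment divided by \<^term>\<open>\<tau> :: real\<close>.
\<close>

lemma observation_law_le:
  fixes W :: "real ^ 'n \<Rightarrow> 'w \<Rightarrow> real"
  assumes M: "prob_space M" and W: "brownian_sheet M W" and \<epsilon>: "0 < \<epsilon>"
    and g: "continuous_on UNIV g" "continuous_on UNIV g0"
    and h: "integrable lborel (\<lambda>u. (g u - g0 u)\<^sup>2)"
    and A: "A \<in> sets (path_space D)" and \<tau>: "0 < \<tau>"
  shows "measure (observation_law M W D \<epsilon> g) A
     \<le> \<tau> * measure (observation_law M W D \<epsilon> g0) A + exp ((\<integral>u. (g u - g0 u)\<^sup>2 \<partial>lborel) / \<epsilon>\<^sup>2) / \<tau>"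
proof -
  interpret centered_gaussian_process M W
    using M W by (simp add: centered_gaussian_process_def centered_gaussian_process_axioms_def brownian_sheet_def)
  \<comment> \<open>Dividing by \<epsilon> puts the difference of the drifts on the scale of the
    sheet; this is the source of \<open>\<epsilon>\<^sup>2\<close> in the exponent.\<close>
  define h where "h u = (g u - g0 u) / \<epsilon>" for u
  have h2: "(h u)\<^sup>2 = (g u - g0 u)\<^sup>2 / \<epsilon>\<^sup>2" for u by (simp add: h_def power_divide)
  have sq_h: "square_integrable lborel h"
  proof -
    have "g \<in> borel_measurable lborel" "g0 \<in> borel_measurable lborel"
      using g by (auto intro: borel_measurable_continuous_onI)
    then have "h \<in> borel_measurable lborel" unfolding h_def[abs_def] by measurable
    then show ?thesis using h by (simp add: square_integrable_def h2)
  qed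
  have drift: "drift g t + \<epsilon> * W t \<omega> = drift g0 t + \<epsilon> * (W t \<omega> + (\<integral>u. h u * sheet_kernel t u \<partial>lborel))" for t \<omega>
  proof -
    have "\<epsilon> * (\<integral>u. h u * sheet_kernel t u \<partial>lborel) = (\<integral>u. g u * sheet_kernel t u - g0 u * sheet_kernel t u \<partial>lborel)"
      using \<epsilon> by (subst integral_mult_right_zero[symmetric]) (simp add: h_def left_diff_distrib)
    also have "\<dots> = drift g t - drift g0 t"
      unfolding drift_eq using g by (intro Bochner_Integration.integral_diff integrable_mult_sheet_kernel)
    finally show ?thesis by (simp add: algebra_simps)
  qed
  have cov: "expectation (\<lambda>\<omega>. W s \<omega> * W t \<omega>) = (\<integral>u. sheet_kernel s u * sheet_kernel t u \<partial>lborel)" for s t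
    using W unfolding sheet_kernel_covariance brownian_sheet_def by blast
  have "measure (distr M (path_space D) (\<lambda>\<omega>. \<lambda>t\<in>D. drift g t + \<epsilon> * W t \<omega>)) A
     \<le> \<tau> * measure (distr M (path_space D) (\<lambda>\<omega>. \<lambda>t\<in>D. drift g0 t + \<epsilon> * W t \<omega>)) A
       + exp (\<integral>u. (h u)\<^sup>2 \<partial>lborel) / \<tau>"
  proof (rule measure_path_space_le[OF M _ _ _ A])
    show "(\<lambda>\<omega>. drift g t + \<epsilon> * W t \<omega>) \<in> borel_measurable M"
      "(\<lambda>\<omega>. drift g0 t + \<epsilon> * W t \<omega>) \<in> borel_measurable M" for t by measurable
    fix I and B :: "(real ^ 'n \<Rightarrow> real) set"
    assume I: "finite I" and B: "B \<in> sets (path_space I)"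
    show "measure (distr M (path_space I) (\<lambda>\<omega>. \<lambda>t\<in>I. drift g t + \<epsilon> * W t \<omega>)) B
       \<le> \<tau> * measure (distr M (path_space I) (\<lambda>\<omega>. \<lambda>t\<in>I. drift g0 t + \<epsilon> * W t \<omega>)) B
         + exp (\<integral>u. (h u)\<^sup>2 \<partial>lborel) / \<tau>"
      unfolding drift
      by (rule covariance_shift_prob_le[OF cov square_integrable_sheet_kernel sq_h I B \<tau>])
  qed (use \<tau> in simp)
  then show ?thesis
    unfolding observation_law_def observation_def by (simp add: h2)
qed

section \<open>Reduction to separated hypotheses\<close>

lemma ennpowr_lower_bound:
  assumes "ennreal a \<le> u" "0 \<le> a" "0 < p"
  shows "ennreal (a powr p) \<le> ennpowr u p"
proof (cases "u = \<top>")
  case False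
  then obtain b where b: "u = ennreal b" "0 \<le> b" by (cases u) auto
  then have "a \<le> b" using assms by simp
  then have "a powr p \<le> b powr p" using assms by (intro powr_mono2) auto
  then show ?thesis using b by (simp add: ennpowr_def ennreal_leI)
qed (simp add: ennpowr_def)

lemma minimax_risk_lower_bound:
  fixes W :: "real ^ 'n \<Rightarrow> 'w \<Rightarrow> real" and g :: "nat \<Rightarrow> real ^ 'n \<Rightarrow> real"
  assumes M: "prob_space M" and W: "brownian_sheet M W" and \<epsilon>: "0 < \<epsilon>"
    and \<phi>: "0 < \<phi>" and p: "0 < p" and s: "0 < s" and m: "0 < m"
    and x: "\<And>j. j < m \<Longrightarrow> x j \<in> cbox (- 1) 1"
    and gF: "\<And>j. j < m \<Longrightarrow> g j \<in> F"
    and cont: "\<And>j. j < m \<Longrightarrow> continuous_on UNIV (g j)" "continuous_on UNIV g0"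
    and int: "\<And>j. j < m \<Longrightarrow> integrable lborel (\<lambda>u. (g j u - g0 u)\<^sup>2)"
    and S: "\<And>j. j < m \<Longrightarrow> (\<integral>u. (g j u - g0 u)\<^sup>2 \<partial>lborel) \<le> S"
    and sep: "\<And>j k. j < m \<Longrightarrow> k < m \<Longrightarrow> j \<noteq> k \<Longrightarrow> 2 * s \<le> \<bar>g j (x j) - g k (x j)\<bar>"
    and small: "(1 + exp (S / \<epsilon>\<^sup>2)) / sqrt (real m) \<le> 1 / 2"
    and h: "h \<in> estimators D"
  shows "ennreal ((s / \<phi>) powr p / 2) \<le> (SUP g\<in>F. risk M W D \<epsilon> \<phi> p h g)"
proof -
  interpret prob_space M by fact
  let ?L = "observation_law M W D \<epsilon>"
  have prob_L: "prob_space (?L f)" for f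
    unfolding observation_law_def by (rule prob_space_distr[OF measurable_observation[OF W]])
  have sets_L[measurable_cong]: "sets (?L f) = sets (path_space D)" for f
    by (simp add: observation_law_def)
  have space_L: "space (?L f) = space (path_space D)" for f
    by (simp add: observation_law_def)
  \<comment> \<open>Testing at finitely many points makes the event measurable for every estimator.
    Each event tests all points because \<open>A j\<close> and \<open>A k\<close> exclude each other
    at \<open>x j\<close>.\<close>
  define A where "A j = {X \<in> space (path_space D). \<forall>k\<in>{..<m}. \<bar>h X (x k) - g j (x k)\<bar> < s}" for j
  have [measurable]: "(\<lambda>X. h X (x k)) \<in> borel_measurable (path_space D)" if "k < m" for k
    using h x[OF that] by (simp add: estimators_def)
  have A: "A j \<in> sets (path_space D)" for j
    unfolding A_def by measurable
  have disj: "disjoint_family_on A {..<m}"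
    unfolding disjoint_family_on_def
  proof (intro ballI impI equals0I)
    fix j k X assume jk: "j \<in> {..<m}" "k \<in> {..<m}" "j \<noteq> k" and "X \<in> A j \<inter> A k"
    then have "\<bar>h X (x j) - g j (x j)\<bar> < s" "\<bar>h X (x j) - g k (x j)\<bar> < s" by (auto simp: A_def)
    then show False using sep[of j k] jk by auto
  qed
  \<comment> \<open>With this threshold the two terms of the summed bound, \<open>t\<close> and
    \<open>m * (E / t)\<close>, have the same order, and their average is
    \<open>(1 + E) / t\<close>.\<close>
  define t where "t = sqrt (real m)"
  have t: "0 < t" "t * t = real m" using m by (auto simp: t_def)
  define E where "E = exp (S / \<epsilon>\<^sup>2)"
  have Pj: "measure (?L (g j)) (A j) \<le> t * measure (?L g0) (A j) + E / t" if "j < m" for j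
  proof -
    have "measure (?L (g j)) (A j) \<le> t * measure (?L g0) (A j) + exp ((\<integral>u. (g j u - g0 u)\<^sup>2 \<partial>lborel) / \<epsilon>\<^sup>2) / t"
      by (rule observation_law_le[OF M W \<epsilon> cont(1)[OF that] cont(2) int[OF that] A t(1)])
    moreover have "exp ((\<integral>u. (g j u - g0 u)\<^sup>2 \<partial>lborel) / \<epsilon>\<^sup>2) / t \<le> E / t"
      unfolding E_def using S[OF that] t(1) by (intro divide_right_mono) (auto simp: divide_right_mono)
    ultimately show ?thesis by linarith
  qed
  have "(\<Sum>j<m. measure (?L (g j)) (A j)) \<le> (\<Sum>j<m. t * measure (?L g0) (A j) + E / t)"
    using Pj by (intro sum_mono) auto
  also have "\<dots> = t * (\<Sum>j<m. measure (?L g0) (A j)) + real m * (E / t)"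
    by (simp add: sum.distrib sum_distrib_left)
  also have "(\<Sum>j<m. measure (?L g0) (A j)) \<le> 1"
  proof -
    interpret L: prob_space "?L g0" by (rule prob_L)
    have "(\<Sum>j<m. measure (?L g0) (A j)) = measure (?L g0) (\<Union>j<m. A j)"
      using disj A by (intro L.finite_measure_finite_Union[symmetric]) (auto simp: sets_L)
    then show ?thesis by simp
  qed
  finally have "(\<Sum>j<m. measure (?L (g j)) (A j)) \<le> t * 1 + real m * (E / t)"
    using t by (simp add: mult_left_mono)
  also have "\<dots> = real m * ((1 + E) / t)" using t by (simp add: field_simps)
  also have "\<dots> \<le> real m * (1 / 2)" using small by (intro mult_left_mono) (auto simp: t_def E_def)
  finally have sum: "(\<Sum>j<m. measure (?L (g j)) (A j)) \<le> (\<Sum>j<m. 1 / 2)" by simp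
  have "\<exists>j<m. measure (?L (g j)) (A j) \<le> 1 / 2"
  proof (rule ccontr)
    assume "\<not> ?thesis"
    then have "(\<Sum>j<m. 1 / 2) < (\<Sum>j<m. measure (?L (g j)) (A j))"
      using m by (intro sum_strict_mono) (auto simp: not_le)
    with sum show False by simp
  qed
  then obtain j where j: "j < m" "measure (?L (g j)) (A j) \<le> 1 / 2" by blast
  interpret L: prob_space "?L (g j)" by (rule prob_L)
  let ?B = "space (?L (g j)) - A j"
  have half: "(1 / 2 :: real) \<le> measure (?L (g j)) ?B"
    using j A by (subst L.prob_compl) (auto simp: sets_L)
  have "ennreal ((s / \<phi>) powr p / 2) \<le> ennreal ((s / \<phi>) powr p * measure (?L (g j)) ?B)"
    using mult_left_mono[OF half, of "(s / \<phi>) powr p"] by (intro ennreal_leI) simp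
  also have "\<dots> = (\<integral>\<^sup>+X. ennreal ((s / \<phi>) powr p) * indicator ?B X \<partial>?L (g j))"
  proof -
    have "?B \<in> sets (?L (g j))" by (intro sets.Diff sets.top) (simp add: sets_L A)
    then show ?thesis by (simp add: nn_integral_cmult_indicator L.emeasure_eq_measure ennreal_mult)
  qed
  \<comment> \<open>Monotonicity of the lower integral holds for a loss that is not
    measurable.\<close>
  also have "\<dots> \<le> risk M W D \<epsilon> \<phi> p h (g j)"
    unfolding risk_def
  proof (rule nn_integral_mono)
    fix X
    show "ennreal ((s / \<phi>) powr p) * indicator ?B X \<le>
        ennpowr (ennreal (inverse \<phi>) * sup_norm (\<lambda>x. h X x - g j x)) p"
    proof (cases "X \<in> ?B")
      case True
      then obtain k where k: "k < m" "s \<le> \<bar>h X (x k) - g j (x k)\<bar>"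
        by (auto simp: A_def space_L not_less)
      have "ennreal s \<le> ennreal \<bar>h X (x k) - g j (x k)\<bar>" using k by (intro ennreal_leI)
      also have "\<dots> \<le> sup_norm (\<lambda>x. h X x - g j x)"
        unfolding sup_norm_def using x[OF k(1)] by (intro SUP_upper)
      finally have "ennreal (inverse \<phi>) * ennreal s \<le> ennreal (inverse \<phi>) * sup_norm (\<lambda>x. h X x - g j x)"
        by (intro mult_left_mono) auto
      moreover have "ennreal (inverse \<phi>) * ennreal s = ennreal (s / \<phi>)"
        using \<phi> s by (simp add: divide_inverse mult.commute flip: ennreal_mult)
      ultimately have "ennreal ((s / \<phi>) powr p) \<le> ennpowr (ennreal (inverse \<phi>) * sup_norm (\<lambda>x. h X x - g j x)) p"
        using \<phi> s p by (intro ennpowr_lower_bound) auto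
      then show ?thesis using True by simp
    qed simp
  qed
  also have "\<dots> \<le> (SUP g\<in>F. risk M W D \<epsilon> \<phi> p h g)"
    using gF[OF j(1)] by (intro SUP_upper)
  finally show ?thesis .
qed

text \<open>The scale \<delta> is tied to \<epsilon> by
  \<open>\<delta> powr N = (l * r)\<^sup>2\<close> with
  \<open>r = \<epsilon> * sqrt (ln (1 / \<epsilon>))\<close>. The separation is then a constant
  times the rate, the exponential of the squared distance over \<open>\<epsilon>\<^sup>2\<close> is
  at most \<open>\<epsilon> powr (- (C * l\<^sup>2))\<close>, and \<open>sqrt m\<close> is at least
  of order \<open>\<epsilon> powr (- (\<nu> / (2 * N)))\<close>; a small \<open>l\<close> lets the
  square root win.\<close>

lemma Liminf_minimax_risk_pos:
  fixes W :: "real ^ 'n \<Rightarrow> 'w \<Rightarrow> real"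
  assumes M: "prob_space M" and W: "brownian_sheet M W" and p: "0 < p"
    and pos: "0 < \<kappa>" "0 < N" "0 < \<nu>" "0 < c" "0 < C"
    and hyp: "\<And>\<delta>. 0 < \<delta> \<Longrightarrow> \<delta> \<le> 1 \<Longrightarrow> \<exists>(m::nat) x g g0. \<delta> powr (- \<nu>) / 8 \<le> real m \<and>
        continuous_on UNIV g0 \<and>
        (\<forall>j<m. x j \<in> cbox (- 1) 1 \<and> g j \<in> F \<and> continuous_on UNIV (g j) \<and>
          integrable lborel (\<lambda>u. (g j u - g0 u)\<^sup>2) \<and> (\<integral>u. (g j u - g0 u)\<^sup>2 \<partial>lborel) \<le> C * \<delta> powr N) \<and>
        (\<forall>j<m. \<forall>k<m. j \<noteq> k \<longrightarrow> 2 * (c * \<delta> powr \<kappa>) \<le> \<bar>g j (x j) - g k (x j)\<bar>)"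
  shows "0 < Liminf (at_right 0) (\<lambda>\<epsilon>. INF h\<in>estimators D. SUP g\<in>F.
      risk M W D \<epsilon> ((\<epsilon> * sqrt (ln (1 / \<epsilon>))) powr (2 * \<kappa> / N)) p h g)"
proof -
  \<comment> \<open>Chosen so that \<open>C * l\<^sup>2 \<le> \<nu> / (4 * N)\<close>, half of the
    exponent available from \<open>sqrt m\<close>.\<close>
  define l where "l = min 1 (sqrt (\<nu> / (4 * N * C)))"
  have l: "0 < l" "l \<le> 1" "C * l\<^sup>2 \<le> \<nu> / (4 * N)"
  proof -
    show "0 < l" "l \<le> 1" using pos by (auto simp: l_def)
    then have "l\<^sup>2 \<le> (sqrt (\<nu> / (4 * N * C)))\<^sup>2" by (intro power_mono) (auto simp: l_def)
    also have "\<dots> = \<nu> / (4 * N * C)" using pos by simp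
    finally show "C * l\<^sup>2 \<le> \<nu> / (4 * N)" using pos by (simp add: field_simps)
  qed
  define c0 where "c0 = (c * l powr (2 * \<kappa> / N)) powr p / 2"
  have c0: "0 < c0" using pos l by (simp add: c0_def)
  \<comment> \<open>Below this level
    \<open>6 * \<epsilon> powr (\<nu> / (4 * N)) \<le> 1 / 2\<close>, the bound at the end of
    \<open>small\<close>.\<close>
  define \<epsilon>0 where "\<epsilon>0 = min 1 ((1 / 12) powr (4 * N / \<nu>))"
  have \<epsilon>0: "0 < \<epsilon>0" by (simp add: \<epsilon>0_def)
  have bound: "ennreal c0 \<le> (SUP g\<in>F. risk M W D \<epsilon> ((\<epsilon> * sqrt (ln (1 / \<epsilon>))) powr (2 * \<kappa> / N)) p h g)"
    if \<epsilon>: "0 < \<epsilon>" "\<epsilon> < \<epsilon>0" and h: "h \<in> estimators D" for \<epsilon> h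
  proof -
    have \<epsilon>1: "\<epsilon> < 1" using \<epsilon> by (simp add: \<epsilon>0_def)
    define r where "r = \<epsilon> * sqrt (ln (1 / \<epsilon>))"
    have ln: "0 < ln (1 / \<epsilon>)" using \<epsilon> \<epsilon>1 by simp
    have r: "0 < r" using \<epsilon> ln by (simp add: r_def)
    have r2: "r\<^sup>2 = \<epsilon>\<^sup>2 * ln (1 / \<epsilon>)" using ln by (simp add: r_def power_mult_distrib)
    \<comment> \<open>This crude bound on the logarithm roughly halves the exponent of the number of
      hypotheses, a loss that the choice of \<open>l\<close> takes into account.\<close>
    have "ln (1 / \<epsilon>) \<le> 1 / \<epsilon> - 1" using \<epsilon> by (intro ln_le_minus_one) simp
    then have "r\<^sup>2 \<le> \<epsilon>\<^sup>2 * (1 / \<epsilon>)" unfolding r2 by (intro mult_left_mono) auto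
    then have r2_le: "r\<^sup>2 \<le> \<epsilon>" using \<epsilon> by (simp add: power2_eq_square)
    define \<delta> where "\<delta> = (l * r)\<^sup>2 powr (1 / N)"
    have lr: "0 < (l * r)\<^sup>2" "(l * r)\<^sup>2 \<le> \<epsilon>"
    proof -
      show "0 < (l * r)\<^sup>2" using l r by simp
      have "(l * r)\<^sup>2 \<le> 1 * r\<^sup>2" unfolding power_mult_distrib
        using l by (intro mult_right_mono power_le_one) auto
      then show "(l * r)\<^sup>2 \<le> \<epsilon>" using r2_le by simp
    qed
    have \<delta>: "0 < \<delta>" "\<delta> \<le> \<epsilon> powr (1 / N)"
      unfolding \<delta>_def using lr pos by (auto intro!: powr_mono2)
    have "\<epsilon> powr (1 / N) \<le> 1" using \<epsilon> \<epsilon>1 pos by (intro powr_le1) auto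
    then have \<delta>1: "\<delta> \<le> 1" using \<delta> by linarith
    have \<delta>N: "\<delta> powr N = (l * r)\<^sup>2" using pos lr by (simp add: \<delta>_def powr_powr)
    have \<delta>\<kappa>: "\<delta> powr \<kappa> = l powr (2 * \<kappa> / N) * r powr (2 * \<kappa> / N)"
    proof -
      have "(l * r)\<^sup>2 = (l * r) powr 2" using l r by simp
      then have "\<delta> powr \<kappa> = (l * r) powr (2 * \<kappa> / N)" by (simp add: \<delta>_def powr_powr)
      then show ?thesis using l r by (simp add: powr_mult)
    qed
    obtain m x g g0 where m: "\<delta> powr (- \<nu>) / 8 \<le> real m" and g0: "continuous_on UNIV g0"
      and g: "\<forall>j<m. x j \<in> cbox (- 1) 1 \<and> g j \<in> F \<and> continuous_on UNIV (g j) \<and>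
          integrable lborel (\<lambda>u. (g j u - g0 u)\<^sup>2) \<and> (\<integral>u. (g j u - g0 u)\<^sup>2 \<partial>lborel) \<le> C * \<delta> powr N"
      and sep: "\<forall>j<m. \<forall>k<m. j \<noteq> k \<longrightarrow> 2 * (c * \<delta> powr \<kappa>) \<le> \<bar>g j (x j) - g k (x j)\<bar>"
      using hyp[OF \<delta>(1) \<delta>1] by (elim exE conjE) (rule that)
    have m0: "0 < m" using m \<delta> by (cases m) (auto simp: not_le)
    have E: "exp (C * \<delta> powr N / \<epsilon>\<^sup>2) = \<epsilon> powr (- (C * l\<^sup>2))"
      unfolding \<delta>N power_mult_distrib r2 using \<epsilon> by (simp add: powr_def ln_div)
    have E_le: "\<epsilon> powr (- (C * l\<^sup>2)) \<le> \<epsilon> powr (- (\<nu> / (4 * N)))"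
      using \<epsilon> \<epsilon>1 l by (intro powr_mono') auto
    have E_ge: "1 \<le> \<epsilon> powr (- (\<nu> / (4 * N)))"
      using \<epsilon> \<epsilon>1 pos powr_mono'[of "- (\<nu> / (4 * N))" 0 \<epsilon>] by simp
    \<comment> \<open>The 3 is an upper bound for the square root of the 8 in
      \<open>hyp\<close>.\<close>
    have sqrt_m: "\<epsilon> powr (- (\<nu> / (2 * N))) / 3 \<le> sqrt (real m)"
    proof (rule real_le_rsqrt)
      have "(\<epsilon> powr (- (\<nu> / (2 * N))) / 3)\<^sup>2 = \<epsilon> powr (- (\<nu> / N)) / 9"
        by (simp add: power_divide power2_eq_square flip: powr_add)
      also have "\<dots> \<le> \<epsilon> powr (- (\<nu> / N)) / 8" by (intro divide_left_mono) auto
      also have "\<epsilon> powr (- (\<nu> / N)) = (\<epsilon> powr (1 / N)) powr (- \<nu>)" by (simp add: powr_powr)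
      also have "\<dots> \<le> \<delta> powr (- \<nu>)" using \<delta> pos by (intro powr_mono2') auto
      finally show "(\<epsilon> powr (- (\<nu> / (2 * N))) / 3)\<^sup>2 \<le> real m" using m by simp
    qed
    have small: "(1 + exp (C * \<delta> powr N / \<epsilon>\<^sup>2)) / sqrt (real m) \<le> 1 / 2"
    proof -
      have "(1 + exp (C * \<delta> powr N / \<epsilon>\<^sup>2)) / sqrt (real m) \<le>
          (2 * \<epsilon> powr (- (\<nu> / (4 * N)))) / (\<epsilon> powr (- (\<nu> / (2 * N))) / 3)"
        using E E_le E_ge sqrt_m \<epsilon> by (intro frac_le) auto
      also have "\<dots> = 6 * \<epsilon> powr (\<nu> / (4 * N))"
      proof -
        have "\<epsilon> powr (- (\<nu> / (4 * N))) / \<epsilon> powr (- (\<nu> / (2 * N))) = \<epsilon> powr (- (\<nu> / (4 * N)) - - (\<nu> / (2 * N)))"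
          by (rule powr_diff[symmetric])
        also have "- (\<nu> / (4 * N)) - - (\<nu> / (2 * N)) = \<nu> / (4 * N)" using pos by (simp add: field_simps)
        finally show ?thesis by simp
      qed
      also have "\<epsilon> powr (\<nu> / (4 * N)) \<le> ((1 / 12) powr (4 * N / \<nu>)) powr (\<nu> / (4 * N))"
        using \<epsilon> pos by (intro powr_mono2) (auto simp: \<epsilon>0_def)
      also have "\<dots> = 1 / 12" using pos by (simp add: powr_powr)
      finally show ?thesis by simp
    qed
    have "ennreal (((c * \<delta> powr \<kappa>) / r powr (2 * \<kappa> / N)) powr p / 2) \<le>
        (SUP g\<in>F. risk M W D \<epsilon> (r powr (2 * \<kappa> / N)) p h g)"
      using g m0 sep pos \<delta> r
      by (intro minimax_risk_lower_bound[OF M W \<epsilon>(1) _ p _ m0 _ _ _ g0 _ _ _ small h]) auto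
    moreover have "(c * \<delta> powr \<kappa>) / r powr (2 * \<kappa> / N) = c * l powr (2 * \<kappa> / N)"
      using r by (simp add: \<delta>\<kappa>)
    ultimately show ?thesis by (simp add: c0_def r_def)
  qed
  have "eventually (\<lambda>\<epsilon>. ennreal c0 \<le> (INF h\<in>estimators D. SUP g\<in>F.
      risk M W D \<epsilon> ((\<epsilon> * sqrt (ln (1 / \<epsilon>))) powr (2 * \<kappa> / N)) p h g)) (at_right 0)"
    unfolding eventually_at_right_field
    using \<epsilon>0 bound by (intro exI[of _ \<epsilon>0]) (auto intro!: INF_greatest)
  then have "ennreal c0 \<le> Liminf (at_right 0) (\<lambda>\<epsilon>. INF h\<in>estimators D. SUP g\<in>F.
      risk M W D \<epsilon> ((\<epsilon> * sqrt (ln (1 / \<epsilon>))) powr (2 * \<kappa> / N)) p h g)"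
    by (rule Liminf_bounded)
  moreover have "0 < ennreal c0" using c0 by simp
  ultimately show ?thesis by (rule order.strict_trans2[rotated])
qed

section \<open>Construction of the hypotheses\<close>

lemma integral_square_le_content:
  fixes f :: "real ^ 'n \<Rightarrow> real"
  assumes "continuous_on UNIV f" and bd: "\<And>u. \<bar>f u\<bar> \<le> K"
    and supp: "\<And>u. f u \<noteq> 0 \<Longrightarrow> \<forall>i. \<bar>u $ i - x $ i\<bar> \<le> w $ i" and w: "\<And>i. 0 \<le> w $ i"
  shows "integrable lborel (\<lambda>u. (f u)\<^sup>2)"
    and "(\<integral>u. (f u)\<^sup>2 \<partial>lborel) \<le> K\<^sup>2 * (\<Prod>i\<in>UNIV. 2 * w $ i)"
proof -
  let ?B = "cbox (x - w) (x + w)"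
  have f[measurable]: "f \<in> borel_measurable lborel"
    using assms(1) by (auto intro: borel_measurable_continuous_onI)
  have le: "(f u)\<^sup>2 \<le> K\<^sup>2 * indicat_real ?B u" for u
  proof (cases "f u = 0")
    case False
    have "u \<in> ?B"
      unfolding mem_box_cart using supp[OF False]
      by (auto simp: abs_le_iff) (smt (verit))+
    moreover have "(f u)\<^sup>2 \<le> K\<^sup>2" using power_mono[OF bd[of u], of 2] by simp
    ultimately show ?thesis by simp
  qed simp
  have int: "integrable lborel (\<lambda>u. K\<^sup>2 * indicat_real ?B u)"
    by (intro integrable_mult_right integrable_real_indicator emeasure_lborel_cbox_finite) simp
  show i: "integrable lborel (\<lambda>u. (f u)\<^sup>2)"
    by (rule Bochner_Integration.integrable_bound[OF int]) (use le in auto)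
  have "(\<integral>u. (f u)\<^sup>2 \<partial>lborel) \<le> (\<integral>u. K\<^sup>2 * indicat_real ?B u \<partial>lborel)"
    using i int le by (intro integral_mono) auto
  also have "\<dots> = K\<^sup>2 * measure lborel ?B" by simp
  also have "measure lborel ?B = (\<Prod>i\<in>UNIV. 2 * w $ i)"
  proof -
    have "x \<in> ?B" using w by (simp add: mem_box_cart)
    then have "?B \<noteq> {}" by blast
    then show ?thesis by (subst content_cbox_cart) (auto intro!: prod.cong)
  qed
  finally show "(\<integral>u. (f u)\<^sup>2 \<partial>lborel) \<le> K\<^sup>2 * (\<Prod>i\<in>UNIV. 2 * w $ i)" .
qed

section \<open>Bumps, waves and test points\<close>

text \<open>The factor \<open>A\<close> fits the bump into the class of radius \<open>L\<close>, and
  \<open>A \<le> 1\<close> keeps later arguments of sine in the range where it is controlled. The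
  strict maximum at the origin is what separates the hypotheses in the level-set
  construction.\<close>

lemma bump_prod_exists:
  assumes \<alpha>: "0 < \<alpha>" and L: "0 < L"
  shows "\<exists>A \<psi>. 0 < A \<and> A \<le> 1 \<and> (\<lambda>x. A * \<psi> x) \<in> hoelder \<alpha> L \<and> continuous_on UNIV \<psi> \<and>
    \<psi> (0 :: 'a::euclidean_space) = 1 \<and> (\<forall>x. 0 \<le> \<psi> x \<and> \<psi> x \<le> 1) \<and> (\<forall>x. x \<noteq> 0 \<longrightarrow> \<psi> x < 1) \<and>
    (\<forall>x. \<psi> x \<noteq> 0 \<longrightarrow> (\<forall>b\<in>Basis. \<bar>x \<bullet> b\<bar> < 1))"
proof -
  let ?n = "Suc (strict_floor \<alpha>)"
  obtain \<phi> where \<phi>: "bounded_derivatives ?n \<phi>" "\<phi> 0 = bump (Suc ?n)"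
    using bounded_derivatives_bump by blast
  define \<psi> where "\<psi> x = (\<Prod>b\<in>Basis. bump (Suc ?n) (x \<bullet> b))" for x :: 'a
  obtain L0 where L0: "0 < L0" "\<psi> \<in> hoelder \<alpha> L0"
    using hoelder_prod_coordinates[OF \<alpha>, of "\<lambda>_. \<phi>"] \<phi> by (auto simp: \<psi>_def[abs_def])
  define A where "A = min 1 (L / L0)"
  have A: "0 < A" "A \<le> 1" "A * L0 \<le> L" using L L0 by (auto simp: A_def min_def field_simps)
  have "(\<lambda>x. A * \<psi> x) \<in> hoelder \<alpha> (A * L0)" using L0 A by (intro hoelder_cmult) auto
  then have "(\<lambda>x. A * \<psi> x) \<in> hoelder \<alpha> L" using A(3) by (rule hoelder_mono)
  moreover have "continuous_on UNIV \<psi>"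
    unfolding \<psi>_def bump_def by (intro continuous_intros)
  moreover have "\<psi> 0 = 1" by (simp add: \<psi>_def bump_0)
  moreover have "0 \<le> \<psi> x \<and> \<psi> x \<le> 1" for x
    unfolding \<psi>_def by (auto intro!: prod_nonneg prod_le_1 simp: bump_nonneg bump_le_1)
  moreover have "\<psi> x < 1" if "x \<noteq> 0" for x
  proof -
    obtain b where b: "b \<in> Basis" "x \<bullet> b \<noteq> 0" using \<open>x \<noteq> 0\<close> euclidean_all_zero_iff[of x] by blast
    have "\<psi> x = bump (Suc ?n) (x \<bullet> b) * (\<Prod>b\<in>Basis - {b}. bump (Suc ?n) (x \<bullet> b))"
      unfolding \<psi>_def using b by (intro prod.remove) auto
    also have "\<dots> \<le> bump (Suc ?n) (x \<bullet> b) * 1"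
      by (intro mult_left_mono prod_le_1) (auto simp: bump_nonneg bump_le_1)
    also have "\<dots> < 1" using b by (simp add: bump_less_1)
    finally show ?thesis .
  qed
  moreover have "\<bar>x \<bullet> b\<bar> < 1" if "\<psi> x \<noteq> 0" "b \<in> Basis" for x b
  proof (rule ccontr)
    assume "\<not> ?thesis"
    then have "bump (Suc ?n) (x \<bullet> b) = 0" by (intro bump_eq_0) auto
    then have "\<psi> x = 0" unfolding \<psi>_def using that by (intro prod_zero) auto
    with that show False by simp
  qed
  ultimately show ?thesis using A by (intro exI[of _ A] exI[of _ \<psi>]) blast
qed

text \<open>Sine replaces the linear function, which is unbounded and hence in no Hoelder class.
  Constant factors 1 in the other coordinates turn it into a product to which
  \<open>hoelder_prod_coordinates\<close> applies.\<close>

lemma sin_coordinate_hoelder: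
  assumes "0 < \<alpha>" "0 < L" "(b :: 'a::euclidean_space) \<in> Basis"
  shows "\<exists>A>0. (\<lambda>x. A * sin (x \<bullet> b)) \<in> hoelder \<alpha> L"
proof -
  define \<phi> where "\<phi> c = (if c = b then (\<lambda>i x. sin (x + real i * (pi / 2))) else (\<lambda>i x. if i = 0 then 1 else 0))" for c
  have bd: "bounded_derivatives n (\<phi> c)" for n c
    by (cases "c = b") (simp_all only: \<phi>_def simp_thms if_True if_False bounded_derivatives_sin bounded_derivatives_1)
  obtain L0 where L0: "0 < L0" "(\<lambda>x :: 'a. \<Prod>c\<in>Basis. \<phi> c 0 (x \<bullet> c)) \<in> hoelder \<alpha> L0"
    using hoelder_prod_coordinates[OF assms(1), of \<phi>] bd by blast
  have "(\<Prod>c\<in>Basis. \<phi> c 0 (x \<bullet> c)) = sin (x \<bullet> b)" for x :: 'a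
  proof -
    have "(\<Prod>c\<in>Basis. \<phi> c 0 (x \<bullet> c)) = \<phi> b 0 (x \<bullet> b) * (\<Prod>c\<in>Basis - {b}. \<phi> c 0 (x \<bullet> c))"
      using assms by (intro prod.remove) auto
    also have "(\<Prod>c\<in>Basis - {b}. \<phi> c 0 (x \<bullet> c)) = 1" by (intro prod.neutral) (auto simp: \<phi>_def)
    finally show ?thesis by (simp add: \<phi>_def)
  qed
  then have "(\<lambda>x :: 'a. sin (x \<bullet> b)) \<in> hoelder \<alpha> L0" using L0 by simp
  then have "(\<lambda>x :: 'a. (L / L0) * sin (x \<bullet> b)) \<in> hoelder \<alpha> ((L / L0) * L0)"
    using assms L0 by (intro hoelder_cmult) auto
  then show ?thesis using assms L0 by (intro exI[of _ "L / L0"]) auto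
qed

text \<open>Mean value theorem, with cosine decreasing on the unit interval. It bounds a separation
  from below and the thickness of a slab from above.\<close>

lemma sin_ge_linear:
  fixes t :: real
  assumes "0 \<le> t" "t \<le> 1"
  shows "t * cos 1 \<le> sin t"
proof (cases "t = 0")
  case False
  then have "0 < t" using assms by simp
  have "\<exists>z. 0 < z \<and> z < t \<and> sin t - sin 0 = (t - 0) * cos z"
    by (rule MVT2) (use \<open>0 < t\<close> in \<open>auto intro!: derivative_eq_intros\<close>)
  then obtain z where z: "0 < z" "z < t" "sin t = t * cos z" by auto
  have "cos 1 \<le> cos z"
    using z assms pi_gt3 by (intro cos_monotone_0_pi_le) auto
  then show ?thesis using z assms by (simp add: mult_left_mono)
qed simp

lemma cos_1_pos: "0 < cos (1 :: real)"
  using pi_gt3 by (intro cos_gt_zero) auto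

text \<open>With spacing \<open>2 * h\<close> the open cubes of half-width \<open>h\<close> around
  the points are disjoint; on an axis, all coordinates but one are 0.\<close>

definition test_point :: "'n::finite \<Rightarrow> real \<Rightarrow> nat \<Rightarrow> real ^ 'n" where
  "test_point i h j = axis i (2 * real j * h)"

lemma test_points:
  fixes i :: "'n::finite"
  assumes h: "0 < h" "h \<le> 1"
  defines "m \<equiv> nat \<lceil>1 / (2 * h)\<rceil>"
  shows "1 / h / 8 \<le> real m"
    and "\<And>j. j < m \<Longrightarrow> test_point i h j \<in> cbox (- 1) (1 :: real ^ 'n)"
    and "\<And>j k. j \<noteq> k \<Longrightarrow> 1 \<le> \<bar>((test_point i h j - test_point i h k) /\<^sub>R h) $ i\<bar>"
proof -
  have "1 / h / 8 \<le> 1 / (2 * h)" using h by (simp add: field_simps)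
  also have "\<dots> \<le> real m" unfolding m_def by (rule real_nat_ceiling_ge)
  finally show "1 / h / 8 \<le> real m" .
  show "test_point i h j \<in> cbox (- 1) (1 :: real ^ 'n)" if "j < m" for j
  proof -
    have "real j < 1 / (2 * h)" using that h unfolding m_def by linarith
    then have 1: "2 * real j * h \<le> 1" using h by (simp add: field_simps)
    have 0: "0 \<le> 2 * real j * h" using h by simp
    have "- 1 \<le> 2 * real j * h" using 0 by linarith
    with 1 show ?thesis by (simp add: mem_box_cart test_point_def axis_def)
  qed
  show "1 \<le> \<bar>((test_point i h j - test_point i h k) /\<^sub>R h) $ i\<bar>" if "j \<noteq> k" for j k
  proof -
    have "((test_point i h j - test_point i h k) /\<^sub>R h) $ i = 2 * (real j - real k)"
      using h by (simp add: test_point_def field_simps)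
    moreover have "1 \<le> \<bar>real j - real k\<bar>" using that by (cases j k rule: linorder_cases) auto
    ultimately show ?thesis by simp
  qed
qed

section \<open>Lower bounds from the two kinds of families\<close>

text \<open>The inner function is a single bump of height \<open>A * h powr \<beta>\<close>, and
  \<open>f h\<close> vanishes at 0, so the common reference is the zero function. The outer function
  decides which height \<open>h powr \<kappa>\<close> survives the composition; height squared times
  the volume of the cube gives the exponent \<open>2 * \<kappa> + CARD('n)\<close>.\<close>

lemma Liminf_risk_inner_bumps:
  fixes W :: "real ^ 'n \<Rightarrow> 'w \<Rightarrow> real" and \<psi> :: "real ^ 'n \<Rightarrow> real"
  assumes M: "prob_space M" and W: "brownian_sheet M W" and p: "0 < p"
    and \<beta>: "0 < \<beta>" and \<kappa>: "0 < \<kappa>" and cK: "0 < c" "0 < K"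
    and \<psi>: "0 < A" "(\<lambda>x. A * \<psi> x) \<in> hoelder \<beta> L2" "0 \<le> L2" "continuous_on UNIV \<psi>" "\<psi> 0 = 1"
      "\<And>x. 0 \<le> \<psi> x \<and> \<psi> x \<le> 1" "\<And>x b. \<psi> x \<noteq> 0 \<Longrightarrow> b \<in> Basis \<Longrightarrow> \<bar>x \<bullet> b\<bar> < 1"
    and f: "\<And>h. 0 < h \<Longrightarrow> h \<le> 1 \<Longrightarrow> f h \<in> hoelder \<gamma> L1" "\<And>h. f h 0 = 0"
      "\<And>h. continuous_on UNIV (f h)"
      "\<And>h u. 0 < h \<Longrightarrow> h \<le> 1 \<Longrightarrow> 0 \<le> u \<Longrightarrow> u \<le> A * h powr \<beta> \<Longrightarrow> \<bar>f h u\<bar> \<le> K * h powr \<kappa>"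
      "\<And>h. 0 < h \<Longrightarrow> h \<le> 1 \<Longrightarrow> 2 * c * h powr \<kappa> \<le> f h (A * h powr \<beta>)"
  shows "0 < Liminf (at_right 0) (\<lambda>\<epsilon>. INF e\<in>estimators D. SUP g\<in>composite_class \<gamma> \<beta> L1 L2.
      risk M W D \<epsilon> ((\<epsilon> * sqrt (ln (1 / \<epsilon>))) powr (2 * \<kappa> / (2 * \<kappa> + CARD('n)))) p e g)"
proof (rule Liminf_minimax_risk_pos[OF M W p \<kappa>, where \<nu> = 1 and c = c and C = "K\<^sup>2 * 2 ^ CARD('n)"])
  fix h :: real assume h: "0 < h" "h \<le> 1"
  define m where "m = nat \<lceil>1 / (2 * h)\<rceil>"
  \<comment> \<open>The direction of the grid; any coordinate will do.\<close>
  fix i :: 'n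
  let ?x = "test_point i h"
  define G where "G j x = h powr \<beta> * (A * \<psi> ((x - ?x j) /\<^sub>R h))" for j x
  have G: "G j \<in> hoelder \<beta> L2" for j
    unfolding G_def[abs_def] using \<psi> h \<beta> by (intro hoelder_dilation[of "\<lambda>x. A * \<psi> x"]) auto
  have G_bd: "0 \<le> G j u" "G j u \<le> A * h powr \<beta>" for j u
    using \<psi>(1,6) by (auto simp: G_def mult_ac mult_left_le)
  have G_cont: "continuous_on UNIV (G j)" for j
    unfolding G_def by (intro continuous_intros continuous_on_compose2[OF \<psi>(4)]) auto
  define g where "g j = f h \<circ> G j" for j
  have g_cont: "continuous_on UNIV (g j)" for j
    unfolding g_def comp_def by (intro continuous_on_compose2[OF f(3) G_cont]) auto
  have g_bd: "\<bar>g j u - 0\<bar> \<le> K * h powr \<kappa>" for j u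
    using f(4)[OF h G_bd] by (simp add: g_def)
  have g_supp: "\<forall>i. \<bar>u $ i - ?x j $ i\<bar> \<le> (\<chi> i. h) $ i" if "g j u - 0 \<noteq> 0" for j u
  proof
    fix i'
    have "\<psi> ((u - ?x j) /\<^sub>R h) \<noteq> 0" using that f(2) by (auto simp: g_def G_def)
    then have "\<bar>((u - ?x j) /\<^sub>R h) \<bullet> axis i' 1\<bar> < 1" by (rule \<psi>(7)) (simp add: axis_in_Basis_iff)
    then show "\<bar>u $ i' - ?x j $ i'\<bar> \<le> (\<chi> i. h) $ i'"
      using h by (simp add: inner_axis abs_mult field_simps)
  qed
  note sq = integral_square_le_content[of "\<lambda>u. g j u - 0" "K * h powr \<kappa>" "?x j" "\<chi> i. h" for j,
      OF _ g_bd g_supp]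
  have "integrable lborel (\<lambda>u. (g j u - 0)\<^sup>2)" for j
    using h g_cont by (intro sq(1)) auto
  moreover have "(\<integral>u. (g j u - 0)\<^sup>2 \<partial>lborel) \<le> (K\<^sup>2 * 2 ^ CARD('n)) * h powr (2 * \<kappa> + CARD('n))" for j
  proof -
    have "(\<integral>u. (g j u - 0)\<^sup>2 \<partial>lborel) \<le> (K * h powr \<kappa>)\<^sup>2 * (\<Prod>i\<in>(UNIV :: 'n set). 2 * (\<chi> i. h) $ i)"
      using h g_cont by (intro sq(2)) auto
    also have "\<dots> = K\<^sup>2 * 2 ^ CARD('n) * ((h powr \<kappa>)\<^sup>2 * h ^ CARD('n))"
      by (simp add: power_mult_distrib)
    also have "(h powr \<kappa>)\<^sup>2 * h ^ CARD('n) = h powr (2 * \<kappa> + CARD('n))"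
      using h by (simp add: powr_add powr_realpow powr_power mult.commute)
    finally show ?thesis .
  qed
  moreover have "2 * (c * h powr \<kappa>) \<le> \<bar>g j (?x j) - g k (?x j)\<bar>" if "j \<noteq> k" for j k
  proof -
    have "\<psi> ((?x j - ?x k) /\<^sub>R h) = 0"
    proof (rule ccontr)
      assume "\<psi> ((?x j - ?x k) /\<^sub>R h) \<noteq> 0"
      then have "\<bar>((?x j - ?x k) /\<^sub>R h) \<bullet> axis i 1\<bar> < 1" by (rule \<psi>(7)) (simp add: axis_in_Basis_iff)
      then have "\<bar>((?x j - ?x k) /\<^sub>R h) $ i\<bar> < 1" by (simp only: inner_axis inner_real_def mult_1_right)
      then show False using test_points(3)[OF h that, of i] by linarith
    qed
    then have "g k (?x j) = 0" by (simp add: g_def G_def f(2))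
    moreover have "g j (?x j) = f h (A * h powr \<beta>)" by (simp add: g_def G_def \<psi>(5) mult.commute)
    ultimately show ?thesis using f(5)[OF h] by simp
  qed
  moreover have "g j \<in> composite_class \<gamma> \<beta> L1 L2" for j
    unfolding composite_class_def g_def using f(1)[OF h] G by blast
  moreover have "h powr (- 1) / 8 \<le> real m"
    using test_points(1)[OF h] h by (simp add: m_def powr_minus_divide)
  moreover have "?x j \<in> cbox (- 1) 1" if "j < m" for j
    using test_points(2)[OF h] that by (simp add: m_def)
  ultimately show "\<exists>(m::nat) (x :: nat \<Rightarrow> real ^ 'n) g g0. h powr (- 1) / 8 \<le> real m \<and>
        continuous_on UNIV g0 \<and>
        (\<forall>j<m. x j \<in> cbox (- 1) 1 \<and> g j \<in> composite_class \<gamma> \<beta> L1 L2 \<and> continuous_on UNIV (g j) \<and>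
          integrable lborel (\<lambda>u. (g j u - g0 u)\<^sup>2) \<and>
          (\<integral>u. (g j u - g0 u)\<^sup>2 \<partial>lborel) \<le> (K\<^sup>2 * 2 ^ CARD('n)) * h powr (2 * \<kappa> + CARD('n))) \<and>
        (\<forall>j<m. \<forall>k<m. j \<noteq> k \<longrightarrow> 2 * (c * h powr \<kappa>) \<le> \<bar>g j (x j) - g k (x j)\<bar>)"
    using g_cont
    by - (rule exI[of _ m], rule exI[of _ "test_point i h"], rule exI[of _ g], rule exI[of _ "\<lambda>_. 0"], auto)
qed (use \<kappa> cK in auto)

text \<open>
  For \<open>\<beta> > 1\<close> the outer function is itself a bump of width \<^term>\<open>\<delta>\<close>, composed with a perturbation of
  \<^term>\<open>sin (x $ i)\<close>. The perturbations of width \<^term>\<open>\<delta> powr (1 / \<beta>)\<close> in all directions only matter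
  where \<^term>\<open>sin (x $ i)\<close> is of the order of \<^term>\<open>\<delta>\<close>, that is, on a slab thinner in the
  direction \<^term>\<open>i\<close>.
\<close>

lemma Liminf_risk_level_set_bumps:
  fixes W :: "real ^ 'n \<Rightarrow> 'w \<Rightarrow> real"
  assumes card: "2 \<le> CARD('n)"
    and M: "prob_space M" and W: "brownian_sheet M W" and p: "0 < p"
    and L: "0 < L1" "0 < L2" and \<gamma>: "0 < \<gamma>" and \<beta>: "1 < \<beta>"
  shows "0 < Liminf (at_right 0) (\<lambda>\<epsilon>. INF e\<in>estimators D. SUP g\<in>composite_class \<gamma> \<beta> L1 L2.
      risk M W D \<epsilon> ((\<epsilon> * sqrt (ln (1 / \<epsilon>))) powr (2 * \<gamma> / (2 * \<gamma> + 1 + (real CARD('n) - 1) / \<beta>))) p e g)"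
proof -
  \<comment> \<open>The wave runs in direction \<open>i1\<close>, the grid in direction
    \<open>i2\<close>. As they differ, all test points lie on the zero level set of the wave; here
    dimension at least 2 enters.\<close>
  have "\<exists>i1 i2 :: 'n. i1 \<noteq> i2"
  proof (rule ccontr)
    assume "\<not> ?thesis"
    then have "(UNIV :: 'n set) = {undefined}" by auto
    then have "CARD('n) = card {undefined :: 'n}" by (rule arg_cong)
    with card show False by simp
  qed
  then obtain i1 i2 :: 'n where i12: "i1 \<noteq> i2" by blast
  have \<beta>0: "0 < \<beta>" using \<beta> by simp
  let ?e1 = "axis i1 1 :: real ^ 'n"
  \<comment> \<open>Half of \<open>L2\<close> goes to the wave, half to the bump added to
    it.\<close>
  obtain A0 where A0: "0 < A0" "(\<lambda>x. A0 * sin (x \<bullet> ?e1)) \<in> hoelder \<beta> (L2 / 2)"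
    using sin_coordinate_hoelder[OF \<beta>0, of "L2 / 2" ?e1] L by (auto simp: axis_in_Basis_iff)
  obtain A \<psi> where A: "0 < A" "A \<le> 1" and \<psi>: "(\<lambda>x. A * \<psi> x) \<in> hoelder \<beta> (L2 / 2)"
      "continuous_on UNIV \<psi>" "\<psi> (0 :: real ^ 'n) = 1" "\<And>x. 0 \<le> \<psi> x \<and> \<psi> x \<le> 1"
      "\<And>x b. \<psi> x \<noteq> 0 \<Longrightarrow> b \<in> Basis \<Longrightarrow> \<bar>x \<bullet> b\<bar> < 1"
    using bump_prod_exists[OF \<beta>0, of "L2 / 2", where 'a = "real ^ 'n"] L by auto
  obtain A' \<eta> where A': "0 < A'" and \<eta>: "(\<lambda>x. A' * \<eta> x) \<in> hoelder \<gamma> L1"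
      "continuous_on UNIV \<eta>" "\<eta> (0 :: real) = 1" "\<And>x. 0 \<le> \<eta> x \<and> \<eta> x \<le> 1" "\<And>x. x \<noteq> 0 \<Longrightarrow> \<eta> x < 1"
      "\<And>x. \<eta> x \<noteq> 0 \<Longrightarrow> \<bar>x\<bar> < 1"
    using bump_prod_exists[OF \<gamma> L(1), where 'a = real] by auto
  \<comment> \<open>At a test point the inner value is 0 without the bump and
    \<open>A * \<delta>\<close> with it; the outer function takes values there that differ by
    \<open>A' * (1 - \<eta> A) * \<delta> powr \<gamma>\<close>.\<close>
  define c where "c = A' * (1 - \<eta> A) / 2"
  have c: "0 < c" using A A' \<eta>(5)[of A] by (simp add: c_def)
  \<comment> \<open>Solving \<open>A0 * \<bar>sin t\<bar> < 2 * \<delta>\<close> for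
    \<open>t\<close> by \<open>sin_ge_linear\<close> gives a slab of half-width
    \<open>B * \<delta>\<close>.\<close>
  define B where "B = 2 / (A0 * cos 1)"
  have B: "0 < B" using A0 cos_1_pos by (simp add: B_def)
  \<comment> \<open>The squared height contributes \<open>2 * \<gamma>\<close>, the slab direction
    1, and each of the other directions, of width \<open>\<delta> powr (1 / \<beta>)\<close>,
    contributes \<open>1 / \<beta>\<close>.\<close>
  define N where "N = 2 * \<gamma> + 1 + (real CARD('n) - 1) / \<beta>"
  have N: "0 < N" using \<gamma> \<beta> card by (simp add: N_def add_pos_nonneg)
  define C where "C = A'\<^sup>2 * ((2 * B) * 2 ^ (CARD('n) - 1))"
  have C: "0 < C" using A' B by (simp add: C_def)
  have "0 < Liminf (at_right 0) (\<lambda>\<epsilon>. INF e\<in>estimators D. SUP g\<in>composite_class \<gamma> \<beta> L1 L2.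
      risk M W D \<epsilon> ((\<epsilon> * sqrt (ln (1 / \<epsilon>))) powr (2 * \<gamma> / N)) p e g)"
  proof (rule Liminf_minimax_risk_pos[OF M W p \<gamma> N _ c C, where \<nu> = "1 / \<beta>"])
    show "0 < 1 / \<beta>" using \<beta> by simp
    fix \<delta> :: real assume \<delta>: "0 < \<delta>" "\<delta> \<le> 1"
    define h where "h = \<delta> powr (1 / \<beta>)"
    have h: "0 < h" "h \<le> 1" "h powr \<beta> = \<delta>" using \<delta> \<beta> by (auto simp: h_def powr_powr intro: powr_le1)
    define m where "m = nat \<lceil>1 / (2 * h)\<rceil>"
    let ?x = "test_point i2 h :: nat \<Rightarrow> real ^ 'n"
    \<comment> \<open>The centre 0 is written out to match the form of
      \<open>hoelder_dilation\<close>.\<close>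
    define f where "f u = \<delta> powr \<gamma> * (A' * \<eta> ((u - 0) /\<^sub>R \<delta>))" for u
    have f: "f \<in> hoelder \<gamma> L1"
      unfolding f_def[abs_def] using \<eta> \<delta> \<gamma> L by (intro hoelder_dilation[of "\<lambda>x. A' * \<eta> x"]) auto
    have f_cont: "continuous_on UNIV f"
      unfolding f_def by (intro continuous_intros continuous_on_compose2[OF \<eta>(2)]) auto
    have f_bd: "0 \<le> f u" "f u \<le> A' * \<delta> powr \<gamma>" for u
      using \<eta>(4)[of "(u - 0) /\<^sub>R \<delta>"] A' by (auto simp: f_def mult_ac mult_left_le)
    have f_supp: "\<bar>u\<bar> < \<delta>" if "f u \<noteq> 0" for u
      using that \<eta>(6)[of "(u - 0) /\<^sub>R \<delta>"] \<delta> by (auto simp: f_def abs_mult field_simps)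
    define G0 where "G0 x = A0 * sin (x \<bullet> ?e1)" for x
    define G where "G j x = G0 x + h powr \<beta> * (A * \<psi> ((x - ?x j) /\<^sub>R h))" for j x
    have "(\<lambda>x. h powr \<beta> * (A * \<psi> ((x - ?x j) /\<^sub>R h))) \<in> hoelder \<beta> (L2 / 2)" for j
      using \<psi> h \<beta> L by (intro hoelder_dilation[of "\<lambda>x. A * \<psi> x"]) auto
    from hoelder_add[OF A0(2) this] have G: "G j \<in> hoelder \<beta> L2" for j
      using L unfolding G_def[abs_def] G0_def by simp
    have G0_cont: "continuous_on UNIV G0" unfolding G0_def by (intro continuous_intros)
    have G_cont: "continuous_on UNIV (G j)" for j
      unfolding G_def by (intro continuous_intros continuous_on_compose2[OF \<psi>(2)] G0_cont) auto
    define g0 where "g0 = f \<circ> G0"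
    define g where "g j = f \<circ> G j" for j
    have cont: "continuous_on UNIV g0" "continuous_on UNIV (g j)" for j
      unfolding g_def g0_def comp_def by (intro continuous_on_compose2[OF f_cont] G0_cont G_cont; simp)+
    have diff_bd: "\<bar>g j u - g0 u\<bar> \<le> A' * \<delta> powr \<gamma>" for j u
      using f_bd(1)[of "G j u"] f_bd(2)[of "G j u"] f_bd(1)[of "G0 u"] f_bd(2)[of "G0 u"]
      unfolding g_def g0_def comp_def by linarith
    define w where "w = (\<chi> i. if i = i1 then B * \<delta> else h)"
    have w: "0 \<le> w $ i" for i using B \<delta> h by (simp add: w_def)
    have supp: "\<forall>i. \<bar>u $ i - ?x j $ i\<bar> \<le> w $ i" if ne: "g j u - g0 u \<noteq> 0" for j u
    proof
      fix i
      have "G j u \<noteq> G0 u" using ne by (auto simp: g_def g0_def)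
      then have \<psi>0: "\<psi> ((u - ?x j) /\<^sub>R h) \<noteq> 0" by (auto simp: G_def)
      have near: "\<bar>u $ i - ?x j $ i\<bar> < h" for i
      proof -
        have "\<bar>((u - ?x j) /\<^sub>R h) \<bullet> axis i 1\<bar> < 1" using \<psi>0 by (rule \<psi>(5)) (simp add: axis_in_Basis_iff)
        then show ?thesis using h by (simp add: inner_axis abs_mult field_simps)
      qed
      have x1: "?x j $ i1 = 0" using i12 by (simp add: test_point_def axis_def)
      have u1: "\<bar>u $ i1\<bar> \<le> 1" using near[of i1] x1 h by simp
      \<comment> \<open>One of the two inner values must lie in the support of \<open>f\<close>.
        They differ by at most \<delta>, so in either case the wave is below
        \<open>2 * \<delta>\<close> in absolute value.\<close>
      have "f (G j u) \<noteq> 0 \<or> f (G0 u) \<noteq> 0" using ne by (auto simp: g_def g0_def)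
      then have "\<bar>G j u\<bar> < \<delta> \<or> \<bar>G0 u\<bar> < \<delta>" using f_supp by blast
      moreover have "0 \<le> G j u - G0 u" "G j u - G0 u \<le> \<delta>"
      proof -
        have "0 \<le> A * \<psi> ((u - ?x j) /\<^sub>R h)" "A * \<psi> ((u - ?x j) /\<^sub>R h) \<le> 1"
          using A \<psi>(4)[of "(u - ?x j) /\<^sub>R h"] by (auto intro: mult_le_one)
        then show "0 \<le> G j u - G0 u" "G j u - G0 u \<le> \<delta>"
          using \<delta> by (auto simp: G_def h(3) mult_left_le)
      qed
      ultimately have "\<bar>G0 u\<bar> < 2 * \<delta>" by linarith
      then have "A0 * \<bar>sin (u $ i1)\<bar> < 2 * \<delta>" using A0 by (simp add: G0_def inner_axis abs_mult)
      moreover have "\<bar>u $ i1\<bar> * cos 1 \<le> \<bar>sin (u $ i1)\<bar>"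
        using sin_ge_linear[of "\<bar>u $ i1\<bar>"] u1 by (cases "0 \<le> u $ i1") auto
      then have "A0 * (\<bar>u $ i1\<bar> * cos 1) \<le> A0 * \<bar>sin (u $ i1)\<bar>" using A0 by (intro mult_left_mono) auto
      ultimately have "\<bar>u $ i1\<bar> * (A0 * cos 1) \<le> 2 * \<delta>" by (simp add: mult_ac)
      then have "\<bar>u $ i1\<bar> \<le> 2 * \<delta> / (A0 * cos 1)" using A0 cos_1_pos by (simp add: pos_le_divide_eq)
      then have "\<bar>u $ i1 - ?x j $ i1\<bar> \<le> w $ i1" by (simp add: x1 w_def B_def)
      then show "\<bar>u $ i - ?x j $ i\<bar> \<le> w $ i"
        using near[of i] by (cases "i = i1") (auto simp: w_def)
    qed
    note sq = integral_square_le_content[of "\<lambda>u. g j u - g0 u" "A' * \<delta> powr \<gamma>" "?x j" w for j,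
        OF _ diff_bd supp w]
    have int: "integrable lborel (\<lambda>u. (g j u - g0 u)\<^sup>2)" for j
      using cont by (intro sq(1) continuous_intros)
    have int_le: "(\<integral>u. (g j u - g0 u)\<^sup>2 \<partial>lborel) \<le> C * \<delta> powr N" for j
    proof -
      have "(\<integral>u. (g j u - g0 u)\<^sup>2 \<partial>lborel) \<le> (A' * \<delta> powr \<gamma>)\<^sup>2 * (\<Prod>i\<in>UNIV. 2 * w $ i)"
        using cont by (intro sq(2) continuous_intros)
      also have "(\<Prod>i\<in>UNIV. 2 * w $ i) = (2 * w $ i1) * (\<Prod>i\<in>UNIV - {i1}. 2 * w $ i)"
        by (intro prod.remove) auto
      also have "(\<Prod>i\<in>UNIV - {i1}. 2 * w $ i) = (\<Prod>i\<in>UNIV - {i1}. 2 * h)"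
        by (intro prod.cong) (auto simp: w_def)
      also have "\<dots> = 2 ^ (CARD('n) - 1) * h ^ (CARD('n) - 1)"
        by (simp add: power_mult_distrib)
      also have "2 * w $ i1 = 2 * B * \<delta>" by (simp add: w_def)
      also have "(A' * \<delta> powr \<gamma>)\<^sup>2 * (2 * B * \<delta> * (2 ^ (CARD('n) - 1) * h ^ (CARD('n) - 1))) =
          C * ((\<delta> powr \<gamma>)\<^sup>2 * \<delta> * h ^ (CARD('n) - 1))"
        by (simp add: C_def power_mult_distrib mult_ac)
      also have "h ^ (CARD('n) - 1) = \<delta> powr ((real CARD('n) - 1) / \<beta>)"
        using \<delta> card by (simp add: h_def powr_power of_nat_diff)
      also have "(\<delta> powr \<gamma>)\<^sup>2 * \<delta> * \<delta> powr ((real CARD('n) - 1) / \<beta>) = \<delta> powr N"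
        using \<delta> by (simp add: N_def powr_add powr_power mult.commute)
      finally show ?thesis .
    qed
    have sep: "2 * (c * \<delta> powr \<gamma>) \<le> \<bar>g j (?x j) - g k (?x j)\<bar>" if "j \<noteq> k" for j k
    proof -
      have "\<psi> ((?x j - ?x k) /\<^sub>R h) = 0"
      proof (rule ccontr)
        assume "\<psi> ((?x j - ?x k) /\<^sub>R h) \<noteq> 0"
        then have "\<bar>((?x j - ?x k) /\<^sub>R h) \<bullet> axis i2 1\<bar> < 1" by (rule \<psi>(5)) (simp add: axis_in_Basis_iff)
        then have "\<bar>((?x j - ?x k) /\<^sub>R h) $ i2\<bar> < 1" by (simp only: inner_axis inner_real_def mult_1_right)
        then show False using test_points(3)[OF h(1,2) that, of i2] by linarith
      qed
      moreover have "?x j $ i1 = 0" using i12 by (simp add: test_point_def axis_def)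
      then have "G0 (?x j) = 0" by (simp add: G0_def inner_axis)
      ultimately have "G k (?x j) = 0" "G j (?x j) = A * \<delta>"
        by (simp_all add: G_def h(3) \<psi>(3))
      moreover have "(A * \<delta> - 0) /\<^sub>R \<delta> = A" using \<delta> by simp
      then have "f (A * \<delta>) = \<delta> powr \<gamma> * (A' * \<eta> A)" by (simp only: f_def)
      moreover have "f 0 = \<delta> powr \<gamma> * A'" by (simp add: f_def \<eta>(3))
      ultimately have "g k (?x j) = A' * \<delta> powr \<gamma>" "g j (?x j) = A' * \<delta> powr \<gamma> * \<eta> A"
        by (simp_all add: g_def)
      then have "g k (?x j) - g j (?x j) = 2 * (c * \<delta> powr \<gamma>)"
        by (simp add: c_def algebra_simps)
      then show ?thesis by linarith
    qed
    have mem: "g j \<in> composite_class \<gamma> \<beta> L1 L2" for j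
      unfolding composite_class_def g_def using f G by blast
    have m: "\<delta> powr (- (1 / \<beta>)) / 8 \<le> real m"
      using test_points(1)[OF h(1,2)] by (simp add: m_def h_def powr_minus_divide)
    have x: "?x j \<in> cbox (- 1) 1" if "j < m" for j
      using test_points(2)[OF h(1,2)] that by (simp add: m_def)
    show "\<exists>(m::nat) (x :: nat \<Rightarrow> real ^ 'n) g g0. \<delta> powr (- (1 / \<beta>)) / 8 \<le> real m \<and>
        continuous_on UNIV g0 \<and>
        (\<forall>j<m. x j \<in> cbox (- 1) 1 \<and> g j \<in> composite_class \<gamma> \<beta> L1 L2 \<and> continuous_on UNIV (g j) \<and>
          integrable lborel (\<lambda>u. (g j u - g0 u)\<^sup>2) \<and> (\<integral>u. (g j u - g0 u)\<^sup>2 \<partial>lborel) \<le> C * \<delta> powr N) \<and>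
        (\<forall>j<m. \<forall>k<m. j \<noteq> k \<longrightarrow> 2 * (c * \<delta> powr \<gamma>) \<le> \<bar>g j (x j) - g k (x j)\<bar>)"
      using m cont int int_le sep mem x
      by - (rule exI[of _ m], rule exI[of _ "test_point i2 h"], rule exI[of _ g], rule exI[of _ g0], blast)
  qed
  then show ?thesis by (simp only: N_def)
qed

theorem theorem1:
  fixes M :: "'w measure"
    and W :: "real ^ 'n \<Rightarrow> 'w \<Rightarrow> real"
    and a b :: "real ^ 'n"
    and L1 L2 \<gamma> \<beta> p :: real
  assumes "2 \<le> CARD('n)"
    and "prob_space M" and "brownian_sheet M W"
    and "cbox (- 1) 1 \<subseteq> box a b"
    and "0 < L1" and "0 < L2" and "0 < \<gamma>" and "0 < \<beta>" and "0 < p"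
  shows "0 < Liminf (at_right 0) (\<lambda>\<epsilon>.
           INF h\<in>estimators (box a b).
             SUP g\<in>composite_class \<gamma> \<beta> L1 L2.
               risk M W (box a b) \<epsilon> (rate CARD('n) \<gamma> \<beta> \<epsilon>) p h g)"
proof -
  let ?d = "real CARD('n)"
  let ?R = "\<lambda>e. 0 < Liminf (at_right 0) (\<lambda>\<epsilon>. INF h\<in>estimators (box a b). SUP g\<in>composite_class \<gamma> \<beta> L1 L2.
      risk M W (box a b) \<epsilon> ((\<epsilon> * sqrt (ln (1 / \<epsilon>))) powr e) p h g)"
  obtain A \<psi> where A: "0 < A" "A \<le> 1" and \<psi>: "(\<lambda>x. A * \<psi> x) \<in> hoelder \<beta> L2"
      "continuous_on UNIV \<psi>" "\<psi> (0 :: real ^ 'n) = 1" "\<And>x. 0 \<le> \<psi> x \<and> \<psi> x \<le> 1"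
      "\<And>x b. \<psi> x \<noteq> 0 \<Longrightarrow> b \<in> Basis \<Longrightarrow> \<bar>x \<bullet> b\<bar> < 1"
    using bump_prod_exists[OF assms(8,6), where 'a = "real ^ 'n"] by auto
  obtain B where B: "0 < B" "(\<lambda>u :: real. B * sin u) \<in> hoelder \<gamma> L1"
    using sin_coordinate_hoelder[OF assms(7,5), of "1 :: real"] by auto
  note inner_bumps = Liminf_risk_inner_bumps[OF assms(2,3,9,8) _ _ _ A(1) \<psi>(1) _ \<psi>(2,3,4,5)]
  consider (level) "1 < \<beta>" "?d * (\<gamma> - 1) + 1 \<le> \<beta>"
    | (smooth) "\<not> (1 < \<beta> \<and> ?d * (\<gamma> - 1) + 1 \<le> \<beta>)" "1 < \<gamma>" "\<beta> < ?d * (\<gamma> - 1) + 1"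
    | (rough) "\<not> (1 < \<beta> \<and> ?d * (\<gamma> - 1) + 1 \<le> \<beta>)" "\<not> (1 < \<gamma> \<and> \<beta> < ?d * (\<gamma> - 1) + 1)"
    by blast
  then show ?thesis
  proof cases
    case level
    have "?R (2 * \<gamma> / (2 * \<gamma> + 1 + (?d - 1) / \<beta>))"
      by (rule Liminf_risk_level_set_bumps[OF assms(1,2,3,9,5,6,7) level(1)])
    then show ?thesis using level by (simp add: rate_def)
  next
    case smooth
    \<comment> \<open>A fixed sine as outer function is bounded above and below by linear functions
      on the range of the inner bump, so the height \<open>h powr \<beta>\<close> survives. The
      factor \<open>cos 1\<close> in \<open>c\<close> is the slope in
      \<open>sin_ge_linear\<close>.\<close>
    have "?R (2 * \<beta> / (2 * \<beta> + ?d))"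
    proof (rule inner_bumps[where f = "\<lambda>h u. B * sin u" and c = "B * A * cos 1 / 2" and K = "B * A"])
      fix h :: real assume h: "0 < h" "h \<le> 1"
      then have h\<beta>: "0 < h powr \<beta>" "h powr \<beta> \<le> 1" using assms by (auto intro: powr_le1)
      then have Ah: "0 \<le> A * h powr \<beta>" "A * h powr \<beta> \<le> 1" using A by (auto intro: mult_le_one)
      show "2 * (B * A * cos 1 / 2) * h powr \<beta> \<le> B * sin (A * h powr \<beta>)"
        using mult_left_mono[OF sin_ge_linear[OF Ah], of B] B by (simp add: mult_ac)
      fix u :: real assume u: "0 \<le> u" "u \<le> A * h powr \<beta>"
      have "\<bar>sin u\<bar> \<le> A * h powr \<beta>" using abs_sin_x_le_abs_x[of u] u by linarith
      then show "\<bar>B * sin u\<bar> \<le> B * A * h powr \<beta>" using B by (simp add: abs_mult mult_ac)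
    qed (use A B assms cos_1_pos in \<open>auto intro!: continuous_intros\<close>)
    moreover have "2 * \<beta> / (2 * \<beta> + ?d) = 2 / (2 + ?d / \<beta>)" using assms by (simp add: field_simps)
    ultimately show ?thesis using smooth by (simp add: rate_def)
  next
    case rough
    have sinA: "0 < sin A" using A pi_gt3 by (intro sin_gt_zero) auto
    \<comment> \<open>The sine is rescaled to the height \<open>h powr \<beta>\<close> of the inner
      bump and there reaches \<open>h powr (\<gamma> * \<beta>)\<close>, the largest order that the
      Hoelder condition with \<open>\<gamma> \<le> 1\<close> allows at that distance from a
      zero.\<close>
    define f where "f h u = (h powr \<beta>) powr \<gamma> * (B * sin ((u - 0) /\<^sub>R (h powr \<beta>)))" for h u
    have "?R (2 * (\<gamma> * \<beta>) / (2 * (\<gamma> * \<beta>) + ?d))"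
    proof (rule inner_bumps[where f = f and c = "B * sin A / 2" and K = B])
      fix h :: real assume h: "0 < h" "h \<le> 1"
      then have h\<beta>: "0 < h powr \<beta>" "h powr \<beta> \<le> 1" using assms by (auto intro: powr_le1)
      have pw: "(h powr \<beta>) powr \<gamma> = h powr (\<gamma> * \<beta>)" by (simp add: powr_powr mult.commute)
      show "f h \<in> hoelder \<gamma> L1"
        unfolding f_def[abs_def] using B h\<beta> assms by (intro hoelder_dilation[of "\<lambda>u. B * sin u"]) auto
      show "2 * (B * sin A / 2) * h powr (\<gamma> * \<beta>) \<le> f h (A * h powr \<beta>)"
        using h\<beta> h by (simp add: f_def pw mult_ac)
      fix u :: real
      show "\<bar>f h u\<bar> \<le> B * h powr (\<gamma> * \<beta>)"
        unfolding f_def pw using B by (simp add: abs_mult mult_left_le mult_ac)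
    next
      show "continuous_on UNIV (f h)" for h
        unfolding f_def by (intro continuous_intros)
    qed (use A B assms sinA in \<open>auto simp: f_def\<close>)
    moreover have "2 * (\<gamma> * \<beta>) / (2 * (\<gamma> * \<beta>) + ?d) = 2 / (2 + ?d / (\<gamma> * \<beta>))"
      using assms by (simp add: field_simps)
    ultimately show ?thesis using rough by (auto simp: rate_def)
  qed
qed

end
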